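(* Given any partition $\lambda$ of $n$ and any composition $\omega$ of $n$, the question of whether $K_{\lambda\omega}=1$ can be answered in polynomial time (that is, in time polynomial in $\mathrm{size}(\lambda,\omega)$).
   Context: A partition of $n$ is a weakly decreasing finite sequence of positive integers with sum $n$; a composition of $n$ is a finite sequence $\omega=(\omega_1,\ldots,\omega_l)$ of non-negative integers with sum $n$. A semistandard Young tableau of shape $\lambda$ is a filling of the Young diagram of $\lambda$ by positive integers, weakly increasing along rows and strictly increasing down columns; its weight is the sequence whose $i$-th entry is the number of times $i$ occurs. $K_{\lambda\omega}$ is the number of semistandard Young tableaux of shape $\lambda$ and weight $\omega$. The input is the pair of tuples $\lambda,\omega$, and $\mathrm{size}(\lambda,\omega)$ denotes the number of bits used to describe these tuples (with integers written in binary). *)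

theory Defs
  imports "HOL-Computational_Algebra.Polynomial"
begin

section \<open>Kostka numbers\<close>

definition partition_of :: "nat \<Rightarrow> nat list \<Rightarrow> bool" where
  "partition_of n lam \<longleftrightarrow> sorted_wrt (\<ge>) lam \<and> (\<forall>x\<in>set lam. 0 < x) \<and> sum_list lam = n"

definition composition_of :: "nat \<Rightarrow> nat list \<Rightarrow> bool" where
  "composition_of n om \<longleftrightarrow> sum_list om = n"

text \<open>A filling is given by the list of its rows.\<close>

definition semistandard :: "nat list \<Rightarrow> nat list list \<Rightarrow> bool" where
  "semistandard lam T \<longleftrightarrow>
     map length T = lam \<and>
     (\<forall>row\<in>set T. (\<forall>x\<in>set row. 0 < x) \<and> sorted_wrt (\<le>) row) \<and>
     (\<forall>i j. Suc i < length T \<longrightarrow> j < length (T ! Suc i) \<longrightarrow> T ! i ! j < T ! Suc i ! j)"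

definition weight :: "nat list list \<Rightarrow> nat \<Rightarrow> nat" where
  "weight T i = count_list (concat T) i"

text \<open>A composition is read as an infinite sequence by appending zeros, so entries larger than
  its length are not allowed to occur.  Entries of a tableau count from 1, list positions
  from 0.\<close>

definition has_weight :: "nat list list \<Rightarrow> nat list \<Rightarrow> bool" where
  "has_weight T om \<longleftrightarrow>
     (\<forall>i\<ge>1. weight T i = (if i \<le> length om then om ! (i - 1) else 0))"

definition ssyt :: "nat list \<Rightarrow> nat list \<Rightarrow> nat list list set" where
  "ssyt lam om = {T. semistandard lam T \<and> has_weight T om}"

definition kostka :: "nat list \<Rightarrow> nat list \<Rightarrow> nat" where
  "kostka lam om = card (ssyt lam om)"

lemma finite_ssyt: "finite (ssyt lam om)"
proof -
  let ?R = "{row. set row \<subseteq> {..length om} \<and> length row \<le> sum_list lam}"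
  have "finite {T. set T \<subseteq> ?R \<and> length T = length lam}"
    by (intro finite_lists_length_eq finite_lists_length_le) auto
  moreover have "ssyt lam om \<subseteq> {T. set T \<subseteq> ?R \<and> length T = length lam}"
  proof
    fix T assume "T \<in> ssyt lam om"
    then have len: "map length T = lam" and w: "has_weight T om"
      and pos: "\<forall>row\<in>set T. \<forall>x\<in>set row. 0 < x"
      by (auto simp: ssyt_def semistandard_def)
    have "x \<le> length om" if "row \<in> set T" "x \<in> set row" for row x
    proof (rule ccontr)
      assume "\<not> x \<le> length om"
      then have "count_list (concat T) x = 0"
        using w pos that by (auto simp: has_weight_def weight_def)
      then show False using that by (auto simp: count_list_0_iff)
    qed
    moreover have "length row \<le> sum_list lam" if "row \<in> set T" for row
      using that len by (auto intro!: member_le_sum_list)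
    ultimately show "T \<in> {T. set T \<subseteq> ?R \<and> length T = length lam}"
      using len by auto
  qed
  ultimately show ?thesis by (rule rev_finite_subset)
qed


section \<open>The input as a bit string\<close>

text \<open>Binary notation, most significant bit first; zero is written as the single digit 0.\<close>

fun binary :: "nat \<Rightarrow> bool list" where
  "binary n = (if n < 2 then [n = 1] else binary (n div 2) @ [odd n])"

declare binary.simps [simp del]

text \<open>Tuples are first written over the four letters 0, 1, comma, semicolon, as in
  \<open>11,10,;1,0,100,;\<close> for the pair of \<open>(3,2)\<close> and \<open>(1,0,4)\<close>.  Each of the four letters then
  takes two bits: \<open>00\<close>, \<open>01\<close>, \<open>10\<close> and \<open>11\<close>.\<close>

definition encode_nat :: "nat \<Rightarrow> bool list" where
  "encode_nat n = concat (map (\<lambda>b. [False, b]) (binary n)) @ [True, False]"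

definition encode_tuple :: "nat list \<Rightarrow> bool list" where
  "encode_tuple xs = concat (map encode_nat xs) @ [True, True]"

definition encode_input :: "nat list \<Rightarrow> nat list \<Rightarrow> bool list" where
  "encode_input lam om = encode_tuple lam @ encode_tuple om"

definition input_size :: "nat list \<Rightarrow> nat list \<Rightarrow> nat" where
  "input_size lam om = length (encode_input lam om)"


section \<open>Deterministic multi-tape Turing machines\<close>

text \<open>States and tape symbols are initial segments of the natural numbers.  The symbol 0 is
  the blank; 1 and 2 stand for the input bits 0 and 1.\<close>

datatype move = Move_Left | Stay | Move_Right

record tm =
  tm_tapes :: nat
  tm_states :: nat
  tm_symbols :: nat
  tm_start :: nat
  tm_accept :: nat
  tm_reject :: nat
  tm_delta :: "nat \<Rightarrow> nat list \<Rightarrow> nat \<times> (nat \<times> move) list"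

definition turing_machine :: "tm \<Rightarrow> bool" where
  "turing_machine M \<longleftrightarrow>
     1 \<le> tm_tapes M \<and> 3 \<le> tm_symbols M \<and>
     tm_start M < tm_states M \<and> tm_accept M < tm_states M \<and> tm_reject M < tm_states M \<and>
     tm_accept M \<noteq> tm_reject M \<and>
     (\<forall>q < tm_states M. \<forall>ss. length ss = tm_tapes M \<and> set ss \<subseteq> {..<tm_symbols M} \<longrightarrow>
        fst (tm_delta M q ss) < tm_states M \<and>
        length (snd (tm_delta M q ss)) = tm_tapes M \<and>
        (\<forall>(s, d) \<in> set (snd (tm_delta M q ss)). s < tm_symbols M))"

text \<open>Tapes are infinite in both directions; a tape is its content and the head position.\<close>

type_synonym tape = "(int \<Rightarrow> nat) \<times> int"
type_synonym tm_config = "nat \<times> tape list"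

definition tape_read :: "tape \<Rightarrow> nat" where
  "tape_read t = fst t (snd t)"

definition move_offset :: "move \<Rightarrow> int" where
  "move_offset d = (case d of Move_Left \<Rightarrow> - 1 | Stay \<Rightarrow> 0 | Move_Right \<Rightarrow> 1)"

definition tape_act :: "nat \<times> move \<Rightarrow> tape \<Rightarrow> tape" where
  "tape_act a t = ((fst t)(snd t := fst a), snd t + move_offset (snd a))"

text \<open>The accepting and the rejecting state are halting: configurations in them do not change
  any more.\<close>

definition tm_step :: "tm \<Rightarrow> tm_config \<Rightarrow> tm_config" where
  "tm_step M c = (case c of (q, ts) \<Rightarrow>
     if q = tm_accept M \<or> q = tm_reject M then c
     else let (q', acts) = tm_delta M q (map tape_read ts) in (q', map2 tape_act acts ts))"

definition blank_tape :: tape where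
  "blank_tape = (\<lambda>_. 0, 0)"

definition input_tape :: "bool list \<Rightarrow> tape" where
  "input_tape w =
     (\<lambda>i. if 0 \<le> i \<and> i < int (length w) then (if w ! nat i then 2 else 1) else 0, 0)"

definition tm_initial :: "tm \<Rightarrow> bool list \<Rightarrow> tm_config" where
  "tm_initial M w = (tm_start M, input_tape w # replicate (tm_tapes M - 1) blank_tape)"

definition accepts_within :: "tm \<Rightarrow> bool list \<Rightarrow> nat \<Rightarrow> bool" where
  "accepts_within M w t \<longleftrightarrow> fst ((tm_step M ^^ t) (tm_initial M w)) = tm_accept M"

definition rejects_within :: "tm \<Rightarrow> bool list \<Rightarrow> nat \<Rightarrow> bool" where
  "rejects_within M w t \<longleftrightarrow> fst ((tm_step M ^^ t) (tm_initial M w)) = tm_reject M"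

end

theory Submission
  imports Defs
begin

text \<open>Removing the largest letter of a tableau counts tableaux by Gelfand--Tsetlin patterns, and
  reflecting one row of a pattern shows that the weight may be sorted. When the smallest part of a
  sorted weight is removed, the next row with the largest partial sums is explicit; it is admissible iff
  the partition dominates the weight, and any other admissible row differs from it by moving boxes
  between two rows. This yields the criterion of Berenstein and Zelevinsky by induction: the number is 1
  iff the partition dominates the weight and between two consecutive equal partial sums there is
  essentially at most one descent. A machine decides this by sorting the weight and one scan that
  maintains the difference of the partial sums in binary.\<close>

section \<open>Kostka numbers and Gelfand--Tsetlin patterns\<close>

text \<open>Integers are written in binary, so the boxes of the diagram may be exponentially many;
  only the number of parts and their bit lengths are bounded by the input size. Hence the decision
  has to rest on partial sums alone. The induction uses that a sum of natural numbers is 1 iff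
  exactly one term is non-zero and that term is 1. Therefore non-vanishing and being 1 are
  characterized together, and each step only needs one distinguished candidate row and the question
  whether there is another. Removing a smallest part matters: below the row where the removed strip
  begins to be forced, all parts of the partition are smaller than every part of the weight, which
  makes the partial sums strictly apart there. The delicate point is that descents near this row are
  not preserved one by one: one descent of the partition may turn into two of the next row, or into
  the freedom to move a box. For the machine, a small stack language whose remaining commands serve
  as states replaces explicit transition tables; its running times are upper bounds with generous
  constants.\<close>

definition nth0 :: "nat list \<Rightarrow> nat \<Rightarrow> nat" where
  "nth0 xs i = (if i < length xs then xs ! i else 0)"

text \<open>The admissible rows directly below a row of \<open>Suc N\<close> entries in a
  Gelfand--Tsetlin pattern. Since \<open>nu\<close> vanishes from \<open>N\<close> on, interlacing
  forces \<open>lam\<close> to vanish from \<open>Suc N\<close> on, so both sums are full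
  sizes.\<close>

definition strip :: "nat \<Rightarrow> (nat \<Rightarrow> nat) \<Rightarrow> nat \<Rightarrow> (nat \<Rightarrow> nat) set" where
  "strip N lam m = {nu. (\<forall>i. lam (Suc i) \<le> nu i \<and> nu i \<le> lam i) \<and> (\<forall>i\<ge>N. nu i = 0) \<and>
     sum nu {..<N} + m = sum lam {..<Suc N}}"

lemma finite_strip: "finite (strip N lam m)"
proof (rule finite_subset)
  let ?B = "{..sum lam {..<N}}"
  show "strip N lam m \<subseteq> {f. \<forall>x. (x \<in> {..<N} \<longrightarrow> f x \<in> ?B) \<and> (x \<notin> {..<N} \<longrightarrow> f x = 0)}"
  proof
    fix nu assume nu: "nu \<in> strip N lam m"
    have "nu x \<le> sum lam {..<N}" if "x < N" for x
    proof -
      have "nu x \<le> lam x" using nu by (simp add: strip_def)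
      also have "\<dots> \<le> sum lam {..<N}" using that by (intro member_le_sum) auto
      finally show ?thesis .
    qed
    then show "nu \<in> {f. \<forall>x. (x \<in> {..<N} \<longrightarrow> f x \<in> ?B) \<and> (x \<notin> {..<N} \<longrightarrow> f x = 0)}"
      using nu by (auto simp: strip_def)
  qed
  show "finite {f. \<forall>x. (x \<in> {..<N} \<longrightarrow> f x \<in> ?B) \<and> (x \<notin> {..<N} \<longrightarrow> f x = (0::nat))}"
    by (rule finite_set_of_finite_funs) auto
qed

text \<open>The number of Gelfand--Tsetlin patterns with top row \<open>lam\<close>; the list of parts of the weight is
  read from the last row downwards, so it is the reverse of the weight of the tableaux.\<close>

fun patterns :: "(nat \<Rightarrow> nat) \<Rightarrow> nat list \<Rightarrow> nat" where
  "patterns lam [] = (if \<forall>i. lam i = 0 then 1 else 0)"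
| "patterns lam (m # ms) = (\<Sum>nu\<in>strip (length ms) lam m. patterns nu ms)"

text \<open>Interlacing puts a non-zero entry at \<open>Suc j\<close> above a non-zero entry at
  \<open>j\<close> of the next row, which has one position less. This reflects that columns are no
  longer than the number of letters.\<close>

lemma patterns_zero: "length ms \<le> i \<Longrightarrow> lam i \<noteq> 0 \<Longrightarrow> patterns lam ms = 0"
proof (cases ms)
  case (Cons m ms')
  assume "length ms \<le> i" "lam i \<noteq> 0"
  with Cons obtain j where "i = Suc j" "length ms' \<le> j" by (cases i) auto
  moreover have "lam (Suc j) \<le> nu j" "nu j = 0" if "nu \<in> strip (length ms') lam m" for nu
    using that \<open>length ms' \<le> j\<close> unfolding strip_def by blast+
  ultimately have "nu \<notin> strip (length ms') lam m" for nu
    using \<open>lam i \<noteq> 0\<close> by (metis le_zero_eq)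
  then have "strip (length ms') lam m = {}" by blast
  then show ?thesis using Cons by simp
qed auto

section \<open>Deleting the largest letter of a tableau\<close>

lemma sorted_row_split:
  fixes row :: "nat list"
  assumes "sorted row" "\<forall>x\<in>set row. x \<le> Suc l"
  shows "row = filter (\<lambda>x. x \<le> l) row @
    replicate (length row - length (filter (\<lambda>x. x \<le> l) row)) (Suc l)"
  using assms
proof (induction row)
  case (Cons x row)
  show ?case
  proof (cases "x \<le> l")
    case True
    then show ?thesis using Cons by (simp add: Suc_diff_le)
  next
    case False
    then have "\<forall>y\<in>set (x # row). y = Suc l" using Cons.prems by fastforce
    then have "filter (\<lambda>y. y \<le> l) (x # row) = []" "x # row = replicate (length (x # row)) (Suc l)"
      using replicate_length_same[of "x # row" "Suc l"] by (auto simp: filter_empty_conv)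
    then show ?thesis by (simp only: list.size(3) append_Nil diff_zero)
  qed
qed simp

text \<open>The letters up to \<open>l\<close> form an initial segment of a sorted row, so comparing
  an entry with \<open>l\<close> amounts to comparing its column with the length of that
  segment.\<close>

lemma filter_row_nth:
  fixes row :: "nat list"
  assumes "sorted row" "\<forall>x\<in>set row. x \<le> Suc l" "j < length row"
  shows "row ! j \<le> l \<longleftrightarrow> j < length (filter (\<lambda>x. x \<le> l) row)"
    and "j < length (filter (\<lambda>x. x \<le> l) row) \<Longrightarrow> filter (\<lambda>x. x \<le> l) row ! j = row ! j"
proof -
  let ?f = "filter (\<lambda>x. x \<le> l) row"
  have eq: "row = ?f @ replicate (length row - length ?f) (Suc l)"
    by (rule sorted_row_split[OF assms(1,2)])
  show nth: "?f ! j = row ! j" if "j < length ?f"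
    using that by (subst (2) eq) (simp add: nth_append)
  show "row ! j \<le> l \<longleftrightarrow> j < length ?f"
  proof (cases "j < length ?f")
    case True
    then show ?thesis using nth nth_mem[OF True] by auto
  next
    case False
    then have "row ! j = Suc l" using assms(3) by (subst eq) (simp add: nth_append)
    then show ?thesis using False by simp
  qed
qed

lemma count_list_filter: "count_list (filter P xs) i = (if P i then count_list xs i else 0)"
  by (induction xs) auto

text \<open>The list version of \<open>strip\<close> keeps the length of \<open>lam\<close>, with
  trailing zeros for rows that became empty, because deleting letters from a tableau keeps its list
  of rows. For this reason the recursion is stated for decreasing lists, not for partitions.\<close>

definition list_strip :: "nat list \<Rightarrow> nat \<Rightarrow> nat list set" where
  "list_strip lam m = {nu. length nu = length lam \<and>
     (\<forall>i. nth0 lam (Suc i) \<le> nth0 nu i \<and> nth0 nu i \<le> nth0 lam i) \<and>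
     sum_list nu + m = sum_list lam}"

lemma ssyt_entries:
  assumes "has_weight T om" "row \<in> set T" "x \<in> set row" "0 < x"
  shows "x \<le> length om"
proof (rule ccontr)
  assume "\<not> x \<le> length om"
  then have "count_list (concat T) x = 0" using assms by (auto simp: has_weight_def weight_def)
  then show False using assms by (auto simp: count_list_0_iff)
qed

text \<open>Deleting the entries equal to the largest letter \<open>Suc l\<close> is a bijection from tableaux to pairs
  of a horizontal strip and a smaller tableau; \<open>extend_rows\<close> is the inverse map.\<close>

definition restrict_entries :: "nat \<Rightarrow> nat list list \<Rightarrow> nat list list" where
  "restrict_entries l T = map (filter (\<lambda>x. x \<le> l)) T"

definition extend_rows :: "nat \<Rightarrow> nat list \<Rightarrow> nat list list \<Rightarrow> nat list list" where
  "extend_rows l lam T = map2 (\<lambda>row k. row @ replicate (k - length row) (Suc l)) T lam"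

lemma concat_restrict: "concat (restrict_entries l T) = filter (\<lambda>x. x \<le> l) (concat T)"
  by (simp add: restrict_entries_def filter_concat)

lemma length_count_top:
  assumes "\<forall>x\<in>set xs. x \<le> Suc l"
  shows "length (filter (\<lambda>x. x \<le> l) xs) + count_list xs (Suc l) = length xs"
  using assms by (induction xs) auto

lemma sum_list_shape: "map length T = lam \<Longrightarrow> length (concat T) = sum_list lam"
  by (simp add: length_concat)

text \<open>The lower interlacing bound is column strictness: below a column where row
  \<open>i\<close> already contains \<open>Suc l\<close> there can be no box, as its entry would
  exceed \<open>Suc l\<close>. So row \<open>Suc i\<close> is no longer than the part of row
  \<open>i\<close> that survives.\<close>

lemma restrict_ssyt:
  assumes sorted: "sorted_wrt (\<ge>) lam" and T: "T \<in> ssyt lam (om @ [m])"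
  defines "l \<equiv> length om"
  shows "map length (restrict_entries l T) \<in> list_strip lam m"
    "restrict_entries l T \<in> ssyt (map length (restrict_entries l T)) om"
    "extend_rows l lam (restrict_entries l T) = T"
proof -
  let ?R = "restrict_entries l T" and ?nu = "map length (restrict_entries l T)"
  have len: "map length T = lam" and rows: "\<And>row. row \<in> set T \<Longrightarrow> sorted row"
    and pos: "\<And>row x. row \<in> set T \<Longrightarrow> x \<in> set row \<Longrightarrow> 0 < x"
    and col: "\<And>i j. Suc i < length T \<Longrightarrow> j < length (T ! Suc i) \<Longrightarrow> T ! i ! j < T ! Suc i ! j"
    and w: "has_weight T (om @ [m])"
    using T by (auto simp: ssyt_def semistandard_def)
  have le: "\<forall>x\<in>set row. x \<le> Suc l" if "row \<in> set T" for row
    using ssyt_entries[OF w that] pos that by (auto simp: l_def)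
  have lenT: "length T = length lam" using len by auto
  have nthlen: "length (T ! i) = lam ! i" if "i < length lam" for i
    using that len by auto
  have dec: "length (T ! Suc i) \<le> length (T ! i)" if "Suc i < length T" for i
    using sorted that nthlen lenT by (auto simp: sorted_wrt_iff_nth_less)
  have top: "length (concat ?R) + m = sum_list lam"
  proof -
    have "count_list (concat T) (Suc l) = m"
      using w by (auto simp: has_weight_def weight_def l_def nth_append)
    then show ?thesis
      using length_count_top[of "concat T" l] le sum_list_shape[OF len]
      by (auto simp: concat_restrict)
  qed
  show "?nu \<in> list_strip lam m"
  proof -
    have "nth0 lam (Suc i) \<le> nth0 ?nu i \<and> nth0 ?nu i \<le> nth0 lam i" for i
    proof (cases "i < length lam")
      case True
      have up: "nth0 ?nu i \<le> nth0 lam i"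
        using True lenT nthlen[OF True] length_filter_le[of "\<lambda>x. x \<le> l" "T ! i"]
        by (simp add: nth0_def restrict_entries_def)
      have "nth0 lam (Suc i) \<le> nth0 ?nu i"
      proof (cases "Suc i < length lam")
        case Suc: True
        show ?thesis
        proof (rule ccontr)
          let ?j = "length (filter (\<lambda>x. x \<le> l) (T ! i))"
          assume "\<not> ?thesis"
          then have j: "?j < length (T ! Suc i)"
            using Suc lenT nthlen[OF Suc] by (simp add: nth0_def restrict_entries_def)
          have "T ! i ! ?j < T ! Suc i ! ?j" using col j Suc lenT by simp
          moreover have "T ! Suc i ! ?j \<le> Suc l"
            using le[of "T ! Suc i"] Suc lenT j nth_mem[of ?j "T ! Suc i"] by simp
          ultimately have "T ! i ! ?j \<le> l" by simp
          moreover have "?j < length (T ! i)" using j dec[of i] Suc lenT by simp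
          ultimately show False
            using filter_row_nth(1)[of "T ! i" l ?j] rows[of "T ! i"] le[of "T ! i"] True lenT
            by simp
        qed
      qed (simp add: nth0_def)
      then show ?thesis using up by simp
    qed (simp add: nth0_def lenT restrict_entries_def)
    then show ?thesis using top lenT sum_list_shape[of ?R ?nu]
      by (simp add: list_strip_def restrict_entries_def)
  qed
  show "?R \<in> ssyt ?nu om"
  proof -
    have "?R ! i ! j < ?R ! Suc i ! j" if i: "Suc i < length ?R" and j: "j < length (?R ! Suc i)" for i j
    proof -
      let ?a = "T ! i" and ?b = "T ! Suc i"
      have ab: "?a \<in> set T" "?b \<in> set T" using i by (auto simp: restrict_entries_def)
      have R: "?R ! i = filter (\<lambda>x. x \<le> l) ?a" "?R ! Suc i = filter (\<lambda>x. x \<le> l) ?b"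
        using i by (simp_all add: restrict_entries_def)
      have jb: "j < length ?b" by (rule less_le_trans[OF _ length_filter_le]) (use j R in simp)
      then have ja: "j < length ?a" using dec[of i] i by (simp add: restrict_entries_def)
      have b: "?b ! j \<le> l" "?R ! Suc i ! j = ?b ! j"
        using filter_row_nth[OF rows[OF ab(2)] le[OF ab(2)] jb] j R by simp_all
      have lt: "?a ! j < ?b ! j" using col i jb by (simp add: restrict_entries_def)
      then have "?R ! i ! j = ?a ! j"
        using filter_row_nth[OF rows[OF ab(1)] le[OF ab(1)] ja] b R by simp
      then show ?thesis using lt b by simp
    qed
    moreover have "has_weight ?R om"
      using w by (auto simp: has_weight_def weight_def concat_restrict count_list_filter l_def nth_append)
    ultimately show ?thesis using rows pos
      by (auto simp: ssyt_def semistandard_def restrict_entries_def intro: sorted_wrt_filter)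
  qed
  show "extend_rows l lam ?R = T"
  proof (rule nth_equalityI)
    show "length (extend_rows l lam ?R) = length T" using lenT by (simp add: extend_rows_def restrict_entries_def)
    fix i assume "i < length (extend_rows l lam ?R)"
    then have i: "i < length T" "i < length lam" using lenT by (auto simp: extend_rows_def restrict_entries_def)
    then have "extend_rows l lam ?R ! i = filter (\<lambda>x. x \<le> l) (T ! i) @
        replicate (length (T ! i) - length (filter (\<lambda>x. x \<le> l) (T ! i))) (Suc l)"
      using nthlen by (simp add: extend_rows_def restrict_entries_def)
    also have "\<dots> = T ! i"
      using sorted_row_split[of "T ! i" l] rows[of "T ! i"] le[of "T ! i"] i by simp
    finally show "extend_rows l lam ?R ! i = T ! i" .
  qed
qed

text \<open>Conversely, a new letter in row \<open>Suc i\<close> lies in a column below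
  \<open>lam ! Suc i\<close>, hence below \<open>nu ! i\<close>; the entry above it is an old one,
  at most \<open>l\<close>.\<close>

lemma extend_ssyt:
  assumes nu: "nu \<in> list_strip lam m" and T: "T \<in> ssyt nu om"
  defines "l \<equiv> length om"
  shows "extend_rows l lam T \<in> ssyt lam (om @ [m])" "restrict_entries l (extend_rows l lam T) = T"
proof -
  let ?E = "extend_rows l lam T"
  have len: "map length T = nu" and rows: "\<And>row. row \<in> set T \<Longrightarrow> sorted row"
    and pos: "\<And>row x. row \<in> set T \<Longrightarrow> x \<in> set row \<Longrightarrow> 0 < x"
    and col: "\<And>i j. Suc i < length T \<Longrightarrow> j < length (T ! Suc i) \<Longrightarrow> T ! i ! j < T ! Suc i ! j"
    and w: "has_weight T om"
    using T by (auto simp: ssyt_def semistandard_def)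
  have le: "\<forall>x\<in>set row. x \<le> l" if "row \<in> set T" for row
    using ssyt_entries[OF w that] pos that by (auto simp: l_def)
  have L: "length nu = length lam" "length T = length lam" using nu len by (auto simp: list_strip_def)
  have nul: "length (T ! i) = nu ! i" if "i < length lam" for i using that len L by auto
  have bounds: "nth0 lam (Suc i) \<le> nth0 nu i" "nth0 nu i \<le> nth0 lam i" for i
    using nu by (auto simp: list_strip_def)
  have up: "nu ! i \<le> lam ! i" if "i < length lam" for i
    using bounds(2)[of i] that L by (simp add: nth0_def)
  have low: "lam ! Suc i \<le> nu ! i" if "Suc i < length lam" for i
    using bounds(1)[of i] that L by (simp add: nth0_def)
  have E: "?E ! i = T ! i @ replicate (lam ! i - nu ! i) (Suc l)" if "i < length lam" for i
    using that L nul by (simp add: extend_rows_def)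
  have lenE: "length ?E = length lam" using L by (simp add: extend_rows_def)
  show res: "restrict_entries l ?E = T"
  proof (rule nth_equalityI)
    fix i assume "i < length (restrict_entries l ?E)"
    then have i: "i < length lam" using lenE by (simp add: restrict_entries_def)
    have "T ! i \<in> set T" using i L by simp
    then have "filter (\<lambda>x. x \<le> l) (T ! i) = T ! i" using le by (simp add: filter_id_conv)
    then show "restrict_entries l ?E ! i = T ! i" using i lenE E by (simp add: restrict_entries_def)
  qed (use L lenE in \<open>simp add: restrict_entries_def\<close>)
  have shape: "map length ?E = lam"
    by (rule nth_equalityI) (use lenE E nul up in auto)
  have Erow: "row \<in> set ?E \<Longrightarrow> \<exists>i<length lam. row = T ! i @ replicate (lam ! i - nu ! i) (Suc l)" for row
    using E lenE by (auto simp: in_set_conv_nth)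
  have Ele: "\<forall>x\<in>set row. 0 < x \<and> x \<le> Suc l" "sorted row" if r: "row \<in> set ?E" for row
  proof -
    obtain i where i: "i < length lam" "row = T ! i @ replicate (lam ! i - nu ! i) (Suc l)"
      using Erow[OF r] by blast
    have "T ! i \<in> set T" using i L by simp
    then show "\<forall>x\<in>set row. 0 < x \<and> x \<le> Suc l" "sorted row"
      using i le[of "T ! i"] pos[of "T ! i"] rows[of "T ! i"]
      by (auto simp: sorted_append le_SucI)
  qed
  have "?E ! i ! j < ?E ! Suc i ! j" if i: "Suc i < length ?E" and j: "j < length (?E ! Suc i)" for i j
  proof -
    have i': "i < length lam" "Suc i < length lam" using i lenE by auto
    have "length (?E ! Suc i) = lam ! Suc i" using shape i' lenE by (metis nth_map)
    then have jn: "j < nu ! i" using j low[OF i'(2)] by simp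
    then have a: "?E ! i ! j = T ! i ! j" using E[OF i'(1)] nul[OF i'(1)] by (simp add: nth_append)
    show ?thesis
    proof (cases "j < nu ! Suc i")
      case True
      then have "?E ! Suc i ! j = T ! Suc i ! j"
        using E[OF i'(2)] nul[OF i'(2)] by (simp add: nth_append)
      then show ?thesis using a col[of i j] True nul[OF i'(2)] i' L by simp
    next
      case False
      then have "?E ! Suc i ! j = Suc l"
        using E[OF i'(2)] nul[OF i'(2)] j by (simp add: nth_append)
      moreover have "T ! i ! j \<le> l"
        using le[of "T ! i"] jn nul[OF i'(1)] i' L by simp
      ultimately show ?thesis using a by simp
    qed
  qed
  moreover have "has_weight ?E (om @ [m])"
    unfolding has_weight_def weight_def
  proof (intro allI impI)
    fix i :: nat assume i: "1 \<le> i"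
    have Eall: "\<forall>x\<in>set (concat ?E). x \<le> Suc l" using Ele by auto
    consider "i \<le> l" | "i = Suc l" | "i > Suc l" by linarith
    then show "count_list (concat ?E) i = (if i \<le> length (om @ [m]) then (om @ [m]) ! (i - 1) else 0)"
    proof cases
      case 1
      then have "count_list (concat ?E) i = count_list (concat T) i"
        using count_list_filter[of "\<lambda>x. x \<le> l" "concat ?E" i] res concat_restrict[of l ?E] by simp
      then show ?thesis using w 1 i by (auto simp: has_weight_def weight_def l_def nth_append)
    next
      case 2
      have "length (concat T) + count_list (concat ?E) (Suc l) = length (concat ?E)"
        using length_count_top[OF Eall] res concat_restrict[of l ?E] by simp
      then have "sum_list nu + count_list (concat ?E) (Suc l) = sum_list lam"
        using sum_list_shape[OF len] sum_list_shape[OF shape] by simp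
      then have "count_list (concat ?E) (Suc l) = m" using nu by (simp add: list_strip_def)
      then show ?thesis using 2 by (simp add: l_def)
    next
      case 3
      then have "i \<notin> set (concat ?E)" using Eall by force
      then have "count_list (concat ?E) i = 0" by (simp only: count_list_0_iff not_False_eq_True)
      then show ?thesis using 3 by (simp add: l_def)
    qed
  qed
  ultimately show "?E \<in> ssyt lam (om @ [m])"
    using Ele shape by (auto simp: ssyt_def semistandard_def)
qed

lemma finite_list_strip: "finite (list_strip lam m)"
proof (rule finite_subset)
  show "list_strip lam m \<subseteq> {nu. set nu \<subseteq> {..sum_list lam} \<and> length nu = length lam}"
  proof
    fix nu assume nu: "nu \<in> list_strip lam m"
    have "x \<le> sum_list lam" if "x \<in> set nu" for x
      using member_le_sum_list[OF that] nu by (simp add: list_strip_def)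
    then show "nu \<in> {nu. set nu \<subseteq> {..sum_list lam} \<and> length nu = length lam}"
      using nu by (auto simp: list_strip_def)
  qed
qed (rule finite_lists_length_eq, simp)

lemma kostka_snoc:
  assumes "sorted_wrt (\<ge>) lam"
  shows "kostka lam (om @ [m]) = (\<Sum>nu\<in>list_strip lam m. kostka nu om)"
proof -
  let ?l = "length om"
  have "bij_betw (restrict_entries ?l) (ssyt lam (om @ [m])) (\<Union>nu\<in>list_strip lam m. ssyt nu om)"
  proof (rule bij_betw_byWitness[where f' = "extend_rows ?l lam"])
    show "restrict_entries ?l ` ssyt lam (om @ [m]) \<subseteq> (\<Union>nu\<in>list_strip lam m. ssyt nu om)"
    proof (rule image_subsetI)
      fix T assume T: "T \<in> ssyt lam (om @ [m])"
      show "restrict_entries ?l T \<in> (\<Union>nu\<in>list_strip lam m. ssyt nu om)"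
        using restrict_ssyt(1,2)[OF assms T] by (rule UN_I[where B = "\<lambda>nu. ssyt nu om"])
    qed
    show "\<forall>T\<in>ssyt lam (om @ [m]). extend_rows ?l lam (restrict_entries ?l T) = T"
      by (intro ballI restrict_ssyt(3)[OF assms])
    show "\<forall>T\<in>(\<Union>nu\<in>list_strip lam m. ssyt nu om). restrict_entries ?l (extend_rows ?l lam T) = T"
    proof (intro ballI, elim UN_E)
      fix T nu assume "nu \<in> list_strip lam m" "T \<in> ssyt nu om"
      then show "restrict_entries ?l (extend_rows ?l lam T) = T" by (rule extend_ssyt(2))
    qed
    show "extend_rows ?l lam ` (\<Union>nu\<in>list_strip lam m. ssyt nu om) \<subseteq> ssyt lam (om @ [m])"
    proof (intro image_subsetI, elim UN_E)
      fix T nu assume "nu \<in> list_strip lam m" "T \<in> ssyt nu om"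
      then show "extend_rows ?l lam T \<in> ssyt lam (om @ [m])" by (rule extend_ssyt(1))
    qed
  qed
  then have "kostka lam (om @ [m]) = card (\<Union>nu\<in>list_strip lam m. ssyt nu om)"
    unfolding kostka_def by (rule bij_betw_same_card)
  also have "\<dots> = (\<Sum>nu\<in>list_strip lam m. card (ssyt nu om))"
  proof (rule card_UN_disjoint[OF finite_list_strip])
    show "\<forall>nu\<in>list_strip lam m. finite (ssyt nu om)" by (simp add: finite_ssyt)
    show "\<forall>nu\<in>list_strip lam m. \<forall>mu\<in>list_strip lam m. nu \<noteq> mu \<longrightarrow> ssyt nu om \<inter> ssyt mu om = {}"
    proof (intro ballI impI equals0I)
      fix nu mu T assume "nu \<noteq> mu" "T \<in> ssyt nu om \<inter> ssyt mu om"
      then have "map length T = nu" "map length T = mu"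
        unfolding ssyt_def semistandard_def by blast+
      with \<open>nu \<noteq> mu\<close> show False by blast
    qed
  qed
  finally show ?thesis by (simp add: kostka_def)
qed

section \<open>From tableaux to patterns of functions\<close>

lemma nth0_list_strip:
  assumes "nu \<in> list_strip lam m"
  shows "nth0 lam (Suc i) \<le> nth0 nu i" "nth0 nu i \<le> nth0 lam i"
  using assms by (auto simp: list_strip_def)

lemma sum_nth0: "length xs \<le> N \<Longrightarrow> sum (nth0 xs) {..<N} = sum_list xs"
proof -
  assume "length xs \<le> N"
  then have "sum (nth0 xs) {..<N} = sum (nth0 xs) {..<length xs}"
    by (intro sum.mono_neutral_right) (auto simp: nth0_def)
  also have "\<dots> = sum_list xs" by (simp add: sum_list_sum_nth atLeast0LessThan nth0_def)
  finally show ?thesis .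
qed

lemma sum_nth0_support: "\<forall>i\<ge>N. nth0 xs i = 0 \<Longrightarrow> sum (nth0 xs) {..<N} = sum_list xs"
proof -
  assume *: "\<forall>i\<ge>N. nth0 xs i = 0"
  have "sum (nth0 xs) {..<N} = sum (nth0 xs) {..<max N (length xs)}"
    by (rule sum.mono_neutral_left) (use * in auto)
  then show ?thesis by (simp add: sum_nth0)
qed

lemma kostka_patterns:
  "sorted_wrt (\<ge>) lam \<Longrightarrow> kostka lam om = patterns (nth0 lam) (rev om)"
proof (induction om arbitrary: lam rule: rev_induct)
  case Nil
  have "ssyt lam [] = (if \<forall>i. nth0 lam i = 0 then {map (\<lambda>_. []) lam} else {})"
  proof -
    have "concat T = []" if "T \<in> ssyt lam []" for T
    proof -
      have "x \<notin> set (concat T)" for x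
        using that ssyt_entries[of T "[]" _ x] by (fastforce simp: ssyt_def semistandard_def)
      then show ?thesis by (metis equals0I set_empty)
    qed
    then have sub: "T = map (\<lambda>_. []) lam \<and> (\<forall>i. nth0 lam i = 0)" if "T \<in> ssyt lam []" for T
    proof -
      have "\<forall>row\<in>set T. row = []" using \<open>\<And>T. T \<in> ssyt lam [] \<Longrightarrow> concat T = []\<close>[OF that] by simp
      have len: "map length T = lam" using that by (simp add: ssyt_def semistandard_def)
      have "length T = length lam" using len by (metis length_map)
      then have "T = map (\<lambda>_. []) lam"
        by (rule nth_equalityI[OF trans[OF _ length_map[symmetric]]])
           (use \<open>\<forall>row\<in>set T. row = []\<close> \<open>length T = length lam\<close> in simp)
      moreover have "\<forall>k\<in>set lam. k = 0" using len \<open>\<forall>row\<in>set T. row = []\<close> by auto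
      ultimately show ?thesis by (simp add: nth0_def)
    qed
    have "map (\<lambda>_. []) lam \<in> ssyt lam []" if "\<forall>i. nth0 lam i = 0"
    proof -
      have "k = 0" if "k \<in> set lam" for k
        using \<open>\<forall>i. nth0 lam i = 0\<close> that unfolding nth0_def in_set_conv_nth by metis
      then have "map length (map (\<lambda>_. []) lam) = lam" by (simp add: map_idI)
      moreover have "concat (map (\<lambda>_. [] :: nat list) lam) = []" by simp
      ultimately show ?thesis
        by (simp add: ssyt_def semistandard_def has_weight_def weight_def)
    qed
    with sub show ?thesis by auto
  qed
  then show ?case by (simp add: kostka_def)
next
  case (snoc m om)
  let ?N = "length om"
  have IH: "kostka nu om = patterns (nth0 nu) (rev om)" if nu: "nu \<in> list_strip lam m" for nu
  proof (rule snoc.IH)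
    \<comment> \<open>Interlacing gives \<open>nu ! j <= lam ! j <= lam ! Suc i <= nu ! i\<close>,
      so the row stays decreasing and the induction hypothesis applies.\<close>
    have "nu ! j \<le> nu ! i" if "i < j" "j < length nu" for i j
    proof -
      have "length nu = length lam" using nu by (simp add: list_strip_def)
      then have "nu ! j \<le> lam ! j" "lam ! j \<le> lam ! Suc i" "lam ! Suc i \<le> nu ! i"
        using that nth0_list_strip[OF nu, of i] nth0_list_strip[OF nu, of j] snoc.prems
        by (auto simp: nth0_def sorted_wrt_iff_nth_less intro: le_less_Suc_eq)
           (metis Suc_lessI le_refl)
      then show ?thesis by simp
    qed
    then show "sorted_wrt (\<ge>) nu" by (simp add: sorted_wrt_iff_nth_less)
  qed
  have inj: "inj_on nth0 (list_strip lam m)"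
  proof (rule inj_onI)
    fix nu mu assume "nu \<in> list_strip lam m" "mu \<in> list_strip lam m" and eq: "nth0 nu = nth0 mu"
    then have "length nu = length mu" by (simp add: list_strip_def)
    moreover have "nu ! i = mu ! i" if "i < length nu" for i
      using fun_cong[OF eq, of i] that calculation by (simp add: nth0_def)
    ultimately show "nu = mu" by (simp add: nth_equalityI)
  qed
  have sub: "strip ?N (nth0 lam) m \<subseteq> nth0 ` list_strip lam m"
  proof
    fix nu assume nu: "nu \<in> strip ?N (nth0 lam) m"
    let ?nu = "map nu [0..<length lam]"
    have z: "nu i = 0" if "length lam \<le> i" for i
    proof -
      have "nu i \<le> nth0 lam i" using nu by (simp add: strip_def)
      then show ?thesis using that by (simp add: nth0_def)
    qed
    then have eq: "nth0 ?nu = nu" by (auto simp: nth0_def fun_eq_iff)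
    have "nth0 lam i = 0" if "Suc ?N \<le> i" for i
    proof -
      obtain j where "i = Suc j" "?N \<le> j" using \<open>Suc ?N \<le> i\<close> by (cases i) auto
      moreover have "nth0 lam (Suc j) \<le> nu j" using nu by (simp add: strip_def)
      ultimately show ?thesis using nu by (simp add: strip_def)
    qed
    then have "sum (nth0 lam) {..<Suc ?N} = sum_list lam" by (intro sum_nth0_support) blast
    moreover have "sum nu {..<?N} = sum_list ?nu"
    proof -
      have "\<forall>i\<ge>?N. nth0 ?nu i = 0" unfolding eq using nu by (simp add: strip_def)
      from sum_nth0_support[OF this] show ?thesis by (simp only: eq)
    qed
    moreover have "sum nu {..<?N} + m = sum (nth0 lam) {..<Suc ?N}"
      "\<forall>i. nth0 lam (Suc i) \<le> nu i \<and> nu i \<le> nth0 lam i"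
      using nu by (simp_all add: strip_def)
    ultimately have "?nu \<in> list_strip lam m"
      unfolding list_strip_def mem_Collect_eq eq by simp
    then show "nu \<in> nth0 ` list_strip lam m" using eq by (metis imageI)
  qed
  \<comment> \<open>\<open>list_strip\<close> allows as many non-zero rows as \<open>lam\<close>
    has, \<open>strip\<close> only as many as letters remain. The surplus rows contribute nothing by
    \<open>patterns_zero\<close>, so the two sums agree.\<close>
  have zero: "patterns nu (rev om) = 0"
    if nu: "nu \<in> nth0 ` list_strip lam m - strip ?N (nth0 lam) m" for nu
  proof -
    obtain xs where xs: "nu = nth0 xs" "xs \<in> list_strip lam m" using nu by blast
    have "\<exists>i\<ge>?N. nu i \<noteq> 0"
    proof (rule ccontr)
      assume "\<not> ?thesis"
      then have z: "\<forall>i\<ge>?N. nth0 xs i = 0" using xs by simp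
      have "nth0 lam i = 0" if "Suc ?N \<le> i" for i
      proof -
        obtain j where "i = Suc j" "?N \<le> j" using \<open>Suc ?N \<le> i\<close> by (cases i) auto
        then show ?thesis using nth0_list_strip(1)[OF xs(2), of j] z by simp
      qed
      then have "sum (nth0 lam) {..<Suc ?N} = sum_list lam" by (intro sum_nth0_support) blast
      moreover have "sum (nth0 xs) {..<?N} = sum_list xs" by (rule sum_nth0_support[OF z])
      ultimately have "nu \<in> strip ?N (nth0 lam) m"
        unfolding strip_def mem_Collect_eq using xs z nth0_list_strip[OF xs(2)]
        by (simp add: list_strip_def del: sum.lessThan_Suc)
      then show False using nu by blast
    qed
    then show ?thesis using patterns_zero[of "rev om"] by auto
  qed
  have "kostka lam (om @ [m]) = (\<Sum>nu\<in>list_strip lam m. patterns (nth0 nu) (rev om))"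
    unfolding kostka_snoc[OF snoc.prems] by (rule sum.cong) (auto simp: IH)
  also have "\<dots> = (\<Sum>nu\<in>nth0 ` list_strip lam m. patterns nu (rev om))"
    by (simp add: sum.reindex[OF inj])
  also have "\<dots> = (\<Sum>nu\<in>strip ?N (nth0 lam) m. patterns nu (rev om))"
    by (rule sum.mono_neutral_right) (use finite_list_strip sub zero in auto)
  finally show ?case by simp
qed

section \<open>Permuting the weight\<close>

text \<open>The Bender--Knuth involution on the middle one of three consecutive rows: every entry is reflected
  in the interval that the neighbouring rows allow for it, which exchanges the two parts of the
  weight.\<close>

definition toggle :: "(nat \<Rightarrow> nat) \<Rightarrow> (nat \<Rightarrow> nat) \<Rightarrow> (nat \<Rightarrow> nat) \<Rightarrow> nat \<Rightarrow> nat" where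
  "toggle lam ka nu i =
     max (lam (Suc i)) (ka i) + (case i of 0 \<Rightarrow> lam 0 | Suc j \<Rightarrow> min (lam i) (ka j)) - nu i"

lemma toggle_bounds:
  assumes "nu \<in> strip (Suc N) lam a" "ka \<in> strip N nu b"
  shows "max (lam (Suc i)) (ka i) \<le> nu i"
    and "nu i \<le> (case i of 0 \<Rightarrow> lam 0 | Suc j \<Rightarrow> min (lam i) (ka j))"
  using assms by (auto simp: strip_def split: nat.split)

text \<open>With \<open>lo\<close> and \<open>up\<close> the ends of the allowed intervals, the
  maximum defining \<open>lo i\<close> and the minimum defining \<open>up (Suc i)\<close> are of the
  same two numbers \<open>lam (Suc i)\<close> and \<open>ka i\<close>. Hence the sum of all ends is
  the size of \<open>lam\<close> plus that of \<open>ka\<close>, and reflecting in the intervals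
  exchanges the two size differences \<open>a\<close> and \<open>b\<close>.\<close>

lemma toggle_strip:
  assumes nu: "nu \<in> strip (Suc N) lam a" and ka: "ka \<in> strip N nu b"
  shows "toggle lam ka nu \<in> strip (Suc N) lam b" "ka \<in> strip N (toggle lam ka nu) a"
    "toggle lam ka (toggle lam ka nu) = nu"
proof -
  let ?t = "toggle lam ka nu"
  define lo where "lo i = max (lam (Suc i)) (ka i)" for i
  define up where "up i = (case i of 0 \<Rightarrow> lam 0 | Suc j \<Rightarrow> min (lam i) (ka j))" for i
  have t: "?t i = lo i + up i - nu i" for i by (simp add: toggle_def lo_def up_def)
  have b: "lo i \<le> nu i" "nu i \<le> up i" for i
    using toggle_bounds[OF nu ka, of i] by (simp_all add: lo_def up_def)
  have tb: "lo i \<le> ?t i" "?t i \<le> up i" "?t i + nu i = lo i + up i" for i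
    using b[of i] by (simp_all add: t)
  have lob: "lam (Suc i) \<le> lo i" "ka i \<le> lo i" for i by (simp_all add: lo_def)
  have upb: "up i \<le> lam i" "up (Suc i) \<le> ka i" for i by (simp_all add: up_def split: nat.split)
  have ka0: "ka i = 0" if "N \<le> i" for i using ka that by (simp add: strip_def)
  have t0: "?t i = 0" if i: "Suc N \<le> i" for i
  proof -
    obtain j where "i = Suc j" "N \<le> j" using i by (cases i) auto
    then show ?thesis using tb(2)[of i] upb(2)[of j] ka0[of j] by simp
  qed
  have "(\<Sum>i<Suc N. lo i) = (\<Sum>i<N. lo i) + lam (Suc N)"
    using ka0[of N] by (simp add: lo_def)
  moreover have "(\<Sum>i<Suc N. up i) = lam 0 + (\<Sum>i<N. up (Suc i))"
    by (simp only: sum.lessThan_Suc_shift) (simp add: up_def)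
  moreover have "(\<Sum>i<N. lo i) + (\<Sum>i<N. up (Suc i)) = (\<Sum>i<N. lam (Suc i)) + sum ka {..<N}"
    unfolding sum.distrib[symmetric] by (rule sum.cong) (auto simp: lo_def up_def)
  moreover have "(\<Sum>i<Suc (Suc N). lam i) = lam 0 + (\<Sum>i<N. lam (Suc i)) + lam (Suc N)"
    unfolding sum.lessThan_Suc_shift[of lam "Suc N"] by simp
  moreover have "sum ?t {..<Suc N} + sum nu {..<Suc N} = (\<Sum>i<Suc N. lo i) + (\<Sum>i<Suc N. up i)"
    unfolding sum.distrib[symmetric] by (rule sum.cong) (auto simp: tb)
  moreover have "sum nu {..<Suc N} + a = sum lam {..<Suc (Suc N)}"
    "sum ka {..<N} + b = sum nu {..<Suc N}"
    using nu ka by (simp_all add: strip_def)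
  ultimately have sums: "sum ?t {..<Suc N} + b = sum lam {..<Suc (Suc N)}"
    "sum ka {..<N} + a = sum ?t {..<Suc N}"
    by linarith+
  show "?t \<in> strip (Suc N) lam b"
    unfolding strip_def mem_Collect_eq
    using sums(1) t0 tb lob upb by (meson le_trans)
  show "ka \<in> strip N ?t a"
    unfolding strip_def mem_Collect_eq
    using sums(2) ka0 tb lob upb by (meson le_trans)
  show "toggle lam ka ?t = nu"
  proof
    fix i
    have "toggle lam ka ?t i = lo i + up i - ?t i" by (simp add: toggle_def lo_def up_def)
    then show "toggle lam ka ?t i = nu i" using tb(3)[of i] by simp
  qed
qed

lemma patterns_swap: "patterns lam (a # b # ms) = patterns lam (b # a # ms)"
proof -
  let ?N = "length ms"
  define S where "S a b = (SIGMA nu:strip (Suc ?N) lam a. strip ?N nu b)" for a b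
  have P: "patterns lam (a # b # ms) = (\<Sum>(nu, ka)\<in>S a b. patterns ka ms)" for a b
    by (simp add: S_def sum.Sigma finite_strip)
  define f where "f = (\<lambda>(nu, ka). (toggle lam ka nu, ka))"
  have f: "f x \<in> S b a" "f (f x) = x" "snd (f x) = snd x" if "x \<in> S a b" for x a b
    using that toggle_strip[of "fst x" ?N lam a "snd x" b]
    by (auto simp: S_def f_def split: prod.splits)
  have "(\<Sum>x\<in>S a b. patterns (snd x) ms) = (\<Sum>x\<in>S b a. patterns (snd x) ms)"
    by (rule sum.reindex_bij_witness[of _ f f]) (simp_all add: f)
  then show ?thesis unfolding P by (simp add: case_prod_beta)
qed

lemma patterns_insort: "patterns lam (insort a ms) = patterns lam (a # ms)"
proof (induction ms arbitrary: lam)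
  case (Cons b ms)
  show ?case
  proof (cases "a \<le> b")
    case False
    then have "patterns lam (insort a (b # ms)) = patterns lam (b # a # ms)"
      by (simp add: Cons)
    then show ?thesis by (simp only: patterns_swap)
  qed simp
qed simp

lemma patterns_sort: "patterns lam (sort ms) = patterns lam ms"
proof (induction ms arbitrary: lam)
  case (Cons a ms)
  have "patterns lam (sort (a # ms)) = patterns lam (a # sort ms)"
    by (simp add: patterns_insort)
  also have "\<dots> = patterns lam (a # ms)" by (simp add: Cons)
  finally show ?case .
qed simp

section \<open>Weight multiplicity one\<close>

abbreviation psum :: "(nat \<Rightarrow> nat) \<Rightarrow> nat \<Rightarrow> nat" where
  "psum f k \<equiv> sum f {..<k}"

lemma psum_split: "k \<le> n \<Longrightarrow> psum f n = psum f k + sum f {k..<n}" for f :: "nat \<Rightarrow> nat"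
  using sum.atLeastLessThan_concat[of 0 k n f] by (simp add: lessThan_atLeast0)

definition feasible :: "nat \<Rightarrow> (nat \<Rightarrow> nat) \<Rightarrow> (nat \<Rightarrow> nat) \<Rightarrow> bool" where
  "feasible N lam om \<longleftrightarrow> (\<forall>k\<le>N. psum om k \<le> psum lam k)"

definition descent :: "(nat \<Rightarrow> nat) \<Rightarrow> nat \<Rightarrow> bool" where
  "descent lam d \<longleftrightarrow> 1 \<le> d \<and> lam d < lam (d - 1)"

text \<open>Indices where the partial sums agree cut the diagram into blocks. By Berenstein and Zelevinsky
  the multiplicity is 1 iff in every block all parts but the first, or all but the last, are equal.
  \<open>slack\<close> says that this fails: some block contains two descents, or one descent that is neither the
  first nor the last possible one.\<close>

definition slack :: "nat \<Rightarrow> (nat \<Rightarrow> nat) \<Rightarrow> (nat \<Rightarrow> nat) \<Rightarrow> bool" where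
  "slack N lam om \<longleftrightarrow> (\<exists>d e. d \<le> e \<and> e < N \<and> descent lam d \<and> descent lam e \<and>
     (\<forall>k\<in>{d..e}. psum om k < psum lam k) \<and>
     (d = e \<longrightarrow> psum om (d - 1) < psum lam (d - 1) \<and> psum om (Suc d) < psum lam (Suc d)))"

lemma slackI2:
  assumes "d < e" "e < N" "descent lam d" "descent lam e"
    "\<And>k. d \<le> k \<Longrightarrow> k \<le> e \<Longrightarrow> psum om k < psum lam k"
  shows "slack N lam om"
  unfolding slack_def using assms by (intro exI[of _ d] exI[of _ e]) auto

lemma slackI1:
  assumes "d < N" "descent lam d" "psum om d < psum lam d"
    "psum om (d - 1) < psum lam (d - 1)" "psum om (Suc d) < psum lam (Suc d)"
  shows "slack N lam om"
  unfolding slack_def using assms by (intro exI[of _ d]) auto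

lemma psum_shift:
  assumes "x < y" "1 \<le> f x"
  shows "psum (f(x := f x - 1, y := Suc (f y))) k + (if x < k \<and> k \<le> y then 1 else 0) = psum f k"
proof (induction k)
  case (Suc k)
  then show ?case using assms by (cases "k = x"; cases "k = y") (auto split: if_splits)
qed simp

lemma strip_total:
  assumes "nu \<in> strip N lam (om N)" "psum lam (Suc N) = psum om (Suc N)"
  shows "psum nu N = psum om N"
  using assms by (simp add: strip_def)

lemma strip_psum_le: "nu \<in> strip N lam m \<Longrightarrow> psum nu k \<le> psum lam k"
  by (rule sum_mono) (simp add: strip_def)

lemma strip_ext:
  assumes "nu \<in> strip N lam m" "mu \<in> strip N lam m" "\<And>k. k \<le> N \<Longrightarrow> psum nu k = psum mu k"
  shows "nu = mu"
proof
  fix i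
  show "nu i = mu i"
  proof (cases "i < N")
    case True
    then show ?thesis using assms(3)[of i] assms(3)[of "Suc i"] by simp
  next
    case False
    then show ?thesis using assms(1,2) by (simp add: strip_def)
  qed
qed

text \<open>\<open>p\<close> is the last row of length at least \<open>om N\<close>. If all rows
  below \<open>p\<close> shrink to the length of the next row, they lose \<open>lam (Suc p)\<close>
  boxes altogether, which is too few; the remaining \<open>om N - lam (Suc p)\<close> boxes can be
  taken from row \<open>p\<close>. The case \<open>lam N = om N\<close>, which would mean
  \<open>p = N\<close>, is left out and treated separately.\<close>

locale step =
  fixes N :: nat and lam om :: "nat \<Rightarrow> nat" and p :: nat
  assumes om_dec: "\<And>i j. i \<le> j \<Longrightarrow> om j \<le> om i"
    and lam_dec: "\<And>i j. i \<le> j \<Longrightarrow> lam j \<le> lam i"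
    and lam_0: "\<And>i. Suc N \<le> i \<Longrightarrow> lam i = 0"
    and total: "psum lam (Suc N) = psum om (Suc N)"
    and feas: "feasible (Suc N) lam om"
    and p: "p < N" "om N \<le> lam p" "lam (Suc p) < om N"
begin

text \<open>The horizontal strip of size \<open>om N\<close> with the lowest boxes; its complement dominates all other
  candidates for the next row.\<close>

definition top :: "nat \<Rightarrow> nat" where
  "top i = (if i < p then lam i else if i = p then lam p + lam (Suc p) - om N else lam (Suc i))"

lemma top_low: "k \<le> p \<Longrightarrow> psum top k = psum lam k"
  by (rule sum.cong) (auto simp: top_def)

text \<open>Beyond \<open>p\<close> the row \<open>top\<close> is \<open>lam\<close> shifted by one
  index. So a descent of \<open>top\<close> at \<open>k\<close> with \<open>Suc p < k\<close> is a
  descent of \<open>lam\<close> at \<open>Suc k\<close>.\<close>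

lemma top_high: "p < k \<Longrightarrow> psum top k + om N = psum lam (Suc k)"
proof (induction k)
  case (Suc k)
  show ?case
  proof (cases "k = p")
    case True
    then show ?thesis using top_low[of p] p by (simp add: top_def)
  next
    case False
    then show ?thesis using Suc by (simp add: top_def)
  qed
qed simp

text \<open>Compare tails instead of heads: from \<open>Suc p\<close> on every part of
  \<open>lam\<close> is below \<open>om N\<close>, the least among the parts of \<open>om\<close> up
  to \<open>N\<close>, and the totals agree. Thus no block boundary lies strictly between
  \<open>p\<close> and \<open>Suc N\<close>.\<close>

lemma above: "p < k \<Longrightarrow> k \<le> N \<Longrightarrow> psum om k < psum lam k"
proof -
  assume k: "p < k" "k \<le> N"
  have "sum lam {k..<Suc N} < sum om {k..<Suc N}"
  proof (rule sum_strict_mono)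
    fix i assume i: "i \<in> {k..<Suc N}"
    have "lam i \<le> lam (Suc p)" using i k by (intro lam_dec) simp
    also have "\<dots> < om N" by (rule p)
    also have "\<dots> \<le> om i" using i by (intro om_dec) simp
    finally show "lam i < om i" .
  qed (use k in auto)
  then show ?thesis using psum_split[of k "Suc N" lam] psum_split[of k "Suc N" om] total k by simp
qed

lemma top_above: "p < k \<Longrightarrow> k < N \<Longrightarrow> psum om k < psum top k"
  using above[of "Suc k"] top_high[of k] om_dec[of k N] by simp

lemma top_N: "psum top N = psum om N"
  using top_high[of N] p total by simp

lemma top_strip: "top \<in> strip N lam (om N)"
proof -
  have "lam (Suc i) \<le> top i \<and> top i \<le> lam i" for i
    using lam_dec[of i "Suc i"] p by (auto simp: top_def)
  moreover have "top i = 0" if "N \<le> i" for i using that p lam_0[of "Suc i"] by (simp add: top_def)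
  ultimately show ?thesis using top_high[of N] p by (simp add: strip_def)
qed

lemma top_feasible: "feasible N top om"
  unfolding feasible_def
proof (intro allI impI)
  fix k assume "k \<le> N"
  consider "k \<le> p" | "p < k" "k < N" | "k = N" using \<open>k \<le> N\<close> by linarith
  then show "psum om k \<le> psum top k"
  proof cases
    case 1
    then show ?thesis using feas \<open>k \<le> N\<close> by (simp add: top_low feasible_def)
  qed (auto simp: top_above top_N less_imp_le)
qed

lemma descent_step: "descent lam (Suc p)"
  using p by (simp add: descent_def)

lemma top_tight: "psum om k < psum top k \<Longrightarrow> k \<noteq> N"
  using top_N by auto

text \<open>Up to \<open>p\<close>, \<open>top\<close> has the largest possible entries; after
  \<open>p\<close> it has the smallest, so the tail of \<open>nu\<close> is at least that of
  \<open>top\<close> while the totals are equal.\<close>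

lemma strip_psum_le_top:
  assumes nu: "nu \<in> strip N lam (om N)" and k: "k \<le> N"
  shows "psum nu k \<le> psum top k"
proof (cases "k \<le> p")
  case True
  then show ?thesis using strip_psum_le[OF nu] by (simp add: top_low)
next
  case False
  have "sum top {k..<N} \<le> sum nu {k..<N}"
    by (rule sum_mono) (use False nu in \<open>simp add: top_def strip_def\<close>)
  moreover have "psum nu N = psum top N"
    using strip_total[OF nu total] top_N by simp
  ultimately show ?thesis
    using psum_split[OF k, of nu] psum_split[OF k, of top] by simp
qed

text \<open>Take the first run \<open>{a..b}\<close> of indices where the partial sums of
  \<open>nu\<close> are below those of \<open>top\<close>. At its ends
  \<open>nu (a - 1) < top (a - 1)\<close> and \<open>top b < nu b\<close>, so \<open>top\<close> is
  not extreme there, which places \<open>a - 1\<close> at most at \<open>p\<close> and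
  \<open>b\<close> at least at \<open>p\<close>. Inside the run \<open>top\<close> strictly
  dominates \<open>om\<close>. The two descents are \<open>a\<close> and \<open>Suc p\<close> if
  \<open>a - 1 < p\<close>, and \<open>Suc p\<close> and \<open>Suc b\<close> if
  \<open>a - 1 = p\<close>.\<close>

lemma other_imp_slack:
  assumes nu: "nu \<in> strip N lam (om N)" "feasible N nu om" and ne: "nu \<noteq> top"
  shows "slack (Suc N) lam om"
proof -
  have N: "psum nu N = psum top N" using strip_total[OF nu(1) total] top_N by simp
  have "\<exists>k\<le>N. psum nu k \<noteq> psum top k"
    using strip_ext[OF nu(1) top_strip] ne by blast
  then have ex: "\<exists>k. k \<le> N \<and> psum nu k < psum top k"
    using strip_psum_le_top[OF nu(1)] by (meson le_neq_implies_less)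
  define a where "a = (LEAST k. k \<le> N \<and> psum nu k < psum top k)"
  have a: "a \<le> N" "psum nu a < psum top a" using LeastI_ex[OF ex] by (simp_all add: a_def)
  have a_min: "\<not> (k \<le> N \<and> psum nu k < psum top k)" if "k < a" for k
    using that not_less_Least unfolding a_def by blast
  have "a \<noteq> 0" using a(2) by (cases a) auto
  then obtain a' where a': "a = Suc a'" by (cases a) auto
  have "a \<noteq> N" using a(2) N by auto
  then have aN: "a < N" using a(1) by simp
  have "psum nu a' = psum top a'"
    using a_min[of a'] a' a(1) strip_psum_le_top[OF nu(1), of a'] by simp
  then have nu_a: "nu a' < top a'" using a(2) a' by simp
  have "\<exists>k. a < k \<and> psum nu k = psum top k" using aN N by blast
  define c where "c = (LEAST k. a < k \<and> psum nu k = psum top k)"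
  have c: "a < c" "psum nu c = psum top c"
    using LeastI_ex[OF \<open>\<exists>k. a < k \<and> psum nu k = psum top k\<close>] by (simp_all add: c_def)
  have "c \<le> N" unfolding c_def by (rule Least_le) (use aN N in simp)
  obtain b where b: "c = Suc b" using c(1) by (cases c) auto
  have bt: "psum nu k < psum top k" if "a \<le> k" "k \<le> b" for k
  proof (cases "k = a")
    case False
    have "\<not> (a < k \<and> psum nu k = psum top k)"
      using not_less_Least[of k "\<lambda>k. a < k \<and> psum nu k = psum top k"] that b
      by (simp add: c_def)
    then show ?thesis
      using False that strip_psum_le_top[OF nu(1), of k] b \<open>c \<le> N\<close> by simp
  qed (use a in simp)
  have slack_ab: "psum om k < psum top k" if "a \<le> k" "k \<le> b" for k
    using bt[OF that] nu(2) that b \<open>c \<le> N\<close> unfolding feasible_def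
    by (meson Suc_leD le_less_trans le_trans)
  have nu_b: "top b < nu b"
    using bt[of b] c b by simp
  have ab: "a \<le> b" using c(1) b by simp
  have lam_a: "lam (Suc a') < top a'" using nu(1) nu_a
    unfolding strip_def by (metis (no_types, lifting) le_less_trans mem_Collect_eq)
  have lam_b: "top b < lam b" using nu(1) nu_b
    unfolding strip_def by (metis (no_types, lifting) less_le_trans mem_Collect_eq)
  have ap: "a' \<le> p" using lam_a by (auto simp: top_def split: if_splits)
  have pb: "p \<le> b" using lam_b by (auto simp: top_def split: if_splits)
  show ?thesis
  proof (cases "a' = p")
    case False
    then have "a \<le> p" using ap a' by simp
    show ?thesis
    proof (rule slackI2[of a "Suc p"])
      show "descent lam a" using lam_a False ap a' by (simp add: descent_def top_def)
      fix k assume "a \<le> k" "k \<le> Suc p"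
      then show "psum om k < psum lam k"
        using slack_ab[of k] pb above[of k] p top_low[of k] by (cases "k = Suc p") auto
    qed (use \<open>a \<le> p\<close> p descent_step in auto)
  next
    case True
    have "p < b" using ab a' True by simp
    show ?thesis
    proof (rule slackI2[of "Suc p" "Suc b"])
      show "descent lam (Suc b)" using lam_b \<open>p < b\<close> by (simp add: descent_def top_def)
      fix k assume "Suc p \<le> k" "k \<le> Suc b"
      then show "psum om k < psum lam k" using above[of k] b \<open>c \<le> N\<close> by simp
    qed (use \<open>p < b\<close> b \<open>c \<le> N\<close> descent_step in auto)
  qed
qed

text \<open>Descents of \<open>top\<close> before \<open>p\<close> are descents of
  \<open>lam\<close>, and those after \<open>Suc p\<close> move up by one index. Those at
  \<open>p\<close> or \<open>Suc p\<close> need not come from \<open>lam\<close>; the descent of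
  \<open>lam\<close> at \<open>Suc p\<close>, always present, takes their place.\<close>

lemma top_slack_imp_slack:
  assumes "slack N top om"
  shows "slack (Suc N) lam om"
proof -
  obtain d e where de: "d \<le> e" "e < N" "descent top d" "descent top e"
    and btw: "\<And>k. d \<le> k \<Longrightarrow> k \<le> e \<Longrightarrow> psum om k < psum top k"
    and sngl: "d = e \<Longrightarrow> psum om (d - 1) < psum top (d - 1) \<and> psum om (Suc d) < psum top (Suc d)"
    using assms unfolding slack_def by auto
  have low: "descent lam k" if "descent top k" "k < p" for k
    using that by (cases k) (auto simp: descent_def top_def)
  have lowk: "psum om k < psum lam k" if "psum om k < psum top k" "k \<le> p" for k
    using that by (simp add: top_low)
  have single: "slack (Suc N) lam om" if "psum om p < psum lam p" "Suc p < N"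
    by (rule slackI1[of "Suc p"]) (use that above[of "Suc p"] above[of "Suc (Suc p)"] descent_step in auto)
  have left: "slack (Suc N) lam om" if "d < p" "p \<le> e"
  proof (rule slackI2[of d "Suc p"])
    fix k assume "d \<le> k" "k \<le> Suc p"
    then show "psum om k < psum lam k"
      using btw[of k] lowk[of k] above[of k] p that by (cases "k = Suc p") auto
  qed (use that p low[OF de(3)] descent_step in auto)
  consider "e < p" | "e = p" "d = p" | "p \<le> e" "d < p" | "e = Suc p" "p \<le> d" | "Suc p < e"
    using de(1) by linarith
  then show ?thesis
  proof cases
    case 1
    show ?thesis
    proof (cases "d = e")
      case True
      then show ?thesis
        using 1 de low btw[of d] sngl lowk[of d] lowk[of "d - 1"] lowk[of "Suc d"]
        by (intro slackI1[of d]) auto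
    next
      case False
      then show ?thesis
        using 1 de low btw lowk by (intro slackI2[of d e]) auto
    qed
  next
    case 2
    then show ?thesis
      using sngl btw[of p] lowk[of p] top_tight[of "Suc p"] de by (intro single) auto
  next
    case 3
    then show ?thesis by (intro left) auto
  next
    case 4
    have "psum om p < psum top p"
    proof (cases "d = p")
      case False
      then have "d = Suc p" "d = e" using 4 de(1) by simp_all
      then show ?thesis using sngl by simp
    qed (use 4 btw in simp)
    then show ?thesis using 4 lowk[of p] de by (intro single) auto
  next
    case 5
    then have "descent lam (Suc e)" using de(4) by (cases e) (auto simp: descent_def top_def)
    then show ?thesis
      using 5 de descent_step above by (intro slackI2[of "Suc p" "Suc e"]) auto
  qed
qed

text \<open>Moving one box from row \<open>x\<close> to row \<open>y\<close> lowers exactly the partial sums between them by one.\<close>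

lemma other_shift:
  assumes xy: "x < y" "y < N" and "lam (Suc x) < top x" "top y < lam y"
    and sl: "\<And>k. x < k \<Longrightarrow> k \<le> y \<Longrightarrow> psum om k < psum top k"
  shows "\<exists>nu\<in>strip N lam (om N). feasible N nu om \<and> nu \<noteq> top"
proof -
  let ?nu = "top(x := top x - 1, y := Suc (top y))"
  have ps: "psum ?nu k + (if x < k \<and> k \<le> y then 1 else 0) = psum top k" for k
    by (rule psum_shift) (use assms in auto)
  have "lam (Suc i) \<le> ?nu i \<and> ?nu i \<le> lam i" for i
    using top_strip assms by (auto simp: strip_def le_diff_conv le_SucI)
  moreover have "psum ?nu N = psum top N" using ps[of N] xy by simp
  ultimately have "?nu \<in> strip N lam (om N)"
    using top_strip xy unfolding strip_def by auto
  moreover have "feasible N ?nu om"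
    unfolding feasible_def
  proof (intro allI impI)
    fix k assume "k \<le> N"
    then have "psum om k \<le> psum top k" using top_feasible by (simp add: feasible_def)
    then show "psum om k \<le> psum ?nu k" using ps[of k] sl[of k] by (auto split: if_splits)
  qed
  moreover have "?nu y \<noteq> top y" by simp
  then have "?nu \<noteq> top" by metis
  ultimately show ?thesis by blast
qed

text \<open>Row \<open>e - 1\<close> still has its full length in \<open>top\<close> and can give a
  box to row \<open>p\<close>, which \<open>top\<close> has shortened.\<close>

lemma other_left:
  assumes "descent lam e" "e \<le> p" "\<And>k. e \<le> k \<Longrightarrow> k \<le> p \<Longrightarrow> psum om k < psum lam k"
  shows "\<exists>nu\<in>strip N lam (om N). feasible N nu om \<and> nu \<noteq> top"
  by (rule other_shift[of "e - 1" p])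
     (use assms p in \<open>auto simp: descent_def top_def top_low\<close>)

text \<open>Row \<open>p\<close> of \<open>top\<close> is longer than its lower bound
  \<open>lam (Suc p)\<close> exactly because \<open>om N < lam p\<close>, so it can give a box to
  row \<open>e - 1\<close>.\<close>

lemma other_right:
  assumes "descent lam e" "Suc p < e" "e \<le> N" "om N < lam p"
  shows "\<exists>nu\<in>strip N lam (om N). feasible N nu om \<and> nu \<noteq> top"
proof (rule other_shift[of p "e - 1"])
  show "lam (Suc p) < top p" using assms by (simp add: top_def)
  show "top (e - 1) < lam (e - 1)" using assms by (cases e) (auto simp: descent_def top_def)
  fix k assume "p < k" "k \<le> e - 1"
  then show "psum om k < psum top k" using assms by (intro top_above) auto
qed (use assms in auto)

text \<open>Here row \<open>p\<close> of \<open>top\<close> has no box to give. If there were no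
  descent after the last equality \<open>t\<close> of partial sums up to \<open>p\<close>, then
  \<open>lam\<close> would be constantly \<open>om N\<close> from \<open>t\<close> to
  \<open>p\<close>; the step from \<open>t\<close> to \<open>Suc t\<close> could then not make
  \<open>lam\<close> overtake \<open>om\<close>, although it is strictly ahead at
  \<open>Suc t\<close>.\<close>

lemma left_descent:
  assumes "lam p = om N"
  shows "\<exists>e\<le>p. descent lam e \<and> (\<forall>k. e \<le> k \<longrightarrow> k \<le> p \<longrightarrow> psum om k < psum lam k)"
proof -
  define t where "t = Max {k. k \<le> p \<and> psum om k = psum lam k}"
  have fin: "finite {k. k \<le> p \<and> psum om k = psum lam k}" by simp
  have "0 \<in> {k. k \<le> p \<and> psum om k = psum lam k}" by simp
  then have t: "t \<le> p" "psum om t = psum lam t"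
    using Max_in[OF fin] unfolding t_def by blast+
  have slack: "psum om k < psum lam k" if "t < k" "k \<le> p" for k
  proof -
    have "psum om k \<noteq> psum lam k"
    proof
      assume "psum om k = psum lam k"
      then have "k \<le> t" using Max_ge[OF fin, of k] that unfolding t_def by simp
      then show False using that by simp
    qed
    then show ?thesis using feas that p by (simp add: feasible_def le_neq_implies_less)
  qed
  show ?thesis
  proof (rule ccontr)
    assume no: "\<not> ?thesis"
    have const: "lam k = om N" if "t \<le> k" "k \<le> p" for k
      using that(2,1)
    proof (induction k rule: inc_induct)
      case base
      then show ?case using assms by simp
    next
      case (step k)
      then have "\<not> descent lam (Suc k)" using no slack by auto
      then have "\<not> lam (Suc k) < lam k" by (simp add: descent_def)
      then show ?case using step lam_dec[of k "Suc k"] by simp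
    qed
    have "psum lam (Suc t) \<le> psum om (Suc t)"
      using const[of t] t om_dec[of t N] p by simp
    moreover have "psum om (Suc t) < psum lam (Suc t)"
      using slack[of "Suc t"] above[of "Suc t"] t(1) p by (cases "t = p") auto
    ultimately show False by simp
  qed
qed

text \<open>Slack strictly left of \<open>p\<close> survives in \<open>top\<close>; slack reaching
  \<open>p\<close> from the left lets a box move to row \<open>p\<close>. If all descents lie right
  of \<open>p\<close>, either \<open>lam p = om N\<close> and \<open>left_descent\<close> supplies
  one on the left, or row \<open>p\<close> can give a box, unless \<open>Suc p\<close> is the only
  descent.\<close>

lemma slack_imp:
  assumes "slack (Suc N) lam om"
  shows "slack N top om \<or> (\<exists>nu\<in>strip N lam (om N). feasible N nu om \<and> nu \<noteq> top)"
proof -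
  obtain d e where de: "d \<le> e" "e < Suc N" "descent lam d" "descent lam e"
    and btw: "\<And>k. d \<le> k \<Longrightarrow> k \<le> e \<Longrightarrow> psum om k < psum lam k"
    and sngl: "d = e \<Longrightarrow> psum om (d - 1) < psum lam (d - 1) \<and> psum om (Suc d) < psum lam (Suc d)"
    using assms unfolding slack_def by auto
  have low: "descent top k" if "descent lam k" "k < p" for k
    using that by (cases k) (auto simp: descent_def top_def)
  have eN: "e \<le> N" using de(2) by simp
  consider "e < p" | "d \<le> p" "p \<le> e" | "p < d" "lam p = om N" | "p < d" "lam p \<noteq> om N"
    using de(1) by linarith
  then show ?thesis
  proof cases
    case 1
    have "slack N top om"
    proof (cases "d = e")
      case True
      then show ?thesis
        using 1 de low btw[of d] sngl p
        by (intro slackI1[of d]) (auto simp: top_low simp del: sum.lessThan_Suc)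
    next
      case False
      then show ?thesis
        using 1 de low btw p
        by (intro slackI2[of d e]) (auto simp: top_low)
    qed
    then show ?thesis ..
  next
    case 2
    then show ?thesis using other_left[OF de(3)] btw by auto
  next
    case 3
    then show ?thesis using left_descent other_left by blast
  next
    case 4
    then have lp: "om N < lam p" using p by simp
    show ?thesis
    proof (cases "Suc p < e")
      case True
      then show ?thesis using other_right[OF de(4) _ eN lp] by blast
    next
      case False
      then have de': "d = Suc p" "e = Suc p" using 4 de by auto
      then have s: "psum om p < psum lam p" "psum om (Suc (Suc p)) < psum lam (Suc (Suc p))"
        using sngl by auto
      have "p \<noteq> 0" using s(1) by (cases p) auto
      have "Suc (Suc p) \<noteq> Suc N" using s(2) total by auto
      then have pN: "Suc p < N" using p by simp
      \<comment> \<open>The single inner descent of \<open>lam\<close> at \<open>Suc p\<close>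
        splits into two of \<open>top\<close>: row \<open>p\<close> ends strictly between its old
        length and \<open>lam (Suc p)\<close>.\<close>
      have "slack N top om"
      proof (rule slackI2[of p "Suc p"])
        show "descent top p"
          using \<open>p \<noteq> 0\<close> lam_dec[of "p - 1" p] p by (auto simp: descent_def top_def)
        show "descent top (Suc p)"
          using lp lam_dec[of "Suc p" "Suc (Suc p)"] by (simp add: descent_def top_def)
        fix k assume "p \<le> k" "k \<le> Suc p"
        then show "psum om k < psum top k"
          using s(1) top_low[of p] top_above[of k] pN by (cases "k = p") auto
      qed (use pN in auto)
      then show ?thesis ..
    qed
  qed
qed

end

section \<open>Induction on the number of parts\<close>

lemma strip_feasible_rest:
  assumes "nu \<in> strip N lam (om N)" "psum lam (Suc N) = psum om (Suc N)"
    and "\<And>i. lam (Suc i) \<le> lam i"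
  shows "\<And>i. nu (Suc i) \<le> nu i" "\<And>i. N \<le> i \<Longrightarrow> nu i = 0" "psum nu N = psum om N"
proof -
  show "nu (Suc i) \<le> nu i" for i using assms(1) by (auto simp: strip_def intro: le_trans)
  show "N \<le> i \<Longrightarrow> nu i = 0" for i using assms(1) by (simp add: strip_def)
  show "psum nu N = psum om N" by (rule strip_total[OF assms(1,2)])
qed

lemma patterns_criterion:
  assumes "\<And>i. om (Suc i) \<le> om i" "\<And>i. lam (Suc i) \<le> lam i" "\<And>i. N \<le> i \<Longrightarrow> lam i = 0"
    and "psum lam N = psum om N"
  shows "patterns lam (rev (map om [0..<N])) \<noteq> 0 \<longleftrightarrow> feasible N lam om"
    and "patterns lam (rev (map om [0..<N])) = 1 \<longleftrightarrow> feasible N lam om \<and> \<not> slack N lam om"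
proof -
  let ?P = "\<lambda>N lam. patterns lam (rev (map om [0..<N]))"
  have "(?P N lam \<noteq> 0 \<longleftrightarrow> feasible N lam om) \<and> (?P N lam = 1 \<longleftrightarrow> feasible N lam om \<and> \<not> slack N lam om)"
    using assms(2-)
  proof (induction N arbitrary: lam)
    case 0
    then show ?case by (simp add: feasible_def slack_def)
  next
    case (Suc N)
    define X where "X = {nu\<in>strip N lam (om N). feasible N nu om}"
    have IH: "?P N nu \<noteq> 0 \<longleftrightarrow> feasible N nu om"
        "?P N nu = 1 \<longleftrightarrow> feasible N nu om \<and> \<not> slack N nu om"
      if "nu \<in> strip N lam (om N)" for nu
      using Suc.IH[of nu] strip_feasible_rest[OF that Suc.prems(3) Suc.prems(1)] by blast+
    have P: "?P (Suc N) lam = (\<Sum>nu\<in>X. ?P N nu)"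
    proof -
      have "?P (Suc N) lam = (\<Sum>nu\<in>strip N lam (om N). ?P N nu)" by simp
      also have "\<dots> = (\<Sum>nu\<in>X. ?P N nu)"
        by (rule sum.mono_neutral_right) (use finite_strip IH in \<open>auto simp: X_def\<close>)
      finally show ?thesis .
    qed
    have finX: "finite X" using finite_strip by (simp add: X_def)
    have pos: "?P N nu \<noteq> 0" if "nu \<in> X" for nu using IH(1) that by (simp add: X_def)
    have nonzero: "?P (Suc N) lam \<noteq> 0 \<longleftrightarrow> X \<noteq> {}"
    proof -
      have "(\<Sum>nu\<in>X. ?P N nu) = 0 \<longleftrightarrow> X = {}"
        unfolding sum_eq_0_iff[OF finX] using pos by blast
      then show ?thesis by (simp only: P)
    qed
    have lam_dec: "lam j \<le> lam i" if "i \<le> j" for i j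
      using lift_Suc_antimono_le[of lam i j] Suc.prems(1) that by blast
    have om_dec: "om j \<le> om i" if "i \<le> j" for i j
      using lift_Suc_antimono_le[of om i j] assms(1) that by blast
    have infeasible: "X = {}" if "\<not> feasible (Suc N) lam om"
    proof (rule ccontr)
      assume "X \<noteq> {}"
      then obtain nu where nu: "nu \<in> strip N lam (om N)" "feasible N nu om"
        unfolding X_def by blast
      have "psum om k \<le> psum lam k" if "k \<le> Suc N" for k
      proof (cases "k = Suc N")
        case False
        then have "psum om k \<le> psum nu k" using nu(2) that by (simp add: feasible_def)
        then show ?thesis using strip_psum_le[OF nu(1), of k] by simp
      qed (use Suc.prems(3) in simp)
      then show False using that by (simp add: feasible_def)
    qed
    \<comment> \<open>It now suffices to exhibit one candidate \<open>nu\<close> for which slack of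
      \<open>lam\<close> means slack of \<open>nu\<close> or a second candidate.\<close>
    have unique: "(?P (Suc N) lam \<noteq> 0) \<and> (?P (Suc N) lam = 1 \<longleftrightarrow> \<not> slack (Suc N) lam om)"
      if nu: "nu \<in> X" and iff: "slack (Suc N) lam om \<longleftrightarrow> slack N nu om \<or> (\<exists>mu\<in>X. mu \<noteq> nu)" for nu
    proof -
      have split: "?P (Suc N) lam = ?P N nu + (\<Sum>mu\<in>X - {nu}. ?P N mu)"
        unfolding P by (rule sum.remove[OF finX nu])
      have nn: "?P N nu \<noteq> 0" by (rule pos[OF nu])
      have "(\<Sum>mu\<in>X - {nu}. ?P N mu) = 0 \<longleftrightarrow> \<not> (\<exists>mu\<in>X. mu \<noteq> nu)"
      proof -
        have "(\<Sum>mu\<in>X - {nu}. ?P N mu) = 0 \<longleftrightarrow> (\<forall>mu\<in>X - {nu}. ?P N mu = 0)"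
          by (rule sum_eq_0_iff) (use finX in simp)
        then show ?thesis using pos by blast
      qed
      moreover have "?P N nu = 1 \<longleftrightarrow> \<not> slack N nu om" using IH(2)[of nu] nu by (simp add: X_def)
      moreover have "?P (Suc N) lam = 1 \<longleftrightarrow> ?P N nu = 1 \<and> (\<Sum>mu\<in>X - {nu}. ?P N mu) = 0"
        unfolding split using nn by linarith
      moreover have "?P (Suc N) lam \<noteq> 0" unfolding split using nn by linarith
      ultimately show ?thesis unfolding iff de_Morgan_disj by (simp only: simp_thms)
    qed
    show ?case
    proof (cases "feasible (Suc N) lam om")
      case False
      then have "?P (Suc N) lam = 0" using nonzero infeasible by blast
      then show ?thesis using False by (simp del: patterns.simps)
    next
      case feas: True
      have tight_last: "psum lam (Suc N) = psum om (Suc N)" by (rule Suc.prems(3))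
      have lastN: "lam N \<le> om N"
      proof -
        have "psum om N \<le> psum lam N" using feas unfolding feasible_def by simp
        then show ?thesis using tight_last by simp
      qed
      have "\<exists>nu\<in>X. slack (Suc N) lam om \<longleftrightarrow> slack N nu om \<or> (\<exists>mu\<in>X. mu \<noteq> nu)"
      proof (cases "lam N = om N")
        case True
        \<comment> \<open>Here the last row has exactly the size to be removed. A candidate is
          bounded by \<open>lam\<close> entrywise and has the same sum over the first
          \<open>N\<close> entries, so it can only be \<open>nu0\<close>; the new last partial sum
          is an equality, hence slack cannot reach \<open>N\<close>.\<close>
        define nu0 where "nu0 = lam(N := 0)"
        have ps: "psum nu0 k = psum lam k" if "k \<le> N" for k
          by (rule sum.cong) (use that in \<open>auto simp: nu0_def\<close>)
        have nu: "nu0 \<in> strip N lam (om N)"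
        proof -
          have "lam (Suc i) \<le> nu0 i" for i
            using Suc.prems(1)[of i] Suc.prems(2)[of "Suc i"] by (auto simp: nu0_def)
          moreover have "nu0 i = 0" if "N \<le> i" for i
            using that Suc.prems(2)[of i] by (cases "i = N") (auto simp: nu0_def)
          moreover have "nu0 i \<le> lam i" for i by (simp add: nu0_def)
          ultimately show ?thesis using True ps[of N] by (simp add: strip_def)
        qed
        have "feasible N nu0 om" using feas ps by (simp add: feasible_def)
        then have X: "nu0 \<in> X" using nu by (simp add: X_def)
        have "mu = nu0" if mu: "mu \<in> strip N lam (om N)" for mu
        proof (rule strip_ext[OF mu nu])
          fix k assume k: "k \<le> N"
          have t: "psum mu N = psum lam N" using mu True by (simp add: strip_def)
          have "sum mu {k..<N} \<le> sum lam {k..<N}" "psum mu k \<le> psum lam k"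
            using mu by (auto simp: strip_def intro: sum_mono)
          then show "psum mu k = psum nu0 k"
            using t psum_split[OF k, of mu] psum_split[OF k, of lam] ps[OF k] by simp
        qed
        then have "\<not> (\<exists>mu\<in>X. mu \<noteq> nu0)" by (auto simp: X_def)
        moreover have "slack (Suc N) lam om \<longleftrightarrow> slack N nu0 om"
        proof -
          have tN: "psum lam N = psum om N" using tight_last True by simp
          have desc: "descent nu0 k \<longleftrightarrow> descent lam k" if "k < N" for k
            using that by (auto simp: descent_def nu0_def)
          show ?thesis
          proof
            assume "slack (Suc N) lam om"
            then obtain d e where de: "d \<le> e" "e < Suc N" "descent lam d" "descent lam e"
              and btw: "\<forall>k\<in>{d..e}. psum om k < psum lam k"
              and sngl: "d = e \<longrightarrow> psum om (d - 1) < psum lam (d - 1) \<and> psum om (Suc d) < psum lam (Suc d)"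
              unfolding slack_def by blast
            have "psum om e < psum lam e" using btw de(1) by simp
            then have "e \<noteq> N" using tN by auto
            then have e: "e < N" using de(2) by simp
            have "\<forall>k\<in>{d..e}. psum om k < psum nu0 k" using btw e ps by simp
            moreover have "d = e \<longrightarrow> psum om (d - 1) < psum nu0 (d - 1) \<and> psum om (Suc d) < psum nu0 (Suc d)"
              using sngl e ps by (auto simp del: sum.lessThan_Suc)
            ultimately show "slack N nu0 om"
              unfolding slack_def using de e desc[of d] desc[of e] by (meson le_less_trans)
          next
            assume "slack N nu0 om"
            then obtain d e where de: "d \<le> e" "e < N" "descent nu0 d" "descent nu0 e"
              and btw: "\<forall>k\<in>{d..e}. psum om k < psum nu0 k"
              and sngl: "d = e \<longrightarrow> psum om (d - 1) < psum nu0 (d - 1) \<and> psum om (Suc d) < psum nu0 (Suc d)"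
              unfolding slack_def by blast
            have "\<forall>k\<in>{d..e}. psum om k < psum lam k" using btw de(2) ps by simp
            moreover have "d = e \<longrightarrow> psum om (d - 1) < psum lam (d - 1) \<and> psum om (Suc d) < psum lam (Suc d)"
              using sngl de(2) ps by (auto simp del: sum.lessThan_Suc)
            ultimately show "slack (Suc N) lam om"
              unfolding slack_def using de desc[of d] desc[of e] by (meson le_less_trans less_SucI)
          qed
        qed
        ultimately show ?thesis using X by blast
      next
        case False
        then have lt: "lam N < om N" using lastN by simp
        have "om N \<le> lam 0"
        proof -
          have "psum om 1 \<le> psum lam 1"
            by (rule feas[unfolded feasible_def, rule_format]) simp
          then show ?thesis using om_dec[of 0 N] by simp
        qed
        define p where "p = Max {i. i \<le> N \<and> om N \<le> lam i}"
        have fin: "finite {i. i \<le> N \<and> om N \<le> lam i}" by simp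
        have "0 \<in> {i. i \<le> N \<and> om N \<le> lam i}" using \<open>om N \<le> lam 0\<close> by simp
        then have p: "p \<le> N" "om N \<le> lam p" using Max_in[OF fin] unfolding p_def by blast+
        have pN: "p < N" using p lt by (cases "p = N") auto
        have "lam (Suc p) < om N"
        proof (rule ccontr)
          assume "\<not> ?thesis"
          then have "Suc p \<le> p" using Max_ge[OF fin, of "Suc p"] pN unfolding p_def by simp
          then show False by simp
        qed
        then interpret step N lam om p
          using om_dec lam_dec Suc.prems feas p pN by unfold_locales auto
        have "top \<in> X" using top_strip top_feasible by (simp add: X_def)
        moreover have "slack (Suc N) lam om \<longleftrightarrow> slack N top om \<or> (\<exists>mu\<in>X. mu \<noteq> top)"
          using slack_imp top_slack_imp_slack other_imp_slack unfolding X_def by blast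
        ultimately show ?thesis by blast
      qed
      then obtain nu where "nu \<in> X" "slack (Suc N) lam om \<longleftrightarrow> slack N nu om \<or> (\<exists>mu\<in>X. mu \<noteq> nu)"
        by blast
      from unique[OF this] show ?thesis using feas by blast
    qed
  qed
  then show "?P N lam \<noteq> 0 \<longleftrightarrow> feasible N lam om"
    "?P N lam = 1 \<longleftrightarrow> feasible N lam om \<and> \<not> slack N lam om"
    by blast+
qed

section \<open>Stack programs and Turing machines\<close>

text \<open>Assigned and pushed values and tests depend on the tops of all stacks at once, as a
  transition function sees all heads. The functions may be arbitrary, since only finitely many
  vectors of tops over the alphabet occur.\<close>

datatype cmd =
    Skip
  | Write nat nat
  | Push nat "(nat \<Rightarrow> nat) \<Rightarrow> nat"
  | Assign nat "(nat \<Rightarrow> nat) \<Rightarrow> nat"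
  | Pop nat
  | Seq cmd cmd (infixr \<open>;;\<close> 60)
  | Cond "(nat \<Rightarrow> nat) \<Rightarrow> bool" cmd cmd
  | While "(nat \<Rightarrow> nat) \<Rightarrow> bool" cmd

type_synonym stacks = "nat \<Rightarrow> nat list"

definition peek :: "nat list \<Rightarrow> nat" where
  "peek xs = (case xs of [] \<Rightarrow> 0 | x # _ \<Rightarrow> x)"

lemma peek_simps [simp]: "peek [] = 0" "peek (x # xs) = x"
  by (simp_all add: peek_def)

abbreviation (input) tops :: "stacks \<Rightarrow> nat \<Rightarrow> nat" where
  "tops s \<equiv> \<lambda>i. peek (s i)"

text \<open>The counter is the exact number of steps of the compiled commands: a push takes two, a
  test one, and a sequence one more to discard the finished \<open>Skip\<close>.\<close>

inductive exec :: "cmd \<Rightarrow> stacks \<Rightarrow> nat \<Rightarrow> stacks \<Rightarrow> bool" where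
  exec_Skip: "exec Skip s 0 s"
| exec_Write: "exec (Write i a) s 1 (s(i := a # tl (s i)))"
| exec_Push: "exec (Push i f) s 2 (s(i := f (tops s) # s i))"
| exec_Assign: "exec (Assign i f) s 1 (s(i := f (tops s) # tl (s i)))"
| exec_Pop: "exec (Pop i) s 1 (s(i := tl (s i)))"
| exec_Seq: "exec c s m s' \<Longrightarrow> exec d s' n s'' \<Longrightarrow> exec (c ;; d) s (m + 1 + n) s''"
| exec_Cond: "exec (if b (tops s) then c else d) s n s' \<Longrightarrow> exec (Cond b c d) s (1 + n) s'"
| exec_While_end: "\<not> b (tops s) \<Longrightarrow> exec (While b c) s 1 s"
| exec_While: "b (tops s) \<Longrightarrow> exec (c ;; While b c) s n s' \<Longrightarrow> exec (While b c) s (1 + n) s'"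

fun wf_cmd :: "nat \<Rightarrow> nat \<Rightarrow> cmd \<Rightarrow> bool" where
  "wf_cmd k K Skip = True"
| "wf_cmd k K (Write i a) = (i < k \<and> a < K)"
| "wf_cmd k K (Push i f) = (i < k \<and> (\<forall>t. (\<forall>i. t i < K) \<longrightarrow> f t < K))"
| "wf_cmd k K (Assign i f) = (i < k \<and> (\<forall>t. (\<forall>i. t i < K) \<longrightarrow> f t < K))"
| "wf_cmd k K (Pop i) = (i < k)"
| "wf_cmd k K (Seq c d) = (wf_cmd k K c \<and> wf_cmd k K d)"
| "wf_cmd k K (Cond b c d) = (wf_cmd k K c \<and> wf_cmd k K d)"
| "wf_cmd k K (While b c) = wf_cmd k K c"

text \<open>The states of the machine are the commands that remain to be executed. A push takes two steps: the
  head leaves the old top first, and \<open>Write\<close> then carries the symbol in the state.\<close>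

fun control :: "cmd \<Rightarrow> (nat \<Rightarrow> nat) \<Rightarrow> cmd \<times> nat \<times> nat \<times> move" where
  "control Skip t = (Skip, 0, t 0, Stay)"
| "control (Write i a) t = (Skip, i, a, Stay)"
| "control (Push i f) t = (Write i (f t), i, t i, Move_Left)"
| "control (Assign i f) t = (Skip, i, f t, Stay)"
| "control (Pop i) t = (Skip, i, t i, Move_Right)"
| "control (Seq c d) t =
     (if c = Skip then (d, 0, t 0, Stay) else map_prod (\<lambda>c'. c' ;; d) id (control c t))"
| "control (Cond b c d) t = (if b t then c else d, 0, t 0, Stay)"
| "control (While b c) t = (if b t then c ;; While b c else Skip, 0, t 0, Stay)"

text \<open>A finite set closed under \<open>control\<close>. Unfolding a loop does not make it
  grow, because residuals of the body always stand in front of the same loop.\<close>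

fun residuals :: "nat \<Rightarrow> cmd \<Rightarrow> cmd set" where
  "residuals K Skip = {Skip}"
| "residuals K (Write i a) = {Write i a, Skip}"
| "residuals K (Push i f) = insert (Push i f) (insert Skip (Write i ` {..<K}))"
| "residuals K (Assign i f) = {Assign i f, Skip}"
| "residuals K (Pop i) = {Pop i, Skip}"
| "residuals K (Seq c d) = (\<lambda>c'. c' ;; d) ` residuals K c \<union> residuals K d"
| "residuals K (Cond b c d) = insert (Cond b c d) (residuals K c \<union> residuals K d)"
| "residuals K (While b c) =
     insert (While b c) (insert Skip ((\<lambda>c'. c' ;; While b c) ` residuals K c))"

lemma finite_residuals: "finite (residuals K c)"
  by (induction c) auto

lemma self_residual: "c \<in> residuals K c"
  by (induction c) auto

lemma Skip_residual: "Skip \<in> residuals K c"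
  by (induction c) auto

lemma residuals_closed:
  assumes "d \<in> residuals K c" "wf_cmd k K c" "\<forall>i. t i < K"
  shows "fst (control d t) \<in> residuals K c"
  using assms
proof (induction c arbitrary: d)
  case (Seq c1 c2)
  consider c' where "c' \<in> residuals K c1" "d = c' ;; c2" | "d \<in> residuals K c2"
    using Seq.prems(1) by auto
  then show ?case
  proof cases
    case 1
    then show ?thesis using Seq.IH(1)[of c'] Seq.prems self_residual by (auto simp: fst_map_prod)
  next
    case 2
    then show ?thesis using Seq by auto
  qed
next
  case (Cond b c1 c2)
  then show ?case using self_residual by auto
next
  case (While b c)
  consider c' where "c' \<in> residuals K c" "d = c' ;; While b c" | "d = While b c" | "d = Skip"
    using While.prems(1) by auto
  then show ?case
  proof cases
    case 1
    then show ?thesis using While.IH[of c'] While.prems self_residual by (auto simp: fst_map_prod)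
  qed (use self_residual in auto)
qed auto

lemma residuals_wf:
  assumes "d \<in> residuals K c" "wf_cmd k K c"
  shows "wf_cmd k K d"
  using assms by (induction c arbitrary: d) auto

lemma control_bounds:
  assumes "wf_cmd k K c" "\<forall>i. t i < K" "0 < k"
  shows "case control c t of (c', i, a, m) \<Rightarrow> i < k \<and> a < K"
  using assms by (induction c) (auto simp: case_prod_beta)

text \<open>The head is on the top element and the stack extends to the right of it, so stacks grow to the left
  and the initial input tape is the stack of all input symbols. Cells left of the head are garbage.\<close>

definition tape_rep :: "tape \<Rightarrow> nat list \<Rightarrow> bool" where
  "tape_rep tp xs \<longleftrightarrow> (\<forall>i. fst tp (snd tp + int i) = (if i < length xs then xs ! i else 0))"

text \<open>Stacks beyond the last tape are required to be empty so that the head symbols padded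
  with 0 by \<open>heads\<close> agree with the tops of all stacks.\<close>

definition tapes_rep :: "nat \<Rightarrow> tape list \<Rightarrow> stacks \<Rightarrow> bool" where
  "tapes_rep k ts s \<longleftrightarrow>
     length ts = k \<and> (\<forall>i<k. tape_rep (ts ! i) (s i)) \<and> (\<forall>i\<ge>k. s i = [])"

definition heads :: "nat list \<Rightarrow> nat \<Rightarrow> nat" where
  "heads ss i = (if i < length ss then ss ! i else 0)"

definition act_list :: "nat list \<Rightarrow> nat \<times> nat \<times> move \<Rightarrow> (nat \<times> move) list" where
  "act_list ss = (\<lambda>(i, a). (map (\<lambda>x. (x, Stay)) ss)[i := a])"

definition cmd_step :: "cmd \<times> tape list \<Rightarrow> cmd \<times> tape list" where
  "cmd_step = (\<lambda>(c, ts). let ss = map tape_read ts; (c', a) = control c (heads ss)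
     in (c', map2 tape_act (act_list ss a) ts))"

definition cmd_move :: "cmd \<times> tape list \<Rightarrow> cmd \<times> tape list \<Rightarrow> bool" where
  "cmd_move x y \<longleftrightarrow> fst x \<noteq> Skip \<and> y = cmd_step x"

lemma tape_act_Stay [simp]: "tape_act (tape_read tp, Stay) tp = tp"
  by (simp add: tape_act_def tape_read_def move_offset_def)

lemma act_list_single:
  assumes "i < length ts"
  shows "map2 tape_act (act_list (map tape_read ts) (i, a)) ts = ts[i := tape_act a (ts ! i)]"
  by (rule nth_equalityI) (use assms in \<open>auto simp: act_list_def nth_list_update\<close>)

lemma tape_rep_read: "tape_rep tp xs \<Longrightarrow> tape_read tp = peek xs"
  unfolding tape_rep_def tape_read_def peek_def
  by (drule spec[of _ 0]) (auto split: list.splits)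

lemma heads_tapes_rep: "tapes_rep k ts s \<Longrightarrow> heads (map tape_read ts) = tops s"
  by (auto simp: tapes_rep_def heads_def tape_rep_read)

lemma tape_rep_Assign: "tape_rep tp xs \<Longrightarrow> tape_rep (tape_act (a, Stay) tp) (a # tl xs)"
  unfolding tape_rep_def
  apply (clarsimp simp: tape_act_def move_offset_def)
  subgoal for i by (cases i; cases xs) (auto dest: spec[of _ i])
  done

lemma tape_rep_Pop:
  assumes "tape_rep tp xs"
  shows "tape_rep (tape_act (tape_read tp, Move_Right) tp) (tl xs)"
  unfolding tape_rep_def
proof
  fix i
  have "fst tp (snd tp + int (Suc i)) = (if Suc i < length xs then xs ! Suc i else 0)"
    using assms unfolding tape_rep_def by blast
  then show "fst (tape_act (tape_read tp, Move_Right) tp)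
      (snd (tape_act (tape_read tp, Move_Right) tp) + int i) =
      (if i < length (tl xs) then tl xs ! i else 0)"
    by (auto simp: tape_act_def move_offset_def tape_read_def nth_tl add_ac)
qed

lemma tape_rep_Push:
  assumes "tape_rep tp xs"
  shows "tape_rep (tape_act (a, Stay) (tape_act (tape_read tp, Move_Left) tp)) (a # xs)"
  unfolding tape_rep_def
proof
  fix i
  show "fst (tape_act (a, Stay) (tape_act (tape_read tp, Move_Left) tp))
      (snd (tape_act (a, Stay) (tape_act (tape_read tp, Move_Left) tp)) + int i) =
      (if i < length (a # xs) then (a # xs) ! i else 0)"
  proof (cases i)
    case (Suc j)
    then show ?thesis using assms spec[of _ j]
      by (auto simp: tape_act_def move_offset_def tape_read_def tape_rep_def)
  qed (simp add: tape_act_def move_offset_def)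
qed

lemma tapes_rep_update:
  assumes "tapes_rep k ts s" "i < k" "tape_rep tp xs"
  shows "tapes_rep k (ts[i := tp]) (s(i := xs))"
  using assms by (auto simp: tapes_rep_def nth_list_update)

lemma cmd_step_eq:
  assumes "tapes_rep k ts s" "control c (tops s) = (c', i, a)" "i < k"
  shows "cmd_step (c, ts) = (c', ts[i := tape_act a (ts ! i)])"
  using assms act_list_single[of i ts a]
  by (simp add: cmd_step_def heads_tapes_rep) (simp add: tapes_rep_def)

lemma cmd_step_quiet:
  assumes "tapes_rep k ts s" "control c (tops s) = (c', 0, peek (s 0), Stay)" "0 < k"
  shows "cmd_step (c, ts) = (c', ts)"
proof -
  have "tape_act (peek (s 0), Stay) (ts ! 0) = ts ! 0"
    using assms tape_rep_read[of "ts ! 0" "s 0"] by (metis tape_act_Stay tapes_rep_def)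
  then show ?thesis using cmd_step_eq[OF assms] by simp
qed

lemma cmd_move_Seq:
  "(cmd_move ^^ n) (c, ts) (c', ts') \<Longrightarrow> (cmd_move ^^ n) (c ;; d, ts) (c' ;; d, ts')"
proof (induction n arbitrary: c' ts')
  case (Suc n)
  then obtain c1 ts1 where "(cmd_move ^^ n) (c, ts) (c1, ts1)" "cmd_move (c1, ts1) (c', ts')"
    by auto
  moreover from this(2) have "cmd_move (c1 ;; d, ts1) (c' ;; d, ts')"
    by (auto simp: cmd_move_def cmd_step_def Let_def map_prod_def split: prod.splits)
  ultimately show ?case using Suc.IH by auto
qed auto

lemma relpowp_append: "(R ^^ m) x y \<Longrightarrow> (R ^^ n) y z \<Longrightarrow> (R ^^ (m + n)) x z"
  by (auto simp: relpowp_add)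

lemma exec_cmd_move:
  assumes "exec c s n s'" "wf_cmd k K c" "tapes_rep k ts s" "0 < k"
  shows "\<exists>ts'. (cmd_move ^^ n) (c, ts) (Skip, ts') \<and> tapes_rep k ts' s'"
  using assms
proof (induction arbitrary: ts)
  case (exec_Skip s)
  then show ?case by auto
next
  case (exec_Write i a s)
  then have "cmd_step (Write i a, ts) = (Skip, ts[i := tape_act (a, Stay) (ts ! i)])"
    by (intro cmd_step_eq) auto
  moreover have "tapes_rep k (ts[i := tape_act (a, Stay) (ts ! i)]) (s(i := a # tl (s i)))"
    using exec_Write by (intro tapes_rep_update tape_rep_Assign) (auto simp: tapes_rep_def)
  ultimately show ?case by (auto simp: cmd_move_def OO_def simp del: fun_upd_apply)
next
  case (exec_Push i f s)
  let ?a = "f (tops s)"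
  let ?tp = "tape_act (peek (s i), Move_Left) (ts ! i)"
  have "cmd_step (Push i f, ts) = (Write i ?a, ts[i := ?tp])"
    using exec_Push by (intro cmd_step_eq) auto
  moreover have len: "i < length ts" using exec_Push by (auto simp: tapes_rep_def)
  moreover have "cmd_step (Write i ?a, ts[i := ?tp]) = (Skip, ts[i := tape_act (?a, Stay) ?tp])"
    using len act_list_single[of i "ts[i := ?tp]"] by (simp add: cmd_step_def)
  moreover have "peek (s i) = tape_read (ts ! i)"
    using exec_Push tape_rep_read[of "ts ! i" "s i"] by (simp add: tapes_rep_def)
  then have "tapes_rep k (ts[i := tape_act (?a, Stay) ?tp]) (s(i := ?a # s i))"
    using exec_Push tape_rep_Push[of "ts ! i" "s i" ?a]
    by (intro tapes_rep_update) (auto simp: tapes_rep_def)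
  ultimately show ?case
    by (intro exI[of _ "ts[i := tape_act (?a, Stay) ?tp]"])
       (auto simp: cmd_move_def numeral_2_eq_2 OO_def simp del: fun_upd_apply)
next
  case (exec_Assign i f s)
  then have "cmd_step (Assign i f, ts) = (Skip, ts[i := tape_act (f (tops s), Stay) (ts ! i)])"
    by (intro cmd_step_eq) auto
  moreover have "tapes_rep k (ts[i := tape_act (f (tops s), Stay) (ts ! i)])
      (s(i := f (tops s) # tl (s i)))"
    using exec_Assign by (intro tapes_rep_update tape_rep_Assign) (auto simp: tapes_rep_def)
  ultimately show ?case by (auto simp: cmd_move_def OO_def simp del: fun_upd_apply)
next
  case (exec_Pop i s)
  then have "cmd_step (Pop i, ts) = (Skip, ts[i := tape_act (peek (s i), Move_Right) (ts ! i)])"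
    by (intro cmd_step_eq) auto
  moreover have "peek (s i) = tape_read (ts ! i)"
    using exec_Pop tape_rep_read[of "ts ! i" "s i"] by (simp add: tapes_rep_def)
  then have "tapes_rep k (ts[i := tape_act (peek (s i), Move_Right) (ts ! i)]) (s(i := tl (s i)))"
    using exec_Pop tape_rep_Pop[of "ts ! i" "s i"]
    by (intro tapes_rep_update) (auto simp: tapes_rep_def)
  ultimately show ?case by (auto simp: cmd_move_def OO_def simp del: fun_upd_apply)
next
  case (exec_Seq c s m s' d n s'')
  obtain ts1 where 1: "(cmd_move ^^ m) (c, ts) (Skip, ts1)" "tapes_rep k ts1 s'"
    using exec_Seq.IH(1)[of ts] exec_Seq.prems by auto
  obtain ts2 where 2: "(cmd_move ^^ n) (d, ts1) (Skip, ts2)" "tapes_rep k ts2 s''"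
    using exec_Seq.IH(2)[of ts1] exec_Seq.prems 1 by auto
  have "cmd_move (Skip ;; d, ts1) (d, ts1)"
    using cmd_step_quiet[OF 1(2), of "Skip ;; d" d] exec_Seq.prems by (simp add: cmd_move_def)
  then have "(cmd_move ^^ (m + 1)) (c ;; d, ts) (d, ts1)"
    using cmd_move_Seq[OF 1(1), of d] by auto
  from relpowp_append[OF this 2(1)] show ?case using 2(2) by blast
next
  case (exec_Cond b s c d n s')
  have "cmd_move (Cond b c d, ts) (if b (tops s) then c else d, ts)"
    using cmd_step_quiet[OF exec_Cond.prems(2), of "Cond b c d"] exec_Cond.prems
    by (simp add: cmd_move_def)
  moreover have "wf_cmd k K (if b (tops s) then c else d)" using exec_Cond.prems by simp
  with exec_Cond obtain ts' where
    "(cmd_move ^^ n) (if b (tops s) then c else d, ts) (Skip, ts')" "tapes_rep k ts' s'"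
    by blast
  ultimately show ?case by (auto intro!: exI[of _ ts'] relpowp_Suc_I2 simp del: relpowp.simps)
next
  case (exec_While_end b s c)
  have "cmd_move (While b c, ts) (Skip, ts)"
    using cmd_step_quiet[OF exec_While_end.prems(2), of "While b c"] exec_While_end
    by (simp add: cmd_move_def)
  then show ?case using exec_While_end by (auto simp: OO_def)
next
  case (exec_While b s c n s')
  have "cmd_move (While b c, ts) (c ;; While b c, ts)"
    using cmd_step_quiet[OF exec_While.prems(2), of "While b c"] exec_While
    by (simp add: cmd_move_def)
  moreover obtain ts' where "(cmd_move ^^ n) (c ;; While b c, ts) (Skip, ts')"
      "tapes_rep k ts' s'"
    using exec_While.IH[of ts] exec_While.prems by auto
  ultimately show ?case by (auto intro!: exI[of _ ts'] relpowp_Suc_I2 simp del: relpowp.simps)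
qed

section \<open>Numbering commands as machine states\<close>

definition state_index :: "nat \<Rightarrow> cmd \<Rightarrow> cmd \<Rightarrow> nat" where
  "state_index K c =
     (SOME h. bij_betw h (residuals K c) {0..<card (residuals K c)})"

lemma state_index_bij: "bij_betw (state_index K c) (residuals K c) {0..<card (residuals K c)}"
  unfolding state_index_def by (rule someI_ex[OF ex_bij_betw_finite_nat[OF finite_residuals]])

text \<open>The verdict is taken in one additional step from \<open>Skip\<close>, by reading tape
  \<open>v\<close>: the symbol 2 means acceptance. The two halting states are numbered after all
  commands.\<close>

definition compile :: "nat \<Rightarrow> nat \<Rightarrow> nat \<Rightarrow> cmd \<Rightarrow> tm" where
  "compile k K v c = (let R = residuals K c; r = card R in
     \<lparr>tm_tapes = k, tm_states = r + 2, tm_symbols = K, tm_start = state_index K c c,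
      tm_accept = r, tm_reject = Suc r,
      tm_delta = (\<lambda>q ss.
        if q < r then
          let d = inv_into R (state_index K c) q in
          if d = Skip then
            (if heads ss v = 2 then r else Suc r, map (\<lambda>x. (x, Stay)) ss)
          else (case control d (heads ss) of (d', a) \<Rightarrow> (state_index K c d', act_list ss a))
        else (q, map (\<lambda>x. (x, Stay)) ss))\<rparr>)"

lemma compile_simps [simp]:
  "tm_tapes (compile k K v c) = k"
  "tm_symbols (compile k K v c) = K"
  "tm_states (compile k K v c) = card (residuals K c) + 2"
  "tm_start (compile k K v c) = state_index K c c"
  "tm_accept (compile k K v c) = card (residuals K c)"
  "tm_reject (compile k K v c) = Suc (card (residuals K c))"
  by (simp_all add: compile_def Let_def)

lemma state_index_less: "d \<in> residuals K c \<Longrightarrow> state_index K c d < card (residuals K c)"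
  using bij_betwE[OF state_index_bij, of K c] by auto

lemma inv_state_index:
  "d \<in> residuals K c \<Longrightarrow> inv_into (residuals K c) (state_index K c) (state_index K c d) = d"
  using state_index_bij bij_betw_imp_inj_on inv_into_f_f by metis

lemma inv_state_index_in:
  "q < card (residuals K c) \<Longrightarrow> inv_into (residuals K c) (state_index K c) q \<in> residuals K c"
  using state_index_bij[of K c] by (intro inv_into_into) (auto simp: bij_betw_def)

lemma turing_machine_compile:
  assumes wf: "wf_cmd k K c" and K: "3 \<le> K" and k: "0 < k"
  shows "turing_machine (compile k K v c)"
proof -
  let ?R = "residuals K c" and ?M = "compile k K v c"
  have main: "fst (tm_delta ?M q ss) < card ?R + 2 \<and> length (snd (tm_delta ?M q ss)) = k \<and>
      (\<forall>(x, d) \<in> set (snd (tm_delta ?M q ss)). x < K)"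
    if q: "q < card ?R + 2" and ss: "length ss = k" "set ss \<subseteq> {..<K}" for q ss
  proof -
    let ?d = "inv_into ?R (state_index K c) q"
    show ?thesis
    proof (cases "q < card ?R \<and> ?d \<noteq> Skip")
      case True
      have t: "\<forall>i. heads ss i < K"
        using K subsetD[OF ss(2) nth_mem] by (auto simp: heads_def)
      obtain d' i a m where ctl: "control ?d (heads ss) = (d', i, a, m)" by (metis prod_cases4)
      have d: "?d \<in> ?R" using True inv_state_index_in by blast
      have "d' \<in> ?R" using residuals_closed[OF d wf t] ctl by simp
      then have "state_index K c d' < card ?R" by (rule state_index_less)
      moreover have "a < K" using control_bounds[OF residuals_wf[OF d wf] t k] ctl by auto
      then have "\<forall>(x, d) \<in> set (act_list ss (i, a, m)). x < K"
        using ss set_update_subset_insert[of "map (\<lambda>x. (x, Stay)) ss" i "(a, m)"]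
        by (auto simp: act_list_def)
      ultimately show ?thesis using True ctl ss
        by (simp add: compile_def Let_def) (simp add: act_list_def)
    next
      case False
      then show ?thesis using q ss by (auto simp: compile_def Let_def)
    qed
  qed
  have "state_index K c c < card ?R" by (rule state_index_less[OF self_residual])
  moreover have "\<forall>q < card ?R + 2. \<forall>ss. length ss = k \<and> set ss \<subseteq> {..<K} \<longrightarrow>
      fst (tm_delta ?M q ss) < card ?R + 2 \<and> length (snd (tm_delta ?M q ss)) = k \<and>
      (\<forall>(x, d) \<in> set (snd (tm_delta ?M q ss)). x < K)"
    using main by blast
  ultimately show ?thesis using K k unfolding turing_machine_def by simp
qed

text \<open>\<open>wf_cmd\<close> bounds the functions in commands only on symbols below
  \<open>K\<close>. All cells, garbage included, must therefore stay below \<open>K\<close> for the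
  state to remain a residual.\<close>

definition small_cells :: "nat \<Rightarrow> tape list \<Rightarrow> bool" where
  "small_cells K ts \<longleftrightarrow> (\<forall>tp\<in>set ts. \<forall>z. fst tp z < K)"

lemma small_cells_heads: "small_cells K ts \<Longrightarrow> 0 < K \<Longrightarrow> heads (map tape_read ts) i < K"
  by (auto simp: small_cells_def heads_def tape_read_def)

lemma cmd_step_invariant:
  assumes wf: "wf_cmd k K c" and K: "3 \<le> K" and k: "0 < k"
    and d: "d \<in> residuals K c" and ts: "small_cells K ts" "length ts = k"
    and step: "cmd_step (d, ts) = (d', ts')"
  shows "d' \<in> residuals K c" "small_cells K ts'" "length ts' = k"
proof -
  have t: "\<forall>i. heads (map tape_read ts) i < K" using small_cells_heads[OF ts(1)] K by simp
  obtain e i a m where ctl: "control d (heads (map tape_read ts)) = (e, i, a, m)"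
    by (metis prod_cases4)
  have ia: "i < k" "a < K" using control_bounds[OF residuals_wf[OF d wf] t k] ctl by auto
  have eq: "d' = e" "ts' = ts[i := tape_act (a, m) (ts ! i)]"
    using step ctl act_list_single[of i ts "(a, m)"] ia ts by (auto simp: cmd_step_def)
  show "d' \<in> residuals K c" using residuals_closed[OF d wf t] ctl eq by simp
  show "length ts' = k" using eq ts by simp
  show "small_cells K ts'"
  proof -
    have "\<forall>tp\<in>insert (tape_act (a, m) (ts ! i)) (set ts). \<forall>z. fst tp z < K"
      using ts ia by (auto simp: small_cells_def tape_act_def)
    then show ?thesis
      using set_update_subset_insert[of ts i "tape_act (a, m) (ts ! i)"]
      unfolding small_cells_def eq by blast
  qed
qed

lemma cmd_move_tm_step:
  assumes wf: "wf_cmd k K c" and K: "3 \<le> K" and k: "0 < k"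
    and "(cmd_move ^^ n) (c, ts) (d, ts')" "small_cells K ts" "length ts = k"
  shows "(tm_step (compile k K v c) ^^ n) (state_index K c c, ts) = (state_index K c d, ts') \<and>
    d \<in> residuals K c \<and> small_cells K ts' \<and> length ts' = k"
  using assms(4)
proof (induction n arbitrary: d ts')
  case 0
  then show ?case using assms self_residual by auto
next
  case (Suc n)
  then obtain d1 ts1 where 1: "(cmd_move ^^ n) (c, ts) (d1, ts1)" "cmd_move (d1, ts1) (d, ts')"
    by auto
  note IH = Suc.IH[OF 1(1)]
  have step: "d1 \<noteq> Skip" "cmd_step (d1, ts1) = (d, ts')" using 1(2) by (auto simp: cmd_move_def)
  have "state_index K c d1 < card (residuals K c)" using IH state_index_less by blast
  then have "tm_step (compile k K v c) (state_index K c d1, ts1) = (state_index K c d, ts')"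
    using step IH
    by (auto simp: tm_step_def compile_def Let_def inv_state_index cmd_step_def split: prod.splits)
  then show ?case using IH cmd_step_invariant[OF wf K k _ _ _ step(2)] by auto
qed

definition initial_stacks :: "bool list \<Rightarrow> stacks" where
  "initial_stacks w = (\<lambda>i. if i = 0 then map (\<lambda>b. if b then 2 else 1) w else [])"

lemma halted_fixed:
  assumes "fst x = tm_accept M \<or> fst x = tm_reject M"
  shows "(tm_step M ^^ n) x = x"
  using assms by (induction n) (auto simp: tm_step_def split: prod.splits)

lemma compile_correct:
  assumes wf: "wf_cmd k K c" and K: "3 \<le> K" and v: "v < k"
    and exec: "exec c (initial_stacks w) n s" and "n < T"
  shows "if peek (s v) = 2 then accepts_within (compile k K v c) w T
         else rejects_within (compile k K v c) w T"
proof -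
  let ?M = "compile k K v c" and ?ts = "input_tape w # replicate (k - 1) blank_tape"
  have k: "0 < k" using v by simp
  have "tape_rep (input_tape w) (initial_stacks w 0)"
    by (auto simp: tape_rep_def input_tape_def initial_stacks_def)
  moreover have "tape_rep blank_tape []" by (simp add: tape_rep_def blank_tape_def)
  ultimately have rep: "tapes_rep k ?ts (initial_stacks w)"
    using k by (auto simp: tapes_rep_def initial_stacks_def nth_Cons split: nat.splits)
  have cells: "small_cells K ?ts"
    using K by (auto simp: small_cells_def input_tape_def blank_tape_def)
  obtain ts where ts: "(cmd_move ^^ n) (c, ?ts) (Skip, ts)" "tapes_rep k ts s"
    using exec_cmd_move[OF exec wf rep k] by auto
  have run: "(tm_step ?M ^^ n) (state_index K c c, ?ts) = (state_index K c Skip, ts)"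
    using cmd_move_tm_step[OF wf K k ts(1) cells] k by auto
  have "heads (map tape_read ts) v = peek (s v)" using heads_tapes_rep[OF ts(2)] by simp
  moreover have "state_index K c Skip < card (residuals K c)"
    by (rule state_index_less[OF Skip_residual])
  ultimately have "fst (tm_step ?M (state_index K c Skip, ts)) =
      (if peek (s v) = 2 then tm_accept ?M else tm_reject ?M)"
    by (auto simp: tm_step_def compile_def Let_def inv_state_index[OF Skip_residual])
  moreover have "tm_initial ?M w = (state_index K c c, ?ts)" by (simp add: tm_initial_def)
  ultimately have fst: "fst ((tm_step ?M ^^ Suc n) (tm_initial ?M w)) =
      (if peek (s v) = 2 then tm_accept ?M else tm_reject ?M)"
    using run by simp
  define x where "x = (tm_step ?M ^^ Suc n) (tm_initial ?M w)"
  have "T = (T - Suc n) + Suc n" using \<open>n < T\<close> by simp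
  then have "(tm_step ?M ^^ T) (tm_initial ?M w) = (tm_step ?M ^^ (T - Suc n)) x"
    unfolding x_def by (metis comp_apply funpow_add)
  also have "\<dots> = x"
    by (rule halted_fixed) (use fst in \<open>simp add: x_def del: funpow.simps split: if_splits\<close>)
  finally show ?thesis
    using fst by (simp add: accepts_within_def rejects_within_def x_def del: funpow.simps)
qed

section \<open>Rules for upper bounds on running times\<close>

definition runs :: "cmd \<Rightarrow> stacks \<Rightarrow> nat \<Rightarrow> stacks \<Rightarrow> bool" where
  "runs c s T s' \<longleftrightarrow> (\<exists>n\<le>T. exec c s n s')"

fun straight :: "cmd \<Rightarrow> bool" where
  "straight (Seq c d) = (straight c \<and> straight d)"
| "straight (Cond b c d) = (straight c \<and> straight d)"
| "straight (While b c) = False"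
| "straight c = True"

fun effect :: "cmd \<Rightarrow> stacks \<Rightarrow> stacks" where
  "effect (Write i a) s = s(i := a # tl (s i))"
| "effect (Push i f) s = s(i := f (tops s) # s i)"
| "effect (Assign i f) s = s(i := f (tops s) # tl (s i))"
| "effect (Pop i) s = s(i := tl (s i))"
| "effect (Seq c d) s = effect d (effect c s)"
| "effect (Cond b c d) s = (if b (tops s) then effect c s else effect d s)"
| "effect _ s = s"

fun cost :: "cmd \<Rightarrow> nat" where
  "cost Skip = 0"
| "cost (Push i f) = 2"
| "cost (Seq c d) = cost c + 1 + cost d"
| "cost (Cond b c d) = 1 + max (cost c) (cost d)"
| "cost _ = 1"

lemma runs_mono: "runs c s T s' \<Longrightarrow> T \<le> T' \<Longrightarrow> runs c s T' s'"
  unfolding runs_def using le_trans by blast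

lemma runs_Seq: "runs c s T1 s1 \<Longrightarrow> runs d s1 T2 s2 \<Longrightarrow> runs (c ;; d) s (T1 + T2 + 1) s2"
  unfolding runs_def
proof (elim exE conjE)
  fix m n assume mn: "m \<le> T1" "n \<le> T2" and e: "exec c s m s1" "exec d s1 n s2"
  show "\<exists>n\<le>T1 + T2 + 1. exec (c ;; d) s n s2"
    by (rule exI[of _ "m + 1 + n"]) (use mn exec_Seq[OF e] in simp)
qed

lemma runs_Cond: "runs (if b (tops s) then c else d) s T s' \<Longrightarrow> runs (Cond b c d) s (T + 1) s'"
  unfolding runs_def by (metis exec_Cond add.commute add_le_cancel_right)

lemma runs_While_end: "\<not> b (tops s) \<Longrightarrow> runs (While b c) s 1 s"
  unfolding runs_def by (metis exec_While_end le_refl)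

lemma runs_While:
  assumes "b (tops s)" "runs c s T1 s1" "runs (While b c) s1 T2 s2"
  shows "runs (While b c) s (T1 + T2 + 2) s2"
proof -
  obtain n where n: "n \<le> T1 + T2 + 1" "exec (c ;; While b c) s n s2"
    using runs_Seq[OF assms(2,3)] by (auto simp: runs_def)
  from exec_While[of b s c n s2, OF assms(1) n(2)] n(1) show ?thesis
    unfolding runs_def by (intro exI[of _ "1 + n"]) auto
qed

lemma runs_straight: "straight c \<Longrightarrow> runs c s (cost c) (effect c s)"
proof (induction c arbitrary: s)
  case (Seq c d)
  then show ?case using runs_Seq[of c s "cost c" "effect c s" d "cost d"]
    by (auto simp: add_ac)
next
  case (Cond b c d)
  then have "runs (if b (tops s) then c else d) s (max (cost c) (cost d))
      (effect (Cond b c d) s)"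
    by (auto intro: runs_mono[OF _ max.cobounded1] runs_mono[OF _ max.cobounded2])
  from runs_Cond[of b s c d, OF this] show ?case by simp
next
  case Skip then show ?case by (auto simp: runs_def intro: exec.intros)
next
  case (Write i a) then show ?case by (auto simp: runs_def simp del: fun_upd_apply intro!: exec.intros exI[of _ 1])
next
  case (Push i f) then show ?case by (auto simp: runs_def simp del: fun_upd_apply intro!: exec.intros exI[of _ 2])
next
  case (Assign i f) then show ?case by (auto simp: runs_def simp del: fun_upd_apply intro!: exec.intros exI[of _ 1])
next
  case (Pop i) then show ?case by (auto simp: runs_def simp del: fun_upd_apply intro!: exec.intros exI[of _ 1])
qed simp

lemma runs_straight_to:
  "straight c \<Longrightarrow> effect c s = s' \<Longrightarrow> cost c \<le> T \<Longrightarrow> runs c s T s'"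
  using runs_straight runs_mono by blast

definition move_while :: "(nat \<Rightarrow> bool) \<Rightarrow> nat \<Rightarrow> nat \<Rightarrow> cmd" where
  "move_while P i j = While (\<lambda>t. P (t i)) (Push j (\<lambda>t. t i) ;; Pop i)"

text \<open>Each symbol costs 4 steps for the body and 2 for the loop. The moved segment is
  reversed, so a number keeps its bit order only after crossing an even number of tapes.\<close>

lemma runs_move_while:
  assumes "s i = xs @ r" "\<forall>x\<in>set xs. P x" "\<not> P (peek r)" "i \<noteq> j" "6 * length xs + 1 \<le> T"
  shows "runs (move_while P i j) s T (s(i := r, j := rev xs @ s j))"
proof -
  have "runs (move_while P i j) s (6 * length xs + 1) (s(i := r, j := rev xs @ s j))"
    using assms(1-4)
  proof (induction xs arbitrary: s)
    case Nil
    then have "s(i := r, j := rev [] @ s j) = s" by (auto simp: fun_eq_iff)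
    then show ?case using runs_While_end[of "\<lambda>t. P (t i)" s] Nil
      by (simp add: move_while_def del: fun_upd_apply)
  next
    case (Cons x xs)
    let ?s = "effect (Push j (\<lambda>t. t i) ;; Pop i) s"
    have si: "s i = x # xs @ r" using Cons.prems by simp
    then have s1: "?s = s(j := x # s j, i := xs @ r)"
      using Cons.prems(4) by (simp add: fun_eq_iff)
    have "runs (move_while P i j) ?s (6 * length xs + 1) (?s(i := r, j := rev xs @ ?s j))"
      using Cons.prems by (intro Cons.IH) (auto simp: s1)
    moreover have "?s(i := r, j := rev xs @ ?s j) = s(i := r, j := rev (x # xs) @ s j)"
      using Cons.prems(4) si by (auto simp: fun_eq_iff)
    moreover have "runs (Push j (\<lambda>t. t i) ;; Pop i) s 4 ?s" by (rule runs_straight_to) auto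
    ultimately show ?case using Cons.prems unfolding move_while_def
      using runs_While[of "\<lambda>t. P (t i)" s "Push j (\<lambda>t. t i) ;; Pop i" 4 ?s "6 * length xs + 1"]
      by (simp add: si del: fun_upd_apply effect.simps)
  qed
  then show ?thesis using assms(5) by (rule runs_mono)
qed

section \<open>Sorting the weight\<close>

definition is_bit :: "nat \<Rightarrow> bool" where
  "is_bit x \<longleftrightarrow> x = 1 \<or> x = 2"

text \<open>Blanks and separators count as the bit 0, so the shorter of two numbers is padded with
  leading zeros without special treatment.\<close>

definition bit_val :: "nat \<Rightarrow> nat" where
  "bit_val x = (if x = 2 then 1 else 0)"

definition to_bit :: "nat \<Rightarrow> nat" where
  "to_bit x = (if x = 2 then 2 else 1)"

text \<open>Bits 0 and 1 are the symbols 1 and 2, least significant bit first.\<close>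

fun bits_val :: "nat list \<Rightarrow> nat" where
  "bits_val [] = 0"
| "bits_val (x # xs) = bit_val x + 2 * bits_val xs"

abbreviation bits :: "nat list \<Rightarrow> bool" where
  "bits xs \<equiv> \<forall>x\<in>set xs. is_bit x"

text \<open>Padding makes representations non-unique, so the specifications below track values by
  \<open>bits_val\<close> and only bound lengths.\<close>

definition short :: "nat \<Rightarrow> nat list \<Rightarrow> bool" where
  "short W b \<longleftrightarrow> bits b \<and> length b \<le> W"

abbreviation move_bits :: "nat \<Rightarrow> nat \<Rightarrow> cmd" where
  "move_bits \<equiv> move_while is_bit"

text \<open>Tape 0 is the input and tape 1 is unused, which keeps \<open>Suc 0\<close> out of the tape numbers.
  \<open>rA\<close>: transcribed input; \<open>rS\<close>: sorted weight, largest part on top; \<open>rX\<close>: part being inserted;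
  \<open>rF\<close>: result of a comparison; \<open>rT\<close>, \<open>rM\<close>, \<open>rN\<close>, \<open>rU\<close>: scratch.\<close>

abbreviation (input) "rI \<equiv> 0::nat"
abbreviation (input) "rA \<equiv> 2::nat"
abbreviation (input) "rS \<equiv> 3::nat"
abbreviation (input) "rX \<equiv> 4::nat"
abbreviation (input) "rT \<equiv> 5::nat"
abbreviation (input) "rM \<equiv> 6::nat"
abbreviation (input) "rN \<equiv> 7::nat"
abbreviation (input) "rU \<equiv> 8::nat"
abbreviation (input) "rF \<equiv> 9::nat"

text \<open>Bits arrive least significant first, so a later difference overrides the verdict so far.
  The guarded pop protects the numbers stored below the current one on \<open>rS\<close>, whereas
  \<open>rX\<close> holds a single number and popping it when empty is harmless.\<close>

definition compare_loop :: cmd where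
  "compare_loop = While (\<lambda>t. is_bit (t rS) \<or> is_bit (t rX))
     (Assign rF (\<lambda>t. if bit_val (t rS) = bit_val (t rX) then t rF
                     else if bit_val (t rX) < bit_val (t rS) then 2 else 1) ;;
      Push rM (\<lambda>t. to_bit (t rS)) ;;
      Push rN (\<lambda>t. to_bit (t rX)) ;;
      Cond (\<lambda>t. is_bit (t rS)) (Pop rS) Skip ;;
      Pop rX)"

lemma not_bit_simps [simp]: "\<not> is_bit 0" "\<not> is_bit 3" "\<not> is_bit 4" "is_bit 1" "is_bit (Suc 0)" "is_bit 2"
  by (auto simp: is_bit_def)

lemma to_bit_simps [simp]: "is_bit (to_bit x)" "bit_val (to_bit x) = bit_val x"
  by (auto simp: to_bit_def is_bit_def bit_val_def)

lemma bits_val_tl: "bits_val xs = bit_val (peek xs) + 2 * bits_val (tl xs)"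
  by (cases xs) (auto simp: bit_val_def)

lemma bits_peek: "bits xs \<Longrightarrow> is_bit (peek xs) \<longleftrightarrow> xs \<noteq> []"
  by (cases xs) auto

lemma bits_tl: "bits xs \<Longrightarrow> bits (tl xs)"
  by (cases xs) auto

lemma bit_val_le: "bit_val x \<le> 1" by (simp add: bit_val_def)

lemma short_tl: "short (Suc n) b \<Longrightarrow> short n (tl b)"
  by (auto simp: short_def dest: bits_tl)

lemma short_0 [simp]: "short 0 b \<longleftrightarrow> b = []"
  by (auto simp: short_def)

lemma short_Nil [simp]: "short W []"
  by (auto simp: short_def)

lemma runs_compare_loop:
  assumes "s rS = b @ r" "\<not> is_bit (peek r)" "short n b" "short n x" "s rX = x" "s rF = [f]"
    "s rM = ms" "s rN = ns"
  shows "\<exists>b' x'. short n b' \<and> short n x' \<and>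
    bits_val b' = bits_val b \<and> bits_val x' = bits_val x \<and>
    runs compare_loop s (20 * n + 1) (s(rS := r, rX := [], rM := rev b' @ ms,
      rN := rev x' @ ns,
      rF := [if bits_val b = bits_val x then f
             else if bits_val x < bits_val b then 2 else 1]))"
  using assms
proof (induction n arbitrary: s b x f ms ns)
  case 0
  then have "s(rS := r, rX := [], rM := rev [] @ ms, rN := rev [] @ ns, rF := [f]) = s"
    by (auto simp: fun_eq_iff)
  moreover have "runs compare_loop s 1 s"
    unfolding compare_loop_def by (rule runs_While_end) (use 0 in auto)
  ultimately show ?case using 0 by (simp del: fun_upd_apply)
next
  case (Suc n)
  show ?case
  proof (cases "b = [] \<and> x = []")
    case True
    then have "s(rS := r, rX := [], rM := rev [] @ ms, rN := rev [] @ ns, rF := [f]) = s"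
      using Suc.prems by (auto simp: fun_eq_iff)
    moreover have "runs compare_loop s 1 s"
      unfolding compare_loop_def by (rule runs_While_end) (use Suc.prems True in auto)
    ultimately show ?thesis using True
      by (auto intro!: exI[of _ "[]"] intro: runs_mono simp del: fun_upd_apply)
  next
    case False
    let ?f = "if bit_val (peek b) = bit_val (peek x) then f
              else if bit_val (peek x) < bit_val (peek b) then 2 else 1"
    define s1 where "s1 = s(rF := [?f], rM := to_bit (peek b) # ms,
      rN := to_bit (peek x) # ns, rS := tl b @ r, rX := tl x)"
    have bb: "bits b" "bits x" using Suc.prems by (auto simp: short_def)
    have S: "bit_val (peek (b @ r)) = bit_val (peek b)" "to_bit (peek (b @ r)) = to_bit (peek b)"
        "is_bit (peek (b @ r)) \<longleftrightarrow> b \<noteq> []"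
        "b \<noteq> [] \<Longrightarrow> tl (b @ r) = tl b @ r"
      using Suc.prems(2) bb(1) by (cases b; auto simp: bit_val_def to_bit_def is_bit_def)+
    have "\<exists>b' x'. short n b' \<and> short n x' \<and>
        bits_val b' = bits_val (tl b) \<and> bits_val x' = bits_val (tl x) \<and>
      runs compare_loop s1 (20 * n + 1) (s1(rS := r, rX := [], rM := rev b' @ to_bit (peek b) # ms,
        rN := rev x' @ to_bit (peek x) # ns,
        rF := [if bits_val (tl b) = bits_val (tl x) then ?f
               else if bits_val (tl x) < bits_val (tl b) then 2 else 1]))"
      by (rule Suc.IH) (use Suc.prems in \<open>auto simp: s1_def short_tl\<close>)
    then obtain b' x' where IH: "short n b'" "short n x'"
        "bits_val b' = bits_val (tl b)" "bits_val x' = bits_val (tl x)" and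
      run: "runs compare_loop s1 (20 * n + 1) (s1(rS := r, rX := [],
        rM := rev b' @ to_bit (peek b) # ms,
        rN := rev x' @ to_bit (peek x) # ns,
        rF := [if bits_val (tl b) = bits_val (tl x) then ?f
               else if bits_val (tl x) < bits_val (tl b) then 2 else 1]))"
      by blast
    have fin: "s1(rS := r, rX := [], rM := rev b' @ to_bit (peek b) # ms,
        rN := rev x' @ to_bit (peek x) # ns,
        rF := [if bits_val (tl b) = bits_val (tl x) then ?f
               else if bits_val (tl x) < bits_val (tl b) then 2 else 1]) =
      s(rS := r, rX := [], rM := rev (to_bit (peek b) # b') @ ms,
        rN := rev (to_bit (peek x) # x') @ ns,
        rF := [if bits_val b = bits_val x then f
               else if bits_val x < bits_val b then 2 else 1])"
      using bit_val_le[of "peek b"] bit_val_le[of "peek x"]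
      unfolding s1_def bits_val_tl[of b] bits_val_tl[of x]
      by (intro ext) auto
    have "runs compare_loop s (20 * Suc n + 1) (s(rS := r, rX := [],
        rM := rev (to_bit (peek b) # b') @ ms,
        rN := rev (to_bit (peek x) # x') @ ns,
        rF := [if bits_val b = bits_val x then f
               else if bits_val x < bits_val b then 2 else 1]))"
      unfolding fin[symmetric] compare_loop_def
      apply (rule runs_mono, rule runs_While)
        apply (use False Suc.prems S bits_peek[OF bb(2)] in force)
       apply (rule runs_straight_to[of _ _ s1 17])
         apply simp
      subgoal using Suc.prems S False by (cases "b = []") (auto simp: s1_def fun_eq_iff)
       apply simp
       apply (rule run[unfolded compare_loop_def])
      apply simp
      done
    then show ?thesis
      using IH bits_val_tl[of b] bits_val_tl[of x]
      by (intro exI[of _ "to_bit (peek b) # b'"] exI[of _ "to_bit (peek x) # x'"])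
         (auto simp: short_def simp del: fun_upd_apply)
  qed
qed

text \<open>The larger number goes to \<open>rT\<close> and the smaller stays in \<open>rX\<close>.
  Comparison left both reversed on \<open>rM\<close> and \<open>rN\<close>, and moving them to
  \<open>rU\<close> and \<open>rX\<close> restores their order. The numbers on \<open>rT\<close>
  remain reversed until all of \<open>rT\<close> is moved back to \<open>rS\<close>.\<close>

definition compare_exchange :: cmd where
  "compare_exchange =
     (Pop rS ;; Assign rF (\<lambda>_. 1)) ;; compare_loop ;;
     Cond (\<lambda>t. t rF = 2) (move_bits rM rU ;; move_bits rN rX)
                         (move_bits rN rU ;; move_bits rM rX) ;;
     Push rT (\<lambda>_. 3) ;; move_bits rU rT"

lemma runs_move_bits:
  assumes "s i = xs @ r" "short W xs" "\<not> is_bit (peek r)" "i \<noteq> j"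
  shows "runs (move_bits i j) s (6 * W + 1) (s(i := r, j := rev xs @ s j))"
  by (rule runs_move_while) (use assms in \<open>auto simp: short_def\<close>)

lemma short_rev [simp]: "short W (rev b) \<longleftrightarrow> short W b"
  by (simp add: short_def)

lemma runs_compare_exchange:
  assumes "s rS = 3 # b @ r" "\<not> is_bit (peek r)" "short W b" "short W (s rX)"
    "tl (s rF) = []" "s rU = []" "s rM = []" "s rN = []"
  shows "\<exists>u x f. short W u \<and> short W x \<and>
    bits_val u = max (bits_val b) (bits_val (s rX)) \<and>
    bits_val x = min (bits_val b) (bits_val (s rX)) \<and>
    runs compare_exchange s (40 * W + 20)
      (s(rS := r, rX := x, rT := rev u @ 3 # s rT, rF := [f]))"
proof -
  define s1 where "s1 = s(rS := b @ r, rF := [1])"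
  have 1: "runs (Pop rS ;; Assign rF (\<lambda>_. 1)) s 3 s1"
    by (rule runs_straight_to) (use assms in \<open>auto simp: s1_def fun_eq_iff\<close>)
  let ?g = "if bits_val b = bits_val (s rX) then 1
            else if bits_val (s rX) < bits_val b then 2 else 1 :: nat"
  have "\<exists>b' x'. short W b' \<and> short W x' \<and>
      bits_val b' = bits_val b \<and> bits_val x' = bits_val (s rX) \<and>
    runs compare_loop s1 (20 * W + 1)
      (s1(rS := r, rX := [], rM := rev b' @ [], rN := rev x' @ [], rF := [?g]))"
    by (rule runs_compare_loop) (use assms in \<open>auto simp: s1_def\<close>)
  then obtain b' x' where bx: "short W b'" "short W x'"
      "bits_val b' = bits_val b" "bits_val x' = bits_val (s rX)" and
    2: "runs compare_loop s1 (20 * W + 1)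
      (s1(rS := r, rX := [], rM := rev b' @ [], rN := rev x' @ [], rF := [?g]))"
    by blast
  define s2 where "s2 = s1(rS := r, rX := [], rM := rev b' @ [], rN := rev x' @ [], rF := [?g])"
  define p where "p = (if bits_val (s rX) < bits_val b then (b', x') else (x', b'))"
  have s2: "s2 rF = [if bits_val (s rX) < bits_val b then 2 else 1]" "s2 rX = []" "s2 rU = []"
    "s2 rM = rev b'" "s2 rN = rev x'"
    using assms by (auto simp: s2_def s1_def)
  have p: "short W (fst p)" "short W (snd p)" "bits_val (fst p) = max (bits_val b) (bits_val (s rX))"
    "bits_val (snd p) = min (bits_val b) (bits_val (s rX))"
    using bx by (auto simp: p_def)
  define s3 where "s3 = s2(rM := [], rN := [], rU := fst p, rX := snd p)"
  have 3: "runs (Cond (\<lambda>t. t rF = 2) (move_bits rM rU ;; move_bits rN rX)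
                         (move_bits rN rU ;; move_bits rM rX)) s2 (12 * W + 4) s3"
  proof (cases "bits_val (s rX) < bits_val b")
    case True
    have "runs (move_bits rM rU ;; move_bits rN rX) s2 ((6 * W + 1) + (6 * W + 1) + 1)
      ((s2(rM := [], rU := rev (rev b') @ s2 rU))
        (rN := [], rX := rev (rev x') @ (s2(rM := [], rU := rev (rev b') @ s2 rU)) rX))"
      by (rule runs_Seq[OF runs_move_bits runs_move_bits]) (use s2 bx in auto)
    also have "(s2(rM := [], rU := rev (rev b') @ s2 rU))
        (rN := [], rX := rev (rev x') @ (s2(rM := [], rU := rev (rev b') @ s2 rU)) rX) = s3"
      using True s2 by (auto simp: fun_eq_iff s3_def p_def)
    finally show ?thesis using True s2
      by (intro runs_mono[OF runs_Cond[of _ s2 _ _ "6 * W + 1 + (6 * W + 1) + 1"]]) auto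
  next
    case False
    have "runs (move_bits rN rU ;; move_bits rM rX) s2 ((6 * W + 1) + (6 * W + 1) + 1)
      ((s2(rN := [], rU := rev (rev x') @ s2 rU))
        (rM := [], rX := rev (rev b') @ (s2(rN := [], rU := rev (rev x') @ s2 rU)) rX))"
      by (rule runs_Seq[OF runs_move_bits runs_move_bits]) (use s2 bx in auto)
    also have "(s2(rN := [], rU := rev (rev x') @ s2 rU))
        (rM := [], rX := rev (rev b') @ (s2(rN := [], rU := rev (rev x') @ s2 rU)) rX) = s3"
      using False s2 by (auto simp: fun_eq_iff s3_def p_def)
    finally show ?thesis using False s2
      by (intro runs_mono[OF runs_Cond[of _ s2 _ _ "6 * W + 1 + (6 * W + 1) + 1"]]) auto
  qed
  define s4 where "s4 = s3(rT := 3 # s3 rT)"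
  have 4: "runs (Push rT (\<lambda>_. 3)) s3 2 s4"
    by (rule runs_straight_to) (auto simp: s4_def)
  have 5: "runs (move_bits rU rT) s4 (6 * W + 1) (s4(rU := [], rT := rev (fst p) @ s4 rT))"
    by (rule runs_move_bits) (use p in \<open>auto simp: s4_def s3_def\<close>)
  have eq: "s4(rU := [], rT := rev (fst p) @ s4 rT) =
      s(rS := r, rX := snd p, rT := rev (fst p) @ 3 # s rT, rF := [?g])"
    using assms by (auto simp: fun_eq_iff s4_def s3_def s2_def s1_def)
  have "runs compare_exchange s (40 * W + 20)
      (s(rS := r, rX := snd p, rT := rev (fst p) @ 3 # s rT, rF := [?g]))"
    unfolding compare_exchange_def eq[symmetric]
    by (rule runs_mono[OF runs_Seq[OF 1 runs_Seq[OF 2[folded s2_def]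
        runs_Seq[OF 3 runs_Seq[OF 4 5]]]]]) simp
  then show ?thesis using p by blast
qed

text \<open>Each number is preceded by the separator 3, since the comma is the last symbol of a number to be
  pushed. Reversing the stack puts the separators behind and the most significant bits first.\<close>

definition encode_bits :: "nat list list \<Rightarrow> nat list" where
  "encode_bits bs = concat (map (\<lambda>b. 3 # b) bs)"

lemma encode_bits_simps [simp]:
  "encode_bits [] = []"
  "encode_bits (b # bs) = 3 # b @ encode_bits bs"
  "encode_bits (as @ bs) = encode_bits as @ encode_bits bs"
  by (simp_all add: encode_bits_def)

lemma peek_encode_bits: "peek (encode_bits bs @ r) = (if bs = [] then peek r else 3)"
  by (cases bs) auto

text \<open>Insertion by exchanging at every position, the minimum being carried on; each step has
  the same form and the pass never stops early.\<close>

fun insert_desc :: "nat \<Rightarrow> nat list \<Rightarrow> nat list" where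
  "insert_desc x [] = [x]"
| "insert_desc x (y # ys) = max y x # insert_desc (min y x) ys"

definition insert_pass :: cmd where
  "insert_pass = While (\<lambda>t. t rS = 3) compare_exchange"

lemma insert_pass:
  assumes "s rS = encode_bits bs" "\<forall>b\<in>set bs. short W b" "s rX = x" "short W x"
    "tl (s rF) = []" "s rU = []" "s rM = []" "s rN = []" "s rT = ts"
  shows "\<exists>bs' x' f. (\<forall>b\<in>set bs'. short W b) \<and> short W x' \<and> length bs' = length bs \<and> tl f = [] \<and>
    map bits_val (bs' @ [x']) = insert_desc (bits_val x) (map bits_val bs) \<and>
    runs insert_pass s (length bs * (40 * W + 22) + 1)
      (s(rS := [], rX := x', rT := rev (encode_bits bs') @ ts, rF := f))"
  using assms
proof (induction bs arbitrary: s x ts)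
  case Nil
  have "runs insert_pass s 1 s"
    unfolding insert_pass_def by (intro runs_While_end) (use Nil in auto)
  moreover have "s = s(rS := [], rX := x, rT := rev (encode_bits []) @ ts, rF := s rF)"
    using Nil by (auto simp: fun_eq_iff)
  ultimately have "runs insert_pass s 1
      (s(rS := [], rX := x, rT := rev (encode_bits []) @ ts, rF := s rF))"
    by (rule back_subst[of "runs insert_pass s 1"])
  then show ?case using Nil(4,5)
    by (intro exI[of _ "[]"] exI[of _ x] exI[of _ "s rF"]) (simp del: fun_upd_apply)
next
  case (Cons b bs)
  have "\<exists>u x' f. short W u \<and> short W x' \<and>
    bits_val u = max (bits_val b) (bits_val (s rX)) \<and>
    bits_val x' = min (bits_val b) (bits_val (s rX)) \<and>
    runs compare_exchange s (40 * W + 20)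
      (s(rS := encode_bits bs, rX := x', rT := rev u @ 3 # s rT, rF := [f]))"
    by (rule runs_compare_exchange) (use Cons.prems peek_encode_bits[of bs "[]"] in auto)
  then obtain u y f where 1: "short W u" "short W y"
    "bits_val u = max (bits_val b) (bits_val x)" "bits_val y = min (bits_val b) (bits_val x)"
    "runs compare_exchange s (40 * W + 20)
      (s(rS := encode_bits bs, rX := y, rT := rev u @ 3 # ts, rF := [f]))"
    using Cons.prems by metis
  define s1 where "s1 = s(rS := encode_bits bs, rX := y, rT := rev u @ 3 # ts, rF := [f])"
  have "\<exists>bs' x' f. (\<forall>b\<in>set bs'. short W b) \<and> short W x' \<and> length bs' = length bs \<and> tl f = [] \<and>
    map bits_val (bs' @ [x']) = insert_desc (bits_val y) (map bits_val bs) \<and>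
    runs insert_pass s1 (length bs * (40 * W + 22) + 1)
      (s1(rS := [], rX := x', rT := rev (encode_bits bs') @ rev u @ 3 # ts, rF := f))"
    by (rule Cons.IH) (use Cons.prems 1 in \<open>auto simp: s1_def\<close>)
  then obtain bs' x' f' where 2: "\<forall>b\<in>set bs'. short W b" "short W x'" "length bs' = length bs"
    "tl f' = []" "map bits_val (bs' @ [x']) = insert_desc (bits_val y) (map bits_val bs)"
    "runs insert_pass s1 (length bs * (40 * W + 22) + 1)
      (s1(rS := [], rX := x', rT := rev (encode_bits bs') @ rev u @ 3 # ts, rF := f'))"
    by blast
  have eq: "s1(rS := [], rX := x', rT := rev (encode_bits bs') @ rev u @ 3 # ts, rF := f') =
      s(rS := [], rX := x', rT := rev (encode_bits (u # bs')) @ ts, rF := f')"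
    by (auto simp: s1_def fun_eq_iff)
  have "runs insert_pass s (length (b # bs) * (40 * W + 22) + 1)
      (s(rS := [], rX := x', rT := rev (encode_bits (u # bs')) @ ts, rF := f'))"
    unfolding eq[symmetric] insert_pass_def
    by (rule runs_mono[OF runs_While[OF _ 1(5)[folded s1_def] 2(6)[unfolded insert_pass_def]]])
       (use Cons.prems in auto)
  then show ?case using 1 2
    by (intro exI[of _ "u # bs'"] exI[of _ x'] exI[of _ f']) (simp del: fun_upd_apply)
qed

definition insertion :: cmd where
  "insertion = While (\<lambda>t. t rA = 3)
     (Pop rA ;; move_bits rA rU ;; move_bits rU rX ;; insert_pass ;;
      Push rT (\<lambda>_. 3) ;; move_bits rX rT ;; move_while (\<lambda>x. x \<noteq> 0) rT rS)"

lemma length_encode_bits: "\<forall>b\<in>set bs. short W b \<Longrightarrow> length (encode_bits bs) \<le> length bs * (W + 1)"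
  by (induction bs) (auto simp: short_def)

lemma encode_bits_nonzero: "\<forall>b\<in>set bs. short W b \<Longrightarrow> \<forall>x\<in>set (encode_bits bs). x \<noteq> 0"
  by (induction bs) (auto simp: short_def is_bit_def)

lemma insertion:
  assumes "s rA = encode_bits as @ r" "peek r = 4" "\<forall>b\<in>set as. short W b"
    "s rS = encode_bits bs" "\<forall>b\<in>set bs. short W b"
    "s rX = []" "tl (s rF) = []" "s rU = []" "s rM = []" "s rN = []" "s rT = []"
    "length as + length bs \<le> B"
  shows "\<exists>bs' f. (\<forall>b\<in>set bs'. short W b) \<and> length bs' = length as + length bs \<and> tl f = [] \<and>
    map bits_val bs' = fold insert_desc (map bits_val as) (map bits_val bs) \<and>
    runs insertion s (length as * (100 * (B + 1) * (W + 1)) + 1)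
      (s(rA := r, rS := encode_bits bs', rF := f))"
  using assms
proof (induction as arbitrary: s bs)
  case Nil
  have "runs insertion s 1 s"
    unfolding insertion_def by (intro runs_While_end) (use Nil in auto)
  moreover have "s = s(rA := r, rS := encode_bits bs, rF := s rF)"
    using Nil by (auto simp: fun_eq_iff)
  ultimately have "runs insertion s 1 (s(rA := r, rS := encode_bits bs, rF := s rF))"
    by (rule back_subst[of "runs insertion s 1"])
  then show ?case using Nil
    by (intro exI[of _ bs] exI[of _ "s rF"]) (simp del: fun_upd_apply)
next
  case (Cons a as)
  define r' where "r' = encode_bits as @ r"
  have r': "\<not> is_bit (peek r')" using Cons.prems(2) by (auto simp: r'_def peek_encode_bits)
  define s1 where "s1 = s(rA := a @ r')"
  have 1: "runs (Pop rA) s 1 s1"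
    by (rule runs_straight_to) (use Cons.prems in \<open>auto simp: s1_def r'_def fun_eq_iff\<close>)
  define s2 where "s2 = s1(rA := r', rU := rev a @ s1 rU)"
  have 2: "runs (move_bits rA rU) s1 (6 * W + 1) s2"
    unfolding s2_def by (rule runs_move_bits) (use Cons.prems r' in \<open>auto simp: s1_def\<close>)
  define s3 where "s3 = s2(rU := [], rX := rev (rev a) @ s2 rX)"
  have 3: "runs (move_bits rU rX) s2 (6 * W + 1) s3"
    unfolding s3_def by (rule runs_move_bits) (use Cons.prems in \<open>auto simp: s1_def s2_def\<close>)
  have "\<exists>bs' x' f. (\<forall>b\<in>set bs'. short W b) \<and> short W x' \<and> length bs' = length bs \<and> tl f = [] \<and>
    map bits_val (bs' @ [x']) = insert_desc (bits_val a) (map bits_val bs) \<and>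
    runs insert_pass s3 (length bs * (40 * W + 22) + 1)
      (s3(rS := [], rX := x', rT := rev (encode_bits bs') @ [], rF := f))"
    by (rule insert_pass) (use Cons.prems in \<open>auto simp: s1_def s2_def s3_def\<close>)
  then obtain bs' x f where b: "\<forall>b\<in>set bs'. short W b" "short W x" "length bs' = length bs"
    "tl f = []" "map bits_val (bs' @ [x]) = insert_desc (bits_val a) (map bits_val bs)" and
    4: "runs insert_pass s3 (length bs * (40 * W + 22) + 1)
      (s3(rS := [], rX := x, rT := rev (encode_bits bs') @ [], rF := f))"
    by blast
  define s4 where "s4 = s3(rS := [], rX := x, rT := rev (encode_bits bs') @ [], rF := f)"
  define s5 where "s5 = s4(rT := 3 # s4 rT)"
  have 5: "runs (Push rT (\<lambda>_. 3)) s4 2 s5"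
    by (rule runs_straight_to) (auto simp: s5_def)
  define s6 where "s6 = s5(rX := [], rT := rev x @ s5 rT)"
  have 6: "runs (move_bits rX rT) s5 (6 * W + 1) s6"
    unfolding s6_def by (rule runs_move_bits) (use b in \<open>auto simp: s5_def s4_def\<close>)
  let ?bs = "bs' @ [x]"
  have s6: "s6 rT = rev (encode_bits ?bs)" "s6 rS = []" by (auto simp: s6_def s5_def s4_def)
  have bs: "\<forall>b\<in>set ?bs. short W b" "length ?bs = length bs + 1" using b by auto
  define s7 where "s7 = s6(rT := [], rS := rev (rev (encode_bits ?bs)) @ s6 rS)"
  have 7: "runs (move_while (\<lambda>x. x \<noteq> 0) rT rS) s6 (6 * ((length bs + 1) * (W + 1)) + 1) s7"
    unfolding s7_def
    by (rule runs_move_while)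
       (use s6 length_encode_bits[OF bs(1)] encode_bits_nonzero[OF bs(1)] bs(2) in auto)
  have s7: "s7 = s(rA := r', rS := encode_bits ?bs, rF := f)"
    using Cons.prems s6 by (auto simp: fun_eq_iff s7_def s6_def s5_def s4_def s3_def s2_def s1_def)
  have "\<exists>bs'' f'. (\<forall>b\<in>set bs''. short W b) \<and> length bs'' = length as + length ?bs \<and> tl f' = [] \<and>
    map bits_val bs'' = fold insert_desc (map bits_val as) (map bits_val ?bs) \<and>
    runs insertion s7 (length as * (100 * (B + 1) * (W + 1)) + 1)
      (s7(rA := r, rS := encode_bits bs'', rF := f'))"
    by (rule Cons.IH) (use Cons.prems b bs in \<open>auto simp: s7 r'_def\<close>)
  then obtain bs'' f' where c: "\<forall>b\<in>set bs''. short W b" "length bs'' = length as + length ?bs"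
    "tl f' = []" "map bits_val bs'' = fold insert_desc (map bits_val as) (map bits_val ?bs)" and
    8: "runs insertion s7 (length as * (100 * (B + 1) * (W + 1)) + 1)
      (s7(rA := r, rS := encode_bits bs'', rF := f'))"
    by blast
  have eq: "s7(rA := r, rS := encode_bits bs'', rF := f') = s(rA := r, rS := encode_bits bs'', rF := f')"
    by (auto simp: s7 fun_eq_iff)
  have "length bs * (40 * W + 22) \<le> B * (40 * (W + 1))"
    using Cons.prems(12) by (intro mult_mono) auto
  moreover have "(length bs + 1) * (W + 1) \<le> (B + 1) * (W + 1)"
    using Cons.prems(12) by (intro mult_right_mono) auto
  \<comment> \<open>The left side nests the bounds of the seven commands of the loop body; the 2
    subtracted on the right is the overhead that \<open>runs_While\<close> adds.\<close>
  ultimately have time: "1 + ((6 * W + 1) + ((6 * W + 1) + ((length bs * (40 * W + 22) + 1) +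
      (2 + ((6 * W + 1) + (6 * ((length bs + 1) * (W + 1)) + 1) + 1) + 1) + 1) + 1) + 1) + 1
      \<le> 100 * (B + 1) * (W + 1) - 2"
    by (simp add: algebra_simps)
  have "runs insertion s (length (a # as) * (100 * (B + 1) * (W + 1)) + 1)
      (s(rA := r, rS := encode_bits bs'', rF := f'))"
    unfolding eq[symmetric] insertion_def
    apply (rule runs_mono[OF runs_While[OF _
        runs_mono[OF runs_Seq[OF 1 runs_Seq[OF 2 runs_Seq[OF 3 runs_Seq[OF 4[folded s4_def]
        runs_Seq[OF 5 runs_Seq[OF 6 7]]]]]] time] 8[unfolded insertion_def]]])
    using Cons.prems by (auto simp: algebra_simps)
  then show ?case using c b by (intro exI[of _ bs''] exI[of _ f']) (auto simp del: fun_upd_apply)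
qed

section \<open>Scanning the partial sums\<close>

text \<open>\<open>rL\<close>: remaining parts of the partition; \<open>rP\<close>, \<open>rQ\<close>: current and previous part; \<open>rD\<close>: difference
  of the partial sums; \<open>rC\<close>: carry; \<open>rZ\<close>, \<open>rY\<close>: whether the difference is nonzero and whether the
  part has changed; \<open>rR\<close>: no violation so far; \<open>rV\<close>, \<open>rW\<close>: whether the last two partial sums were
  equal; \<open>rG\<close>: whether the current block has had a descent; \<open>rE\<close>, \<open>rB\<close>: scratch.\<close>

abbreviation (input) "rL \<equiv> 10::nat"
abbreviation (input) "rP \<equiv> 11::nat"
abbreviation (input) "rD \<equiv> 12::nat"
abbreviation (input) "rE \<equiv> 13::nat"
abbreviation (input) "rB \<equiv> 14::nat"
abbreviation (input) "rQ \<equiv> 15::nat"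
abbreviation (input) "rC \<equiv> 16::nat"
abbreviation (input) "rZ \<equiv> 17::nat"
abbreviation (input) "rY \<equiv> 18::nat"
abbreviation (input) "rR \<equiv> 19::nat"
abbreviation (input) "rV \<equiv> 20::nat"
abbreviation (input) "rW \<equiv> 21::nat"
abbreviation (input) "rG \<equiv> 22::nat"

text \<open>The carries -1, 0, 1 of \<open>rD + rP - rS\<close> are stored as 1, 2, 3. The total below is therefore too
  large by 2, which preserves its parity.\<close>

definition digit_total :: "(nat \<Rightarrow> nat) \<Rightarrow> nat" where
  "digit_total t = bit_val (t rD) + bit_val (t rP) + t rC - bit_val (t rS)"

text \<open>One pass forms the new difference on \<open>rE\<close>, records whether it is non-zero,
  compares the part with the previous one and copies it to \<open>rB\<close> as the next previous
  part. \<open>rC\<close> is updated after the other users of \<open>digit_total\<close>, which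
  reads it.\<close>

definition arith_loop :: cmd where
  "arith_loop = While (\<lambda>t. is_bit (t rD) \<or> is_bit (t rP) \<or> is_bit (t rS) \<or> is_bit (t rQ))
     (Push rE (\<lambda>t. if odd (digit_total t) then 2 else 1) ;;
      Push rB (\<lambda>t. to_bit (t rP)) ;;
      Assign rY (\<lambda>t. if bit_val (t rP) = bit_val (t rQ) then t rY else 2) ;;
      Assign rZ (\<lambda>t. if odd (digit_total t) then 2 else t rZ) ;;
      Assign rC (\<lambda>t. digit_total t div 2 + 1) ;;
      Cond (\<lambda>t. is_bit (t rS)) (Pop rS) Skip ;;
      Pop rD ;; Pop rP ;; Pop rQ)"

text \<open>With true carries \<open>c - 2\<close> and \<open>c' - 2\<close> the invariant says that
  \<open>out\<close> plus the weighted final carry is \<open>d + p - b\<close> plus the initial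
  carry. It is rearranged to avoid subtraction of natural numbers.\<close>

lemma arith_loop:
  assumes "s rS = b @ r" "\<not> is_bit (peek r)" "short n b"
    "s rD = d" "short n d" "s rP = p" "short n p" "s rQ = q" "short n q"
    "s rC = [c]" "c \<in> {1..3}" "s rZ = [z]" "s rY = [y]" "s rE = es" "s rB = bs"
  shows "\<exists>out p' c'. short n out \<and> short n p' \<and> bits_val p' = bits_val p \<and> c' \<in> {1..3} \<and>
    bits_val out + 2 ^ length out * c' + bits_val b + 2 =
      bits_val d + bits_val p + c + 2 * 2 ^ length out \<and>
    runs arith_loop s (30 * n + 1) (s(rS := r, rD := [], rP := [], rQ := [],
      rE := rev out @ es, rB := rev p' @ bs, rC := [c'],
      rZ := [if bits_val out = 0 then z else 2],
      rY := [if bits_val p = bits_val q then y else 2]))"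
  using assms
proof (induction n arbitrary: s b d p q c z y es bs)
  case 0
  have "runs arith_loop s 1 s"
    unfolding arith_loop_def by (rule runs_While_end) (use 0 in auto)
  moreover have "s = s(rS := r, rD := [], rP := [], rQ := [],
      rE := rev [] @ es, rB := rev [] @ bs, rC := [c], rZ := [z], rY := [y])"
    using 0 by (auto simp: fun_eq_iff)
  ultimately have "runs arith_loop s 1 (s(rS := r, rD := [], rP := [], rQ := [],
      rE := rev [] @ es, rB := rev [] @ bs, rC := [c], rZ := [z], rY := [y]))"
    by (rule back_subst[of "runs arith_loop s 1"])
  then show ?case using 0
    by (intro exI[of _ "[]"] exI[of _ c]) (simp del: fun_upd_apply)
next
  case (Suc n)
  show ?case
  proof (cases "b = [] \<and> d = [] \<and> p = [] \<and> q = []")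
    case True
    have "runs arith_loop s 1 s"
      unfolding arith_loop_def by (rule runs_While_end) (use Suc.prems True in auto)
    moreover have "s = s(rS := r, rD := [], rP := [], rQ := [],
        rE := rev [] @ es, rB := rev [] @ bs, rC := [c], rZ := [z], rY := [y])"
      using Suc.prems True by (auto simp: fun_eq_iff)
    ultimately have "runs arith_loop s 1 (s(rS := r, rD := [], rP := [], rQ := [],
        rE := rev [] @ es, rB := rev [] @ bs, rC := [c], rZ := [z], rY := [y]))"
      by (rule back_subst[of "runs arith_loop s 1"])
    then show ?thesis using Suc.prems True
      by (intro exI[of _ "[]"] exI[of _ c]) (auto simp del: fun_upd_apply intro: runs_mono)
  next
    case False
    define tot where "tot = bit_val (peek d) + bit_val (peek p) + c - bit_val (peek b)"
    define o1 where "o1 = (if odd tot then 2 else 1 :: nat)"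
    let ?c = "tot div 2 + 1"
    let ?z = "if odd tot then 2 else z"
    let ?y = "if bit_val (peek p) = bit_val (peek q) then y else 2"
    define s1 where "s1 = s(rE := o1 # es, rB := to_bit (peek p) # bs, rY := [?y], rZ := [?z],
      rC := [?c], rS := tl b @ r, rD := tl d, rP := tl p, rQ := tl q)"
    have bb: "bits b" "bits d" "bits p" "bits q" using Suc.prems by (auto simp: short_def)
    have S: "bit_val (peek (b @ r)) = bit_val (peek b)"
        "is_bit (peek (b @ r)) \<longleftrightarrow> b \<noteq> []"
      using Suc.prems(2) bb(1) by (cases b; auto simp: bit_val_def to_bit_def is_bit_def)+
    have le: "bit_val (peek d) \<le> 1" "bit_val (peek p) \<le> 1" "bit_val (peek b) \<le> 1"
      "bit_val (peek q) \<le> 1"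
      by (rule bit_val_le)+
    have tot: "tot + bit_val (peek b) = bit_val (peek d) + bit_val (peek p) + c"
      using le Suc.prems by (auto simp: tot_def)
    have c1: "?c \<in> {1..3}" using le Suc.prems tot by auto
    have "\<exists>out p' c'. short n out \<and> short n p' \<and> bits_val p' = bits_val (tl p) \<and> c' \<in> {1..3} \<and>
      bits_val out + 2 ^ length out * c' + bits_val (tl b) + 2 =
        bits_val (tl d) + bits_val (tl p) + ?c + 2 * 2 ^ length out \<and>
      runs arith_loop s1 (30 * n + 1) (s1(rS := r, rD := [], rP := [], rQ := [],
        rE := rev out @ o1 # es, rB := rev p' @ to_bit (peek p) # bs, rC := [c'],
        rZ := [if bits_val out = 0 then ?z else 2],
        rY := [if bits_val (tl p) = bits_val (tl q) then ?y else 2]))"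
      by (rule Suc.IH) (use Suc.prems c1 in \<open>auto simp: s1_def short_tl\<close>)
    then obtain out p' c' where IH: "short n out" "short n p'"
        "bits_val p' = bits_val (tl p)" "c' \<in> {1..3}"
        "bits_val out + 2 ^ length out * c' + bits_val (tl b) + 2 =
        bits_val (tl d) + bits_val (tl p) + ?c + 2 * 2 ^ length out" and
      run: "runs arith_loop s1 (30 * n + 1) (s1(rS := r, rD := [], rP := [], rQ := [],
        rE := rev out @ o1 # es, rB := rev p' @ to_bit (peek p) # bs, rC := [c'],
        rZ := [if bits_val out = 0 then ?z else 2],
        rY := [if bits_val (tl p) = bits_val (tl q) then ?y else 2]))"
      by blast
    have o1: "is_bit o1" "bit_val o1 = tot mod 2"
      by (auto simp: o1_def bit_val_def odd_iff_mod_2_eq_one)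
    have fin: "s1(rS := r, rD := [], rP := [], rQ := [],
        rE := rev out @ o1 # es, rB := rev p' @ to_bit (peek p) # bs, rC := [c'],
        rZ := [if bits_val out = 0 then ?z else 2],
        rY := [if bits_val (tl p) = bits_val (tl q) then ?y else 2]) =
      s(rS := r, rD := [], rP := [], rQ := [],
        rE := rev (o1 # out) @ es, rB := rev (to_bit (peek p) # p') @ bs, rC := [c'],
        rZ := [if bits_val (o1 # out) = 0 then z else 2],
        rY := [if bits_val p = bits_val q then y else 2])"
      using le o1 unfolding s1_def bits_val_tl[of p] bits_val_tl[of q]
      by (intro ext) (auto simp: odd_iff_mod_2_eq_one)
    have val: "bits_val (o1 # out) + 2 ^ length (o1 # out) * c' + bits_val b + 2 =
        bits_val d + bits_val p + c + 2 * 2 ^ length (o1 # out)"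
    proof -
      define td tm where "td = tot div 2" and "tm = tot mod 2"
      have "2 ^ length (o1 # out) * c' = 2 * (2 ^ length out * c')"
        "2 ^ length (o1 # out) = 2 * (2 ^ length out :: nat)"
        "tot = 2 * td + tm" "bits_val (o1 # out) = tm + 2 * bits_val out"
        using o1 by (simp_all add: td_def tm_def)
      moreover have "bits_val out + 2 ^ length out * c' + bits_val (tl b) + 2 =
          bits_val (tl d) + bits_val (tl p) + (td + 1) + 2 * 2 ^ length out"
        using IH(5) by (simp add: td_def)
      ultimately show ?thesis
        using tot bits_val_tl[of b] bits_val_tl[of d] bits_val_tl[of p] by linarith
    qed
    have "runs arith_loop s (30 * Suc n + 1) (s(rS := r, rD := [], rP := [], rQ := [],
        rE := rev (o1 # out) @ es, rB := rev (to_bit (peek p) # p') @ bs, rC := [c'],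
        rZ := [if bits_val (o1 # out) = 0 then z else 2],
        rY := [if bits_val p = bits_val q then y else 2]))"
      unfolding fin[symmetric] arith_loop_def
      apply (rule runs_mono, rule runs_While)
        apply (use False Suc.prems S bits_peek[OF bb(2)] bits_peek[OF bb(3)] bits_peek[OF bb(4)] in force)
       apply (rule runs_straight_to[of _ _ s1 28])
         apply simp
      subgoal using Suc.prems S False by (cases "b = []")
          (auto simp: s1_def fun_eq_iff digit_total_def tot_def o1_def)
       apply simp
       apply (rule run[unfolded arith_loop_def])
      apply simp
      done
    then show ?thesis
      using IH(1-4) val o1(1) bits_val_tl[of p]
      by (intro exI[of _ "o1 # out"] exI[of _ "to_bit (peek p) # p'"] exI[of _ c'])
         (auto simp: short_def simp del: fun_upd_apply)
  qed
qed

definition encode_msb :: "nat list list \<Rightarrow> nat list" where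
  "encode_msb bs = concat (map (\<lambda>b. rev b @ [3]) bs)"

definition flag :: "bool \<Rightarrow> nat" where
  "flag b = (if b then 2 else 1)"

lemma flag_simps [simp]: "flag b = 2 \<longleftrightarrow> b" "flag True = 2" "flag False = 1"
  by (auto simp: flag_def)

text \<open>The order matters: \<open>rR\<close> and \<open>rG\<close> use the old flags, and
  \<open>rW\<close> must copy \<open>rV\<close> before it is overwritten.\<close>

definition scan_flags :: cmd where
  "scan_flags =
     Assign rR (\<lambda>t. flag (t rR = 2 \<and>
       \<not> (t rY = 2 \<and> t rV \<noteq> 2 \<and> (t rG = 2 \<or> t rW \<noteq> 2 \<and> t rZ = 2)))) ;;
     Assign rG (\<lambda>t. flag (t rV \<noteq> 2 \<and> (t rG = 2 \<or> t rY = 2))) ;;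
     Assign rW (\<lambda>t. t rV) ;;
     Assign rV (\<lambda>t. flag (t rZ \<noteq> 2))"

definition scan_body :: cmd where
  "scan_body =
     (Pop rS ;; Assign rC (\<lambda>_. 2) ;; Assign rZ (\<lambda>_. 1) ;; Assign rY (\<lambda>_. 1)) ;;
     move_bits rL rP ;; Pop rL ;; arith_loop ;;
     Cond (\<lambda>t. t rC = 1) (Assign rR (\<lambda>_. 1))
       (Cond (\<lambda>t. t rC = 3) (Push rE (\<lambda>_. 2) ;; Assign rZ (\<lambda>_. 2)) Skip ;;
        move_bits rE rD ;; move_bits rB rQ ;; scan_flags)"

definition scan_loop :: cmd where
  "scan_loop = While (\<lambda>t. t rS = 3 \<and> t rR = 2) scan_body"

text \<open>A descent is noticed only when the next part is read, hence the flags for the last two positions.\<close>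

fun scan :: "nat \<Rightarrow> nat \<Rightarrow> bool \<Rightarrow> bool \<Rightarrow> bool \<Rightarrow> bool \<Rightarrow> nat list \<Rightarrow> nat list \<Rightarrow> bool" where
  "scan d q t1 t2 g ok lam [] = ok"
| "scan d q t1 t2 g ok lam (w # om) = (ok \<and> w \<le> d + peek lam \<and>
     (let d' = d + peek lam - w; desc = (peek lam \<noteq> q) in
      scan d' (peek lam) (d' = 0) t1 (\<not> t1 \<and> (g \<or> desc))
        (\<not> (desc \<and> \<not> t1 \<and> (g \<or> \<not> t2 \<and> d' \<noteq> 0))) (tl lam) om))"

definition scan_state :: "nat \<Rightarrow> nat \<Rightarrow> bool \<Rightarrow> bool \<Rightarrow> bool \<Rightarrow> bool \<Rightarrow> nat list list \<Rightarrow>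
    nat list list \<Rightarrow> nat \<Rightarrow> stacks \<Rightarrow> bool" where
  "scan_state d q t1 t2 g ok ls ws V s \<longleftrightarrow>
     s rS = encode_bits ws \<and> s rL = encode_msb ls \<and>
     (\<forall>b\<in>set ws. short V b) \<and> (\<forall>b\<in>set ls. short V b) \<and>
     short V (s rD) \<and> bits_val (s rD) = d \<and> short V (s rQ) \<and> bits_val (s rQ) = q \<and>
     s rP = [] \<and> s rE = [] \<and> s rB = [] \<and> tl (s rC) = [] \<and> tl (s rZ) = [] \<and> tl (s rY) = [] \<and>
     s rV = [flag t1] \<and> s rW = [flag t2] \<and> s rG = [flag g] \<and> s rR = [flag ok]"

lemma bits_val_less: "bits_val b < 2 ^ length b"
  by (induction b) (auto simp: bit_val_def)

lemma bits_val_append: "bits_val (a @ b) = bits_val a + 2 ^ length a * bits_val b"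
  by (induction a) (auto simp: algebra_simps)

lemma short_mono: "short V b \<Longrightarrow> V \<le> V' \<Longrightarrow> short V' b"
  by (auto simp: short_def)

text \<open>The difference gains at most one bit per part, from a final carry of 1, hence the width
  \<open>Suc V\<close> afterwards. A final carry of -1 means that dominance fails.\<close>

lemma scan_body:
  assumes st: "scan_state d q t1 t2 g True ls (w # ws) V s"
  defines "p \<equiv> peek (map bits_val ls)" and "wv \<equiv> bits_val w"
  shows "\<exists>s'. runs scan_body s (60 * V + 60) s' \<and>
    (if wv \<le> d + p then
       scan_state (d + p - wv) p (d + p = wv) t1 (\<not> t1 \<and> (g \<or> p \<noteq> q))
         (\<not> (p \<noteq> q \<and> \<not> t1 \<and> (g \<or> \<not> t2 \<and> d + p \<noteq> wv))) (tl ls) ws (Suc V) s'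
     else s' rR = [1])"
proof -
  note st' = st[unfolded scan_state_def]
  \<comment> \<open>When the partition is exhausted, the empty bit list stands for the part
    0.\<close>
  define pb where "pb = (case ls of [] \<Rightarrow> [] | l # _ \<Rightarrow> l)"
  define r where "r = (case ls of [] \<Rightarrow> [] | l # ls' \<Rightarrow> 3 # encode_msb ls')"
  have L: "s rL = rev pb @ r" "\<not> is_bit (peek r)" "short V pb" "tl r = encode_msb (tl ls)"
      "bits_val pb = p"
    using st' by (auto simp: pb_def r_def p_def encode_msb_def split: list.splits)
  define s1 where "s1 = s(rS := w @ encode_bits ws, rC := [2], rZ := [1], rY := [1])"
  have 1: "runs (Pop rS ;; Assign rC (\<lambda>_. 2) ;; Assign rZ (\<lambda>_. 1) ;; Assign rY (\<lambda>_. 1)) s 7 s1"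
    by (rule runs_straight_to) (use st' in \<open>auto simp: s1_def fun_eq_iff\<close>)
  define s2 where "s2 = s1(rL := r, rP := rev (rev pb) @ s1 rP)"
  have 2: "runs (move_bits rL rP) s1 (6 * V + 1) s2"
    unfolding s2_def by (rule runs_move_bits) (use L in \<open>auto simp: s1_def\<close>)
  define s3 where "s3 = s2(rL := encode_msb (tl ls))"
  have 3: "runs (Pop rL) s2 1 s3"
    by (rule runs_straight_to) (use L in \<open>auto simp: s2_def s3_def\<close>)
  have s3: "s3 rP = pb" using st' by (simp add: s3_def s2_def s1_def)
  have "\<exists>out p' c'. short V out \<and> short V p' \<and> bits_val p' = bits_val pb \<and> c' \<in> {1..3} \<and>
    bits_val out + 2 ^ length out * c' + bits_val w + 2 =
      bits_val (s rD) + bits_val pb + 2 + 2 * 2 ^ length out \<and>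
    runs arith_loop s3 (30 * V + 1) (s3(rS := encode_bits ws, rD := [], rP := [], rQ := [],
      rE := rev out @ [], rB := rev p' @ [], rC := [c'],
      rZ := [if bits_val out = 0 then 1 else 2],
      rY := [if bits_val pb = bits_val (s rQ) then 1 else 2]))"
    by (rule arith_loop)
       (use st' L s3 peek_encode_bits[of ws "[]"] in \<open>auto simp: s3_def s2_def s1_def\<close>)
  then obtain out p' c where o: "short V out" "short V p'" "bits_val p' = bits_val pb"
    "c \<in> {1..3}"
    "bits_val out + 2 ^ length out * c + bits_val w + 2 =
      bits_val (s rD) + bits_val pb + 2 + 2 * 2 ^ length out" and
    4: "runs arith_loop s3 (30 * V + 1) (s3(rS := encode_bits ws, rD := [], rP := [], rQ := [],
      rE := rev out @ [], rB := rev p' @ [], rC := [c],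
      rZ := [if bits_val out = 0 then 1 else 2],
      rY := [if bits_val pb = bits_val (s rQ) then 1 else 2]))"
    by blast
  have "bits_val (s rD) = d" using st' by simp
  with o L(5) have out: "short V out" "short V p'" "bits_val p' = p" "c \<in> {1..3}"
    "bits_val out + 2 ^ length out * c + wv = d + p + 2 * 2 ^ length out"
    by (simp_all add: wv_def)
  define s4 where "s4 = s3(rS := encode_bits ws, rD := [], rP := [], rQ := [],
      rE := rev out @ [], rB := rev p' @ [], rC := [c],
      rZ := [if bits_val out = 0 then 1 else 2],
      rY := [if bits_val pb = bits_val (s rQ) then 1 else 2])"
  let ?rest = "Cond (\<lambda>t. t rC = 3) (Push rE (\<lambda>_. 2) ;; Assign rZ (\<lambda>_. 2)) Skip ;;
        move_bits rE rD ;; move_bits rB rQ ;; scan_flags"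
  have "\<exists>s'. runs (Cond (\<lambda>t. t rC = 1) (Assign rR (\<lambda>_. 1)) ?rest) s4 (20 * V + 40) s' \<and>
    (if wv \<le> d + p then
       scan_state (d + p - wv) p (d + p = wv) t1 (\<not> t1 \<and> (g \<or> p \<noteq> q))
         (\<not> (p \<noteq> q \<and> \<not> t1 \<and> (g \<or> \<not> t2 \<and> d + p \<noteq> wv))) (tl ls) ws (Suc V) s'
     else s' rR = [1])"
  proof (cases "c = 1")
    case True
    have "runs (Assign rR (\<lambda>_. 1)) s4 1 (s4(rR := [1]))"
      by (rule runs_straight_to)
         (use st' in \<open>auto simp: s4_def s3_def s2_def s1_def fun_eq_iff\<close>)
    then have "runs (Cond (\<lambda>t. t rC = 1) (Assign rR (\<lambda>_. 1)) ?rest) s4 (20 * V + 40) (s4(rR := [1]))"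
      by (intro runs_mono[OF runs_Cond[of _ s4 _ _ 1]]) (use True in \<open>auto simp: s4_def\<close>)
    moreover have "\<not> wv \<le> d + p"
      using out(5) bits_val_less[of out] True by simp
    ultimately show ?thesis by (intro exI[of _ "s4(rR := [1])"]) simp
  next
    case False
    \<comment> \<open>The stored carry 3 is an actual carry of 1, and the symbol 2 is the bit
      1.\<close>
    define ob where "ob = (if c = 3 then out @ [2] else out)"
    have ob: "short (Suc V) ob" "bits_val ob + wv = d + p"
    proof -
      have "c = 2 \<or> c = 3" using out(4) False by auto
      then show "short (Suc V) ob" "bits_val ob + wv = d + p"
        using out by (auto simp: ob_def short_def bits_val_append bit_val_def)
    qed
    define s5 where "s5 = s4(rE := rev ob, rZ := [if bits_val ob = 0 then 1 else 2])"
    have 5: "runs (Cond (\<lambda>t. t rC = 3) (Push rE (\<lambda>_. 2) ;; Assign rZ (\<lambda>_. 2)) Skip) s4 10 s5"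
      by (rule runs_straight_to)
         (auto simp: s4_def s5_def ob_def fun_eq_iff bits_val_append bit_val_def)
    define s6 where "s6 = s5(rE := [], rD := rev (rev ob) @ s5 rD)"
    have 6: "runs (move_bits rE rD) s5 (6 * Suc V + 1) s6"
      unfolding s6_def by (rule runs_move_bits) (use ob in \<open>auto simp: s5_def\<close>)
    define s7 where "s7 = s6(rB := [], rQ := rev (rev p') @ s6 rQ)"
    have 7: "runs (move_bits rB rQ) s6 (6 * V + 1) s7"
      unfolding s7_def by (rule runs_move_bits) (use out in \<open>auto simp: s6_def s5_def s4_def\<close>)
    define s8 where "s8 = effect scan_flags s7"
    have 8: "runs scan_flags s7 7 s8"
      by (rule runs_straight_to) (auto simp: s8_def scan_flags_def)
    have "runs ?rest s4 (20 * V + 39) s8"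
      by (rule runs_mono[OF runs_Seq[OF 5 runs_Seq[OF 6 runs_Seq[OF 7 8]]]]) simp
    then have "runs (Cond (\<lambda>t. t rC = 1) (Assign rR (\<lambda>_. 1)) ?rest) s4 (20 * V + 40) s8"
      by (intro runs_mono[OF runs_Cond[of _ s4 _ _ "20 * V + 39"]])
         (use False in \<open>auto simp: s4_def\<close>)
    moreover have "wv \<le> d + p" using ob(2) by simp
    moreover have "scan_state (d + p - wv) p (d + p = wv) t1 (\<not> t1 \<and> (g \<or> p \<noteq> q))
         (\<not> (p \<noteq> q \<and> \<not> t1 \<and> (g \<or> \<not> t2 \<and> d + p \<noteq> wv))) (tl ls) ws (Suc V) s8"
    proof -
      have z: "bits_val ob = d + p - wv" "bits_val ob = 0 \<longleftrightarrow> d + p = wv" using ob(2) by auto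
      have sh: "\<forall>b\<in>set ws. short (Suc V) b" "\<forall>b\<in>set (tl ls). short (Suc V) b"
          "short (Suc V) p'"
        proof -
        show "\<forall>b\<in>set ws. short (Suc V) b" using st' short_mono[of V _ "Suc V"] by simp
        have "\<forall>b\<in>set ls. short (Suc V) b" using st' short_mono[of V _ "Suc V"] by simp
        then show "\<forall>b\<in>set (tl ls). short (Suc V) b" by (cases ls) simp_all
        show "short (Suc V) p'" using out(2) short_mono[of V _ "Suc V"] by simp
      qed
      have s7: "s7 rS = encode_bits ws" "s7 rL = encode_msb (tl ls)" "s7 rD = ob" "s7 rQ = p'"
        "s7 rP = []" "s7 rE = []" "s7 rB = []" "s7 rC = [c]"
        "s7 rZ = [if d + p = wv then 1 else 2]" "s7 rY = [if p = q then 1 else 2]"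
        "s7 rV = [flag t1]" "s7 rW = [flag t2]" "s7 rG = [flag g]" "s7 rR = [2]"
        using st' L(5) z by (auto simp: s7_def s6_def s5_def s4_def s3_def s2_def s1_def)
      have "s8 i = s7 i" if "i \<notin> {rR, rG, rW, rV}" for i
        using that by (simp add: s8_def scan_flags_def)
      moreover have "s8 rR = [flag (\<not> (p \<noteq> q \<and> \<not> t1 \<and> (g \<or> \<not> t2 \<and> d + p \<noteq> wv)))]"
        "s8 rG = [flag (\<not> t1 \<and> (g \<or> p \<noteq> q))]" "s8 rW = [flag t1]" "s8 rV = [flag (d + p = wv)]"
        by (simp_all add: s8_def scan_flags_def s7)
      ultimately show ?thesis unfolding scan_state_def
        using s7 sh ob(1) z out(3) by simp
    qed
    ultimately show ?thesis by (intro exI[of _ s8]) (simp del: fun_upd_apply)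
  qed
  then obtain s' where 5:
    "runs (Cond (\<lambda>t. t rC = 1) (Assign rR (\<lambda>_. 1)) ?rest) s4 (20 * V + 40) s'"
    "if wv \<le> d + p then
       scan_state (d + p - wv) p (d + p = wv) t1 (\<not> t1 \<and> (g \<or> p \<noteq> q))
         (\<not> (p \<noteq> q \<and> \<not> t1 \<and> (g \<or> \<not> t2 \<and> d + p \<noteq> wv))) (tl ls) ws (Suc V) s'
     else s' rR = [1]"
    by blast
  have "runs scan_body s (60 * V + 60) s'"
    unfolding scan_body_def
    by (rule runs_mono[OF runs_Seq[OF 1 runs_Seq[OF 2 runs_Seq[OF 3
        runs_Seq[OF 4[folded s4_def] 5(1)]]]]]) simp
  then show ?thesis using 5(2) by blast
qed

lemma scan_loop:
  assumes "scan_state d q t1 t2 g ok ls ws V s" "V + length ws \<le> B"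
  shows "\<exists>s'. runs scan_loop s (length ws * (60 * B + 62) + 1) s' \<and>
    (peek (s' rR) = 2 \<longleftrightarrow> scan d q t1 t2 g ok (map bits_val ls) (map bits_val ws))"
  using assms
proof (induction ws arbitrary: d q t1 t2 g ok ls V s)
  case Nil
  have "runs scan_loop s 1 s"
    unfolding scan_loop_def by (rule runs_While_end) (use Nil in \<open>simp add: scan_state_def\<close>)
  then show ?case using Nil by (intro exI[of _ s]) (simp add: scan_state_def)
next
  case (Cons w ws)
  show ?case
  proof (cases ok)
    case False
    have "runs scan_loop s 1 s"
      unfolding scan_loop_def
      by (rule runs_While_end) (use Cons.prems False in \<open>simp add: scan_state_def\<close>)
    then have "runs scan_loop s (length (w # ws) * (60 * B + 62) + 1) s"
      by (rule runs_mono) simp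
    then show ?thesis using Cons.prems False by (intro exI[of _ s]) (simp add: scan_state_def)
  next
    case True
    let ?p = "peek (map bits_val ls)" and ?w = "bits_val w"
    let ?t = "\<not> t1 \<and> (g \<or> ?p \<noteq> q)"
    let ?ok = "\<not> (?p \<noteq> q \<and> \<not> t1 \<and> (g \<or> \<not> t2 \<and> d + ?p \<noteq> ?w))"
    have cond: "peek (s rS) = 3 \<and> peek (s rR) = 2"
      using Cons.prems True by (simp add: scan_state_def)
    have "scan_state d q t1 t2 g True ls (w # ws) V s" using Cons.prems(1) True by simp
    from scan_body[OF this] obtain s1 where s1: "runs scan_body s (60 * V + 60) s1"
      "if ?w \<le> d + ?p then
         scan_state (d + ?p - ?w) ?p (d + ?p = ?w) t1 ?t ?ok (tl ls) ws (Suc V) s1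
       else s1 rR = [1]"
      by blast
    have V: "60 * V + 60 \<le> 60 * B" and V': "Suc V + length ws \<le> B"
      using Cons.prems(2) by simp_all
    show ?thesis
    proof (cases "?w \<le> d + ?p")
      case ge: True
      then have st: "scan_state (d + ?p - ?w) ?p (d + ?p = ?w) t1 ?t ?ok (tl ls) ws (Suc V) s1"
        using s1(2) by simp
      obtain s2 where s2: "runs scan_loop s1 (length ws * (60 * B + 62) + 1) s2"
        "peek (s2 rR) = 2 \<longleftrightarrow> scan (d + ?p - ?w) ?p (d + ?p = ?w) t1 ?t ?ok
           (map bits_val (tl ls)) (map bits_val ws)"
        using Cons.IH[OF st V'] by blast
      have "runs scan_loop s (length (w # ws) * (60 * B + 62) + 1) s2"
        unfolding scan_loop_def
        by (rule runs_mono[OF runs_While[OF _ s1(1) s2(1)[unfolded scan_loop_def]]])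
           (use cond V in auto)
      moreover have eq: "(d + ?p - ?w = 0) = (d + ?p = ?w)" using ge by auto
      have "scan d q t1 t2 g ok (map bits_val ls) (map bits_val (w # ws)) =
          scan (d + ?p - ?w) ?p (d + ?p = ?w) t1 ?t ?ok (map bits_val (tl ls)) (map bits_val ws)"
        unfolding list.map scan.simps Let_def eq map_tl using ge True by (simp only: simp_thms)
      ultimately show ?thesis using s2(2) by blast
    next
      case less: False
      then have stop: "runs scan_loop s1 1 s1"
        using s1(2) unfolding scan_loop_def by (intro runs_While_end) simp
      have "runs scan_loop s (length (w # ws) * (60 * B + 62) + 1) s1"
        unfolding scan_loop_def
        by (rule runs_mono[OF runs_While[OF _ s1(1) stop[unfolded scan_loop_def]]])
           (use cond V in auto)
      then show ?thesis using less True s1(2) by (intro exI[of _ s1]) simp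
    qed
  qed
qed

section \<open>The decision program\<close>

text \<open>The letters 0, 1, comma, semicolon become the symbols 1, 2, 3, 4.\<close>

definition transcode :: cmd where
  "transcode = While (\<lambda>t. t rI \<noteq> 0)
     (Assign rF (\<lambda>t. t rI) ;; Pop rI ;;
      Push rA (\<lambda>t. if t rF = 1 then (if t rI = 1 then 1 else 2)
                   else if t rI = 1 then 3 else 4) ;;
      Pop rI)"

definition letter :: "nat \<Rightarrow> nat list" where
  "letter x = (if x = 1 then [1, 1] else if x = 2 then [1, 2] else if x = 3 then [2, 1] else [2, 2])"

lemma letter_simps:
  "letter (Suc 0) = [1, 1]" "letter 2 = [1, 2]" "letter 3 = [2, 1]" "letter 4 = [2, 2]"
  by (simp_all add: letter_def)

lemma transcode:
  assumes "s rI = concat (map letter xs)" "\<forall>x\<in>set xs. 1 \<le> x \<and> x \<le> 4" "tl (s rF) = []"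
    "s rA = as"
  shows "\<exists>f. tl f = [] \<and> runs transcode s (12 * length xs + 1)
    (s(rI := [], rA := rev xs @ as, rF := f))"
  using assms
proof (induction xs arbitrary: s as)
  case Nil
  have "runs transcode s 1 s"
    unfolding transcode_def by (rule runs_While_end) (use Nil in auto)
  moreover have "s = s(rI := [], rA := rev [] @ as, rF := s rF)"
    using Nil by (auto simp: fun_eq_iff)
  ultimately have "runs transcode s 1 (s(rI := [], rA := rev [] @ as, rF := s rF))"
    by (rule back_subst[of "runs transcode s 1"])
  then show ?case using Nil by (intro exI[of _ "s rF"]) (simp del: fun_upd_apply)
next
  case (Cons x xs)
  define s1 where "s1 = s(rI := concat (map letter xs), rA := x # as, rF := [hd (letter x)])"
  have x: "x = 1 \<or> x = 2 \<or> x = 3 \<or> x = 4" using Cons.prems(2) by auto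
  have "\<exists>f. tl f = [] \<and> runs transcode s1 (12 * length xs + 1)
    (s1(rI := [], rA := rev xs @ x # as, rF := f))"
    by (rule Cons.IH) (use Cons.prems in \<open>auto simp: s1_def\<close>)
  then obtain f where f: "tl f = []" "runs transcode s1 (12 * length xs + 1)
    (s1(rI := [], rA := rev xs @ x # as, rF := f))" by blast
  have eq: "s1(rI := [], rA := rev xs @ x # as, rF := f) =
      s(rI := [], rA := rev (x # xs) @ as, rF := f)"
    by (auto simp: s1_def fun_eq_iff)
  have "runs transcode s (12 * length (x # xs) + 1) (s(rI := [], rA := rev (x # xs) @ as, rF := f))"
    unfolding eq[symmetric] transcode_def
    apply (rule runs_mono, rule runs_While)
       apply (use Cons.prems x in \<open>force simp: letter_simps\<close>)
      apply (rule runs_straight_to[of _ _ s1 9])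
        apply simp
    subgoal using Cons.prems x by (elim disjE) (auto simp: s1_def fun_eq_iff letter_simps)
      apply simp
     apply (rule f(2)[unfolded transcode_def])
    apply simp
    done
  then show ?case using f(1) by blast
qed

text \<open>Transcribing reverses the input onto \<open>rA\<close>: the final semicolon is on top,
  then the weight with least significant bits first, then the other semicolon and the partition. The
  last move restores the partition to reading order on \<open>rL\<close>. The initial flags describe
  position 0, where both partial sums are empty and equal.\<close>

definition decide :: cmd where
  "decide = transcode ;; Pop rA ;; insertion ;; Pop rA ;; move_while (\<lambda>x. x \<noteq> 0) rA rL ;;
     (Assign rR (\<lambda>_. 2) ;; Assign rV (\<lambda>_. 2) ;; Assign rW (\<lambda>_. 2) ;; Assign rG (\<lambda>_. 1)) ;;
     scan_loop"

text \<open>The tapes are numbered from 0 to 22; the five symbols are the blank, two bits, comma and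
  semicolon.\<close>

lemma wf_decide: "wf_cmd 23 5 decide"
proof -
  have "bit_val x \<le> 1" "to_bit x < 5" "flag b < 5" for x b
    by (auto simp: bit_val_def to_bit_def flag_def)
  moreover have "digit_total t div 2 + 1 < 5" if "\<forall>i. t i < 5" for t
    using that[rule_format, of rC] calculation(1)[of "t rD"] calculation(1)[of "t rP"]
    by (auto simp: digit_total_def)
  ultimately show ?thesis
    by (auto simp: decide_def transcode_def insertion_def move_while_def insert_pass_def
        compare_exchange_def compare_loop_def scan_loop_def scan_body_def scan_flags_def
        arith_loop_def)
qed

section \<open>The input encoding and the total running time\<close>

definition digits :: "nat \<Rightarrow> nat list" where
  "digits n = rev (map (\<lambda>b. if b then 2 else 1) (binary n))"

lemma bits_val_digits [simp]: "bits_val (digits n) = n"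
  unfolding digits_def
proof (induction n rule: binary.induct)
  case (1 n)
  show ?case
  proof (cases "n < 2")
    case True
    then show ?thesis by (subst binary.simps) (auto simp: bit_val_def)
  next
    case False
    have "bits_val (rev (map (\<lambda>b. if b then 2 else 1) (binary n))) =
        bit_val (if odd n then 2 else 1) + 2 * (n div 2)"
      using 1[OF False] by (subst binary.simps) (use False in auto)
    then show ?thesis by (auto simp: bit_val_def odd_two_times_div_two_succ)
  qed
qed

lemma bits_digits: "bits (digits n)"
  by (auto simp: digits_def)

definition symbols :: "nat list \<Rightarrow> nat list" where
  "symbols xs = encode_msb (map digits xs) @ [4]"

lemma letter_encode_nat:
  "map (\<lambda>b. if b then 2 else 1) (encode_nat n) = concat (map letter (rev (digits n) @ [3]))"
  by (auto simp: encode_nat_def digits_def letter_def map_concat comp_def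
      intro!: arg_cong[where f = concat])

lemma letter_encode_tuple:
  "map (\<lambda>b. if b then 2 else 1) (encode_tuple xs) = concat (map letter (symbols xs))"
proof -
  have "map (\<lambda>b. if b then 2 else 1) (concat (map encode_nat xs)) =
      concat (map letter (encode_msb (map digits xs)))"
  proof (induction xs)
    case (Cons a xs)
    then show ?case using letter_encode_nat[of a] by (simp add: encode_msb_def)
  qed (simp add: encode_msb_def)
  then show ?thesis by (simp add: encode_tuple_def symbols_def letter_def)
qed

lemma rev_encode_msb: "rev (encode_msb bs) = encode_bits (rev bs)"
  by (induction bs) (auto simp: encode_msb_def)

lemma rev_encode_bits: "rev (encode_bits bs) = encode_msb (rev bs)"
  using rev_encode_msb[of "rev bs"] by (metis rev_rev_ident)

lemma length_letters: "length (concat (map letter xs)) = 2 * length xs"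
  by (induction xs) (auto simp: letter_def)

lemma short_symbols: "b \<in> set (map digits xs) \<Longrightarrow> short (length (symbols xs)) b"
  by (induction xs) (auto simp: symbols_def encode_msb_def short_def bits_digits)

lemma length_symbols: "length xs \<le> length (symbols xs)"
  by (induction xs) (auto simp: symbols_def encode_msb_def)

lemma symbols_range: "\<forall>x\<in>set (symbols xs). 1 \<le> x \<and> x \<le> 4"
proof (induction xs)
  case (Cons a xs)
  have "\<forall>x\<in>set (digits a). 1 \<le> x \<and> x \<le> 4"
    using bits_digits[of a] by (auto simp: is_bit_def)
  moreover have "symbols (a # xs) = rev (digits a) @ 3 # symbols xs"
    by (simp add: symbols_def encode_msb_def)
  ultimately show ?case using Cons by (simp add: ball_Un)
qed (simp add: symbols_def encode_msb_def)

lemma length_encode_rev: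
  "length (encode_bits (map digits (rev xs))) = length (encode_msb (map digits xs))"
  by (metis length_rev rev_encode_msb rev_map)

text \<open>Once all products are expanded, the monomials in \<open>n\<close> can be treated as
  atoms of a linear inequality.\<close>

lemma decide_time:
  fixes a b l n :: nat
  assumes "a \<le> n * (100 * (n + 1) * (n + 1))" "b \<le> n * (60 * (2 * n) + 62)" "l \<le> n"
  shows "12 * l + 1 + (1 + (a + 1 + (1 + (6 * n + 1 + (7 + (b + 1) + 1) + 1) + 1) + 1) + 1) + 1
    \<le> 1000 * (n + 1) ^ 3"
proof -
  have "n * (100 * (n + 1) * (n + 1)) = 100 * (n * n * n) + 200 * (n * n) + 100 * n"
    "n * (60 * (2 * n) + 62) = 120 * (n * n) + 62 * n"
    "(n + 1) ^ 3 = n * n * n + 3 * (n * n) + 3 * n + 1"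
    by (simp_all add: power3_eq_cube algebra_simps)
  with assms show ?thesis by linarith
qed

lemma decide_runs:
  "\<exists>s. runs decide (initial_stacks (encode_input lam om)) (1000 * (input_size lam om + 1) ^ 3) s \<and>
    (peek (s rR) = 2 \<longleftrightarrow>
       scan 0 0 True True False True lam (fold insert_desc (rev om) []))"
proof -
  let ?N = "input_size lam om"
  let ?xs = "symbols lam @ symbols om"
  have I: "map (\<lambda>b. if b then 2 else 1) (encode_input lam om) = concat (map letter ?xs)"
    using letter_encode_tuple by (simp add: encode_input_def)
  have "length (map (\<lambda>b. if b then 2 else 1::nat) (encode_input lam om)) = 2 * length ?xs"
    unfolding I by (rule length_letters)
  then have len: "?N = 2 * length ?xs" by (simp add: input_size_def)
  have range: "\<forall>x\<in>set ?xs. 1 \<le> x \<and> x \<le> 4"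
    using symbols_range[of lam] symbols_range[of om] by (simp add: ball_Un)
  define s0 where "s0 = initial_stacks (encode_input lam om)"
  have s0: "s0 rI = concat (map letter ?xs)" "\<And>i. i \<noteq> 0 \<Longrightarrow> s0 i = []"
    using I by (auto simp: s0_def initial_stacks_def)
  have "\<exists>f. tl f = [] \<and> runs transcode s0 (12 * length ?xs + 1)
      (s0(rI := [], rA := rev ?xs @ [], rF := f))"
    by (rule transcode) (use s0 range in auto)
  then obtain f where f: "tl f = []" and 1: "runs transcode s0 (12 * length ?xs + 1)
      (s0(rI := [], rA := rev ?xs @ [], rF := f))"
    by blast
  define s1 where "s1 = s0(rI := [], rA := rev ?xs @ [], rF := f)"
  define r where "r = 4 # encode_bits (map digits (rev lam))"
  define s2 where "s2 = s1(rA := encode_bits (map digits (rev om)) @ r)"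
  have 2: "runs (Pop rA) s1 1 s2"
    by (rule runs_straight_to)
       (auto simp: s1_def s2_def symbols_def r_def rev_encode_msb rev_map)
  have "\<exists>bs' f. (\<forall>b\<in>set bs'. short ?N b) \<and>
      length bs' = length (map digits (rev om)) + length ([] :: nat list list) \<and> tl f = [] \<and>
    map bits_val bs' = fold insert_desc (map bits_val (map digits (rev om))) (map bits_val []) \<and>
    runs insertion s2 (length (map digits (rev om)) * (100 * (?N + 1) * (?N + 1)) + 1)
      (s2(rA := r, rS := encode_bits bs', rF := f))"
  proof (rule insertion)
    show "\<forall>b\<in>set (map digits (rev om)). short ?N b"
    proof
      fix b assume "b \<in> set (map digits (rev om))"
      then have "short (length (symbols om)) b" using short_symbols[of b om] by simp
      then show "short ?N b" by (rule short_mono) (use len in simp)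
    qed
  qed (use s0 f length_symbols[of om] len in \<open>auto simp: s2_def s1_def r_def\<close>)
  then obtain bs f' where bs: "\<forall>b\<in>set bs. short ?N b" "length bs = length om" "tl f' = []"
    "map bits_val bs = fold insert_desc (rev om) []" and
    3: "runs insertion s2 (length om * (100 * (?N + 1) * (?N + 1)) + 1)
      (s2(rA := r, rS := encode_bits bs, rF := f'))"
    by (auto simp: comp_def)
  define s3 where "s3 = s2(rA := r, rS := encode_bits bs, rF := f')"
  define s4 where "s4 = s3(rA := tl r)"
  have 4: "runs (Pop rA) s3 1 s4"
    by (rule runs_straight_to) (auto simp: s3_def s4_def)
  define s5 where "s5 = s4(rA := [], rL := rev (tl r) @ s4 rL)"
  have shl: "\<forall>b\<in>set (map digits lam). short ?N b"
  proof
    fix b assume "b \<in> set (map digits lam)"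
    then show "short ?N b" using short_mono[OF short_symbols[of b lam], of ?N] len by simp
  qed
  have 5: "runs (move_while (\<lambda>x. x \<noteq> 0) rA rL) s4 (6 * ?N + 1) s5"
    unfolding s5_def
  proof (rule runs_move_while)
    have "length (tl r) \<le> ?N"
      using len length_encode_rev[of lam] by (simp add: r_def symbols_def)
    then show "6 * length (tl r) + 1 \<le> 6 * ?N + 1" by simp
    show "\<forall>x\<in>set (tl r). x \<noteq> 0"
      using encode_bits_nonzero[of "map digits (rev lam)" ?N] shl by (auto simp: r_def)
  qed (auto simp: s4_def)
  define s6 where "s6 = s5(rR := [2], rV := [2], rW := [2], rG := [1])"
  have 6: "runs (Assign rR (\<lambda>_. 2) ;; Assign rV (\<lambda>_. 2) ;; Assign rW (\<lambda>_. 2) ;; Assign rG (\<lambda>_. 1))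
      s5 7 s6"
    by (rule runs_straight_to)
       (use s0 in \<open>auto simp: s6_def s5_def s4_def s3_def s2_def s1_def fun_eq_iff\<close>)
  have "scan_state 0 0 True True False True (map digits lam) bs ?N s6"
    unfolding scan_state_def using s0 bs shl rev_encode_bits[of "map digits (rev lam)"]
    by (simp add: s6_def s5_def s4_def s3_def s2_def s1_def r_def rev_map)
  \<comment> \<open>Numbers start with width at most \<open>?N\<close> and may grow by one bit per
    part, so width \<open>2 * ?N\<close> suffices throughout.\<close>
  moreover have "?N + length bs \<le> 2 * ?N" using bs(2) length_symbols[of om] len by simp
  ultimately obtain s7 where 7: "runs scan_loop s6 (length bs * (60 * (2 * ?N) + 62) + 1) s7"
    "peek (s7 rR) = 2 \<longleftrightarrow> scan 0 0 True True False True
       (map bits_val (map digits lam)) (map bits_val bs)"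
    using scan_loop by blast
  have om: "length om \<le> ?N" using length_symbols[of om] len by simp
  have time: "length om * (100 * (?N + 1) * (?N + 1)) \<le> ?N * (100 * (?N + 1) * (?N + 1))"
    "length bs * (60 * (2 * ?N) + 62) \<le> ?N * (60 * (2 * ?N) + 62)"
    using om bs(2) by (simp_all only: mult_right_mono)
  have "length ?xs \<le> ?N" using len by simp
  note time = decide_time[OF time this]
  have "runs decide s0 (1000 * (?N + 1) ^ 3) s7"
    unfolding decide_def
    by (rule runs_mono[OF runs_Seq[OF 1[folded s1_def] runs_Seq[OF 2 runs_Seq[OF 3[folded s3_def]
        runs_Seq[OF 4 runs_Seq[OF 5 runs_Seq[OF 6 7(1)]]]]]] time])
  then show ?thesis using 7(2) bs(4) unfolding s0_def
    by (intro exI[of _ s7]) (simp add: comp_def del: fun_upd_apply)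
qed

section \<open>Correctness of the scan\<close>

text \<open>The meaning of the flag \<open>rG\<close> before position \<open>k\<close> is read: the
  current run of strict inequalities already contains a descent.\<close>

definition chain :: "(nat \<Rightarrow> nat) \<Rightarrow> (nat \<Rightarrow> nat) \<Rightarrow> nat \<Rightarrow> bool" where
  "chain lam om k \<longleftrightarrow>
     (\<exists>d<k. descent lam d \<and> (\<forall>j. d \<le> j \<longrightarrow> j < k \<longrightarrow> psum om j < psum lam j))"

text \<open>The form in which \<open>slack\<close> is detected, at its later descent.\<close>

definition alarm :: "(nat \<Rightarrow> nat) \<Rightarrow> (nat \<Rightarrow> nat) \<Rightarrow> nat \<Rightarrow> bool" where
  "alarm lam om k \<longleftrightarrow> descent lam k \<and> psum om k < psum lam k \<and>
     (chain lam om k \<or>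
      psum om (k - 1) < psum lam (k - 1) \<and> psum om (Suc k) < psum lam (Suc k))"

lemma slack_alarm: "slack N lam om \<longleftrightarrow> (\<exists>k<N. alarm lam om k)"
proof
  assume "slack N lam om"
  then obtain d e where de: "d \<le> e" "e < N" "descent lam d" "descent lam e"
    and btw: "\<And>k. d \<le> k \<Longrightarrow> k \<le> e \<Longrightarrow> psum om k < psum lam k"
    and sngl: "d = e \<Longrightarrow> psum om (d - 1) < psum lam (d - 1) \<and> psum om (Suc d) < psum lam (Suc d)"
    unfolding slack_def by auto
  have "alarm lam om e"
  proof (cases "d = e")
    case True
    then show ?thesis using de btw sngl by (simp add: alarm_def)
  next
    case False
    then have "chain lam om e"
      unfolding chain_def using de btw by (intro exI[of _ d]) auto
    then show ?thesis using de btw by (simp add: alarm_def)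
  qed
  then show "\<exists>k<N. alarm lam om k" using de by blast
next
  assume "\<exists>k<N. alarm lam om k"
  then obtain k where k: "k < N" "descent lam k" "psum om k < psum lam k"
    and alt: "chain lam om k \<or>
      psum om (k - 1) < psum lam (k - 1) \<and> psum om (Suc k) < psum lam (Suc k)"
    unfolding alarm_def by blast
  from alt show "slack N lam om"
  proof
    assume "chain lam om k"
    then obtain d where d: "d < k" "descent lam d"
      "\<forall>j. d \<le> j \<longrightarrow> j < k \<longrightarrow> psum om j < psum lam j"
      unfolding chain_def by blast
    show ?thesis
      by (rule slackI2[OF d(1) k(1) d(2) k(2)]) (use d(3) k(3) le_neq_implies_less in blast)
  next
    assume "psum om (k - 1) < psum lam (k - 1) \<and> psum om (Suc k) < psum lam (Suc k)"
    then show ?thesis using slackI1[OF k] by blast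
  qed
qed

lemma chain_Suc:
  "chain lam om (Suc k) \<longleftrightarrow> psum om k < psum lam k \<and> (chain lam om k \<or> descent lam k)"
proof
  assume "chain lam om (Suc k)"
  then obtain d where d: "d \<le> k" "descent lam d"
    "\<And>j. d \<le> j \<Longrightarrow> j \<le> k \<Longrightarrow> psum om j < psum lam j"
    unfolding chain_def by (auto simp: less_Suc_eq_le)
  then have "d \<noteq> k \<Longrightarrow> chain lam om k" unfolding chain_def by (intro exI[of _ d]) auto
  then show "psum om k < psum lam k \<and> (chain lam om k \<or> descent lam k)" using d by auto
qed (auto simp: chain_def less_Suc_eq)

text \<open>Generalized to a scan resumed at position \<open>k\<close> with flags in their intended
  meaning. An alarm at \<open>k\<close> is decidable when part \<open>k\<close> is read, since the
  partial sums at \<open>Suc k\<close> are then known.\<close>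

lemma scan_correct:
  assumes "\<And>i. lam (Suc i) \<le> lam i"
    and "\<And>i. nth0 ls i = lam (k + i)" "\<And>i. i < length ws \<Longrightarrow> ws ! i = om (k + i)"
    and "feasible k lam om" "q = (if k = 0 then 0 else lam (k - 1))"
    and "t1 \<longleftrightarrow> psum lam k = psum om k" "k \<noteq> 0 \<Longrightarrow> t2 \<longleftrightarrow> psum lam (k - 1) = psum om (k - 1)"
    and "g \<longleftrightarrow> chain lam om k"
  shows "scan (psum lam k - psum om k) q t1 t2 g ok ls ws \<longleftrightarrow>
    ok \<and> feasible (k + length ws) lam om \<and> (\<forall>j. k \<le> j \<longrightarrow> j < k + length ws \<longrightarrow> \<not> alarm lam om j)"
  using assms(2-)
proof (induction ws arbitrary: k q t1 t2 g ok ls)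
  case Nil
  then show ?case by simp
next
  case (Cons w ws)
  let ?p = "peek ls" and ?D = "psum lam k - psum om k"
  have p: "?p = lam k" using Cons.prems(1)[of 0] by (cases ls) (auto simp: nth0_def)
  have w: "w = om k" using Cons.prems(2)[of 0] by simp
  have le: "psum om j \<le> psum lam j" if "j \<le> k" for j
    using Cons.prems(3) that by (simp add: feasible_def)
  have lek: "psum om k \<le> psum lam k" using le by simp
  show ?case
  proof (cases "w \<le> ?D + ?p")
    case False
    then have "\<not> psum om (Suc k) \<le> psum lam (Suc k)" using lek p w by simp
    then have "\<not> feasible (k + length (w # ws)) lam om"
      unfolding feasible_def by (auto simp del: sum.lessThan_Suc intro!: exI[of _ "Suc k"])
    then show ?thesis using False by simp
  next
    case True
    have D: "?D + ?p - w = psum lam (Suc k) - psum om (Suc k)"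
      using lek p w by simp
    have leS: "psum om (Suc k) \<le> psum lam (Suc k)" using True lek p w by simp
    have feasS: "feasible (Suc k) lam om"
      using leS Cons.prems(3) unfolding feasible_def by (metis le_Suc_eq)
    have zero: "(psum lam (Suc k) - psum om (Suc k) = 0) \<longleftrightarrow> psum lam (Suc k) = psum om (Suc k)"
      using leS by linarith
    have t1: "\<not> t1 \<longleftrightarrow> psum om k < psum lam k" using Cons.prems(5) lek by linarith
    \<comment> \<open>At position 0 the flag \<open>t1\<close> holds, and \<open>scan\<close>
      consults \<open>q\<close> and \<open>t2\<close> only if \<open>t1\<close> fails, so their
      initial values are harmless.\<close>
    have desc: "?p \<noteq> q \<longleftrightarrow> descent lam k" if "\<not> t1"
    proof -
      have "k \<noteq> 0" using that t1 by (cases k) auto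
      then show ?thesis using assms(1)[of "k - 1"] Cons.prems(4) p by (auto simp: descent_def)
    qed
    have t2: "\<not> t2 \<longleftrightarrow> psum om (k - 1) < psum lam (k - 1)" if "\<not> t1"
    proof -
      have "k \<noteq> 0" using that t1 by (cases k) auto
      then show ?thesis using Cons.prems(6) le[of "k - 1"] by linarith
    qed
    have g: "(\<not> t1 \<and> (g \<or> ?p \<noteq> q)) \<longleftrightarrow> chain lam om (Suc k)"
      unfolding chain_Suc using t1 desc Cons.prems(7) by blast
    have "psum lam (Suc k) \<noteq> psum om (Suc k) \<longleftrightarrow> psum om (Suc k) < psum lam (Suc k)"
      using leS by linarith
    then have alarm: "(?p \<noteq> q \<and> \<not> t1 \<and> (g \<or> \<not> t2 \<and> psum lam (Suc k) \<noteq> psum om (Suc k))) \<longleftrightarrow>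
        alarm lam om k"
      unfolding alarm_def using t1 t2 desc Cons.prems(7) by blast
    have "scan ?D q t1 t2 g ok ls (w # ws) \<longleftrightarrow> ok \<and>
        scan (psum lam (Suc k) - psum om (Suc k)) (lam k) (psum lam (Suc k) = psum om (Suc k)) t1
          (chain lam om (Suc k)) (\<not> alarm lam om k) (tl ls) ws"
      unfolding scan.simps Let_def D alarm g zero using True by (simp only: p simp_thms)
    also have "scan (psum lam (Suc k) - psum om (Suc k)) (lam k) (psum lam (Suc k) = psum om (Suc k)) t1
          (chain lam om (Suc k)) (\<not> alarm lam om k) (tl ls) ws \<longleftrightarrow>
        \<not> alarm lam om k \<and> feasible (Suc k + length ws) lam om \<and>
        (\<forall>j. Suc k \<le> j \<longrightarrow> j < Suc k + length ws \<longrightarrow> \<not> alarm lam om j)"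
    proof (rule Cons.IH)
      show "nth0 (tl ls) i = lam (Suc k + i)" for i
        using Cons.prems(1)[of "Suc i"] by (cases ls) (auto simp: nth0_def)
      show "i < length ws \<Longrightarrow> ws ! i = om (Suc k + i)" for i
        using Cons.prems(2)[of "Suc i"] by simp
    qed (use feasS Cons.prems(5) in auto)
    also have "ok \<and> (\<not> alarm lam om k \<and> feasible (Suc k + length ws) lam om \<and>
        (\<forall>j. Suc k \<le> j \<longrightarrow> j < Suc k + length ws \<longrightarrow> \<not> alarm lam om j)) \<longleftrightarrow>
      ok \<and> feasible (k + length (w # ws)) lam om \<and>
        (\<forall>j. k \<le> j \<longrightarrow> j < k + length (w # ws) \<longrightarrow> \<not> alarm lam om j)"
      by (auto simp: Suc_le_eq) (metis le_neq_implies_less)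
    finally show ?thesis .
  qed
qed

section \<open>The sorted weight and the final assembly\<close>

lemma mset_insert_desc: "mset (insert_desc x ys) = add_mset x (mset ys)"
  by (induction x ys rule: insert_desc.induct) (auto simp: max_def min_def)

lemma sorted_insert_desc: "sorted_wrt (\<ge>) ys \<Longrightarrow> sorted_wrt (\<ge>) (insert_desc x ys)"
proof (induction x ys rule: insert_desc.induct)
  case (2 x y ys)
  have "set (insert_desc (min y x) ys) = insert (min y x) (set ys)"
    using arg_cong[OF mset_insert_desc[of "min y x" ys], of set_mset] by simp
  then show ?case using 2 by (auto simp: le_max_iff_disj)
qed simp

lemma fold_insert_desc: "rev (fold insert_desc xs []) = sort xs"
proof -
  have "mset (fold insert_desc xs ys) = mset xs + mset ys \<and>
      (sorted_wrt (\<ge>) ys \<longrightarrow> sorted_wrt (\<ge>) (fold insert_desc xs ys))" for ys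
    by (induction xs arbitrary: ys) (auto simp: mset_insert_desc sorted_insert_desc)
  from this[of "[]"] show ?thesis
    by (intro properties_for_sort[symmetric]) (auto simp: sorted_wrt_rev)
qed

lemma scan_kostka:
  assumes lam: "partition_of n lam" and om: "composition_of n om"
  shows "scan 0 0 True True False True lam (fold insert_desc (rev om) []) \<longleftrightarrow> kostka lam om = 1"
proof -
  let ?ws = "fold insert_desc (rev om) []"
  let ?lam = "nth0 lam" and ?om = "nth0 ?ws" and ?N = "length ?ws"
  have rev: "rev ?ws = sort (rev om)" by (rule fold_insert_desc)
  have mset: "mset ?ws = mset om" using arg_cong[OF rev, of mset] by simp
  have sorted: "sorted_wrt (\<ge>) ?ws"
    using sorted_sort[of "rev om"] unfolding rev[symmetric] by (simp add: sorted_wrt_rev)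
  have slam: "sorted_wrt (\<ge>) lam" using lam by (simp add: partition_of_def)
  have dec: "nth0 xs (Suc i) \<le> nth0 xs i" if "sorted_wrt (\<ge>) xs" for xs i
    using that by (auto simp: nth0_def sorted_wrt_iff_nth_less)
  have sum_ws: "sum_list ?ws = n"
    using om mset by (metis composition_of_def sum_mset_sum_list)
  \<comment> \<open>\<open>patterns\<close> takes the weight in reverse, so the decreasing list
    \<open>?ws\<close> enters as the increasing list that \<open>patterns_sort\<close>
    produces.\<close>
  have "patterns ?lam (rev ?ws) = patterns ?lam (rev om)"
    unfolding rev by (rule patterns_sort)
  then have kostka: "kostka lam om = patterns ?lam (rev ?ws)"
    using kostka_patterns[OF slam] by simp
  have map: "map ?om [0..<?N] = ?ws"
    by (rule nth_equalityI) (auto simp: nth0_def)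
  have "scan (psum ?lam 0 - psum ?om 0) 0 True True False True lam ?ws \<longleftrightarrow>
      True \<and> feasible (0 + ?N) ?lam ?om \<and> (\<forall>j. 0 \<le> j \<longrightarrow> j < 0 + ?N \<longrightarrow> \<not> alarm ?lam ?om j)"
    by (rule scan_correct) (use dec[OF slam] in \<open>auto simp: feasible_def chain_def nth0_def\<close>)
  then have scan: "scan 0 0 True True False True lam ?ws \<longleftrightarrow>
      feasible ?N ?lam ?om \<and> \<not> slack ?N ?lam ?om"
    by (simp add: slack_alarm)
  have om_N: "psum ?om ?N = n" using sum_nth0[of ?ws ?N] sum_ws by simp
  have sum_lam: "sum_list lam = n" using lam by (simp add: partition_of_def)
  show ?thesis
  proof (cases "length lam \<le> ?N")
    case True
    have "psum ?lam ?N = psum ?om ?N" using sum_nth0[OF True] om_N sum_lam by simp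
    then have "patterns ?lam (rev (map ?om [0..<?N])) = 1 \<longleftrightarrow>
        feasible ?N ?lam ?om \<and> \<not> slack ?N ?lam ?om"
      using True by (intro patterns_criterion(2) dec slam sorted) (auto simp: nth0_def)
    then show ?thesis using scan kostka by (simp only: map)
  next
    \<comment> \<open>With more rows than letters there is no tableau. The scan agrees: the first
      \<open>?N\<close> rows miss at least one box, so the last dominance condition fails.\<close>
    case False
    then have pos: "0 < ?lam ?N" using lam by (simp add: partition_of_def nth0_def)
    then have "kostka lam om = 0"
      unfolding kostka by (intro patterns_zero[of _ ?N]) auto
    moreover have "psum ?lam (Suc ?N) \<le> psum ?lam (length lam)"
      using False by (intro sum_mono2) auto
    then have "\<not> psum ?om ?N \<le> psum ?lam ?N"
      using pos om_N sum_nth0[of lam "length lam"] sum_lam by simp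
    then have "\<not> feasible ?N ?lam ?om" by (auto simp: feasible_def)
    ultimately show ?thesis using scan by simp
  qed
qed

theorem corollary3p1:
  "\<exists>(M :: tm) (p :: nat poly). turing_machine M \<and>
     (\<forall>n lam om. partition_of n lam \<longrightarrow> composition_of n om \<longrightarrow>
        (if kostka lam om = 1
         then accepts_within M (encode_input lam om) (poly p (input_size lam om))
         else rejects_within M (encode_input lam om) (poly p (input_size lam om))))"
proof (intro exI conjI allI impI)
  \<comment> \<open>Tape 19 is \<open>rR\<close>. The summand 1 in the polynomial pays for the step
    that turns the finished program into a verdict.\<close>
  let ?M = "compile 23 5 19 decide" and ?p = "[:1:] + smult 1000 ([:1, 1:] ^ 3) :: nat poly"
  show "turing_machine ?M" by (rule turing_machine_compile[OF wf_decide]) simp_all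
  fix n lam om assume lo: "partition_of n lam" "composition_of n om"
  obtain s where s: "runs decide (initial_stacks (encode_input lam om))
      (1000 * (input_size lam om + 1) ^ 3) s"
    "peek (s 19) = 2 \<longleftrightarrow> kostka lam om = 1"
    using decide_runs[of lam om] scan_kostka[OF lo] by blast
  obtain t where t: "exec decide (initial_stacks (encode_input lam om)) t s"
    "t \<le> 1000 * (input_size lam om + 1) ^ 3"
    using s(1) unfolding runs_def by blast
  have "t < poly ?p (input_size lam om)" using t(2) by (simp add: poly_power add.commute)
  from compile_correct[OF wf_decide _ _ t(1) this, of 19] show "if kostka lam om = 1
         then accepts_within ?M (encode_input lam om) (poly ?p (input_size lam om))
         else rejects_within ?M (encode_input lam om) (poly ?p (input_size lam om))"
    unfolding s(2) by simp
qed

end
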